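(* Fix an integer $1\le n\leq 5$ and let $H$ be the dihedral group of order $2n$ generated by involutions $u$ and $v$. Suppose that $H$ acts simplicially on a systolic complex $X$ and let $a$ be a vertex in $X_u\cap X_v$. Then one of the following two statements is true: (1) The orbit $a^H$ spans a simplex. (2) The orbit $a^H$ forms an $|H|$-cycle $C$ without diagonals, and there exists a vertex $b$ in $X$ such that $b^H$ supports an $H$-stabilized simplex $\Sigma$ and such that the vertices of $C$ and the vertices of $\Sigma$ span a complete bipartite graph (i.e. every vertex of $C$ is adjacent to every vertex of $\Sigma$). Moreover, each vertex of $\Sigma$ is contained in $X_u\cap X_v$. If $n\in\{1,2\}$, only the first case occurs.
   Context: A flag simplicial complex is $k$-large ($k\ge4$) if every cycle of length at least $4$ and strictly less than $k$ has a diagonal, i.e. an edge of the complex connecting two nonconsecutive vertices of the cycle. A simplicial complex is systolic if it is connected, simply connected, and all its vertex links are $6$-large. Write $x^g$ for the image of a vertex $x$ under $g\in H$ and $x^H$ for its $H$-orbit; $a\sim b$ means that $a,b$ are joined by an edge. For an involution $u$ acting on $X$, the invariance set $X_u$ is the flag simplicial complex in $X$ spanned by those vertices $x$ with $x^u=x$ or $x^u\sim x$. An orbit "supports" a simplex $\Sigma$ if it is the vertex set of $\Sigma$; $\Sigma$ is $H$-stabilized if every element of $H$ maps it to itself setwise. *)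

theory Defs
  imports
    "HOL-Analysis.Analysis"
    "HOL-Algebra.Group_Action"
    "HOL-Algebra.Multiplicative_Group"
    "HOL-Algebra.Generated_Groups"
begin

text \<open>A complex is given by its set of (nonempty, finite) simplices, each simplex being its vertex
  set. There is no bound on the dimension and no local finiteness.\<close>

definition simplicial_complex :: "'v set set \<Rightarrow> bool" where
  "simplicial_complex K \<longleftrightarrow>
     (\<forall>\<sigma>\<in>K. finite \<sigma> \<and> \<sigma> \<noteq> {} \<and> (\<forall>\<tau>. \<tau> \<subseteq> \<sigma> \<and> \<tau> \<noteq> {} \<longrightarrow> \<tau> \<in> K))"

definition vertices :: "'v set set \<Rightarrow> 'v set" where
  "vertices K = \<Union>K"

definition adjacent :: "'v set set \<Rightarrow> 'v \<Rightarrow> 'v \<Rightarrow> bool" where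
  "adjacent K x y \<longleftrightarrow> x \<noteq> y \<and> {x, y} \<in> K"

definition link :: "'v set set \<Rightarrow> 'v \<Rightarrow> 'v set set" where
  "link K x = {\<sigma> \<in> K. x \<notin> \<sigma> \<and> insert x \<sigma> \<in> K}"

definition flag_complex :: "'v set set \<Rightarrow> bool" where
  "flag_complex K \<longleftrightarrow> simplicial_complex K \<and>
     (\<forall>S. finite S \<and> S \<noteq> {} \<and> S \<subseteq> vertices K \<and> (\<forall>x\<in>S. \<forall>y\<in>S. x \<noteq> y \<longrightarrow> adjacent K x y)
          \<longrightarrow> S \<in> K)"

text \<open>A cycle is listed by its pairwise distinct vertices, in cyclic order; the length of the list
  is the length of the cycle.\<close>

definition is_cycle :: "'v set set \<Rightarrow> 'v list \<Rightarrow> bool" where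
  "is_cycle K c \<longleftrightarrow> 3 \<le> length c \<and> distinct c \<and>
     (\<forall>i<length c. adjacent K (c ! i) (c ! (Suc i mod length c)))"

definition has_diagonal :: "'v set set \<Rightarrow> 'v list \<Rightarrow> bool" where
  "has_diagonal K c \<longleftrightarrow>
     (\<exists>i<length c. \<exists>j<length c. i \<noteq> j \<and> j \<noteq> Suc i mod length c \<and> i \<noteq> Suc j mod length c \<and>
        adjacent K (c ! i) (c ! j))"

definition large :: "nat \<Rightarrow> 'v set set \<Rightarrow> bool" where
  "large k K \<longleftrightarrow> flag_complex K \<and>
     (\<forall>c. is_cycle K c \<and> 4 \<le> length c \<and> length c < k \<longrightarrow> has_diagonal K c)"

text \<open>Points are given by barycentric coordinates. A closed simplex carries its Euclidean topology
  (the restriction of the product topology on functions, as only finitely many coordinates are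
  nonzero), and the realization carries the weak topology determined by its closed simplices.\<close>

definition closed_simplex :: "'v set \<Rightarrow> ('v \<Rightarrow> real) set" where
  "closed_simplex \<sigma> = {t. (\<forall>x. 0 \<le> t x) \<and> (\<forall>x. x \<notin> \<sigma> \<longrightarrow> t x = 0) \<and> sum t \<sigma> = 1}"

definition realization :: "'v set set \<Rightarrow> ('v \<Rightarrow> real) topology" where
  "realization K = topology (\<lambda>U. U \<subseteq> (\<Union>\<sigma>\<in>K. closed_simplex \<sigma>) \<and>
     (\<forall>\<sigma>\<in>K. openin (top_of_set (closed_simplex \<sigma>)) (U \<inter> closed_simplex \<sigma>)))"

lemma openin_realization:
  "openin (realization K) U \<longleftrightarrow> U \<subseteq> (\<Union>\<sigma>\<in>K. closed_simplex \<sigma>) \<and>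
     (\<forall>\<sigma>\<in>K. openin (top_of_set (closed_simplex \<sigma>)) (U \<inter> closed_simplex \<sigma>))"
proof -
  let ?P = "\<lambda>U. U \<subseteq> (\<Union>\<sigma>\<in>K. closed_simplex \<sigma>) \<and>
     (\<forall>\<sigma>\<in>K. openin (top_of_set (closed_simplex \<sigma>)) (U \<inter> closed_simplex \<sigma>))"
  have "istopology ?P"
    unfolding istopology_def
  proof (intro conjI allI impI)
    fix S T assume S: "?P S" and T: "?P T"
    have "openin (top_of_set (closed_simplex \<sigma>)) (S \<inter> T \<inter> closed_simplex \<sigma>)" if "\<sigma> \<in> K" for \<sigma>
    proof -
      have "S \<inter> T \<inter> closed_simplex \<sigma> = (S \<inter> closed_simplex \<sigma>) \<inter> (T \<inter> closed_simplex \<sigma>)"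
        by blast
      then show ?thesis using S T that by (metis openin_Int)
    qed
    then show "S \<inter> T \<subseteq> (\<Union>\<sigma>\<in>K. closed_simplex \<sigma>)"
      and "\<forall>\<sigma>\<in>K. openin (top_of_set (closed_simplex \<sigma>)) (S \<inter> T \<inter> closed_simplex \<sigma>)"
      using S by blast+
  next
    fix \<U> assume U: "\<forall>S\<in>\<U>. ?P S"
    have "openin (top_of_set (closed_simplex \<sigma>)) (\<Union>\<U> \<inter> closed_simplex \<sigma>)" if "\<sigma> \<in> K" for \<sigma>
    proof -
      have "\<Union>\<U> \<inter> closed_simplex \<sigma> = (\<Union>S\<in>\<U>. S \<inter> closed_simplex \<sigma>)"
        by blast
      moreover have "openin (top_of_set (closed_simplex \<sigma>)) (S \<inter> closed_simplex \<sigma>)"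
        if "S \<in> \<U>" for S
        using U that \<open>\<sigma> \<in> K\<close> by blast
      ultimately show ?thesis by (metis (no_types, lifting) imageE openin_Union)
    qed
    then show "\<Union>\<U> \<subseteq> (\<Union>\<sigma>\<in>K. closed_simplex \<sigma>)"
      and "\<forall>\<sigma>\<in>K. openin (top_of_set (closed_simplex \<sigma>)) (\<Union>\<U> \<inter> closed_simplex \<sigma>)"
      using U by blast+
  qed
  then show ?thesis
    unfolding realization_def by (simp add: topology_inverse')
qed

lemma topspace_realization: "topspace (realization K) = (\<Union>\<sigma>\<in>K. closed_simplex \<sigma>)"
proof -
  have "(\<Union>\<sigma>\<in>K. closed_simplex \<sigma>) \<inter> closed_simplex \<tau> = closed_simplex \<tau>" if "\<tau> \<in> K" for \<tau>
    using that by blast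
  then have "openin (realization K) (\<Union>\<sigma>\<in>K. closed_simplex \<sigma>)"
    by (simp add: openin_realization)
  then show ?thesis
    by (meson openin_realization openin_subset openin_topspace subset_antisym)
qed

text \<open>The analogue of \<^const>\<open>simply_connected\<close> for abstract topologies: any two loops are freely
  homotopic through loops. Constant loops being included, this entails path-connectedness.\<close>

definition simply_connected_space :: "'a topology \<Rightarrow> bool" where
  "simply_connected_space T \<longleftrightarrow>
     (\<forall>p q. pathin T p \<and> p 1 = p 0 \<and> pathin T q \<and> q 1 = q 0
        \<longrightarrow> homotopic_with (\<lambda>r. r 1 = r 0) (top_of_set {0..1}) T p q)"

lemma simply_connected_space_top_of_set:
  "simply_connected_space (top_of_set S) \<longleftrightarrow> simply_connected S"
proof -
  have "pathin (top_of_set S) p \<longleftrightarrow> path p \<and> path_image p \<subseteq> S" for p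
    by (auto simp: pathin_def path_def path_image_def)
  then show ?thesis
    unfolding simply_connected_space_def simply_connected_def homotopic_loops_def
      pathstart_def pathfinish_def by auto
qed

definition systolic :: "'v set set \<Rightarrow> bool" where
  "systolic K \<longleftrightarrow> simplicial_complex K \<and>
     connected_space (realization K) \<and> simply_connected_space (realization K) \<and>
     (\<forall>x\<in>vertices K. large 6 (link K x))"

text \<open>For n = 1 this is the group of order 2 with u = v, for n = 2 the Klein four-group. The
  conditions are redundant: two involutions whose product has order n > 0 generate a group of
  order 2n.\<close>

definition dihedral_generated_by :: "nat \<Rightarrow> ('g, 'm) monoid_scheme \<Rightarrow> 'g \<Rightarrow> 'g \<Rightarrow> bool" where
  "dihedral_generated_by n H u v \<longleftrightarrow> group H \<and> u \<in> carrier H \<and> v \<in> carrier H \<and>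
     group.ord H u = 2 \<and> group.ord H v = 2 \<and> group.ord H (u \<otimes>\<^bsub>H\<^esub> v) = n \<and>
     generate H {u, v} = carrier H \<and> order H = 2 * n"

text \<open>The image of x under g is written \<open>\<phi> g x\<close>. Actions in the library are left actions;
  passing from a right action to the left action of inverses changes neither the orbits, nor the
  setwise stabilizers, nor the action of an involution.\<close>

definition simplicial_action ::
    "('g, 'm) monoid_scheme \<Rightarrow> 'v set set \<Rightarrow> ('g \<Rightarrow> 'v \<Rightarrow> 'v) \<Rightarrow> bool" where
  "simplicial_action H K \<phi> \<longleftrightarrow> group_action H (vertices K) \<phi> \<and>
     (\<forall>g\<in>carrier H. \<forall>\<sigma>\<in>K. \<phi> g ` \<sigma> \<in> K)"

text \<open>For flag K, the full subcomplex on the given vertices is again flag.\<close>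

definition invariance_set :: "'v set set \<Rightarrow> ('v \<Rightarrow> 'v) \<Rightarrow> 'v set set" where
  "invariance_set K f = {\<sigma> \<in> K. \<forall>x\<in>\<sigma>. f x = x \<or> adjacent K (f x) x}"

end

theory Submission
  imports Defs
begin

text \<open>A systolic complex is its own universal cover. Building that cover ball by ball, the links being
  6-large, shows that the 1-skeleton of a systolic complex is a bridged graph: vertices at distance
  \<open>k + 1\<close> from a base point have pairwise adjacent neighbours at distance \<open>k\<close>, and the two ends of an edge
  have a common such neighbour. Simple connectivity enters through a fine subdivision of a
  contracting homotopy, whose rows are lifted to the cover one after the other.

  The orbit of \<open>a\<close> is a closed walk \<open>w 0, w 1, \<dots>\<close> of length \<open>2 * n\<close>, on which \<open>u\<close> and \<open>v\<close> act by
  \<open>i \<mapsto> 1 - i\<close> and \<open>i \<mapsto> - 1 - i\<close>. One diagonal produces all the others, because quadrangles and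
  pentagons have diagonals. If there is none, distances in the bridged graph produce a vertex \<open>b\<close> adjacent
  to five consecutive vertices of the cycle, for \<open>n = 5\<close> with the help of the symmetry. The orbit of
  \<open>b\<close> is then a clique, and transitivity makes each of its vertices adjacent to the whole cycle.\<close>

section \<open>Lifting closed edge paths\<close>

text \<open>Flagness is not part of \<open>systolic\<close>, and simple connectivity is known only
  for the realization with its weak topology. The cover handles both. Its balls grow by adding the
  neighbours that boundary vertices still lack, and the only choice is which missing neighbours to
  identify; that this identification is transitive rests on pentagons in links having diagonals.
  Once the cover is trivial it yields filled triangles as well as the two distance properties of
  balls. The bound on \<open>n\<close> enters twice. Diagonals of the orbit walk are spread by
  quadrangles and, for \<open>n = 5\<close>, by pentagons through the even vertices. A diagonal-free
  orbit cycle has length 6, 8 or 10: induced hexagons and heptagons have a vertex adjacent to all of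
  their vertices, and an octagon still has one adjacent to five consecutive vertices. For length 10
  the argument splits according to which vertices at index distance 3 have a common neighbour, and
  rotations make the answer depend only on a parity.\<close>

lemma simplicial_complex_face:
  assumes "simplicial_complex K" "\<sigma> \<in> K" "\<tau> \<subseteq> \<sigma>" "\<tau> \<noteq> {}"
  shows "\<tau> \<in> K"
  using assms unfolding simplicial_complex_def by blast

text \<open>The weak topology is made so that each closed simplex includes continuously.\<close>

lemma continuous_map_into_realization:
  assumes "continuous_map X (top_of_set (closed_simplex \<sigma>)) g" "\<sigma> \<in> K"
  shows "continuous_map X (realization K) g"
proof -
  have im: "g x \<in> closed_simplex \<sigma>" if "x \<in> topspace X" for x
    using continuous_map_image_subset_topspace[OF assms(1)] that by auto
  have "openin X {x \<in> topspace X. g x \<in> U}" if U: "openin (realization K) U" for U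
  proof -
    have "openin (top_of_set (closed_simplex \<sigma>)) (U \<inter> closed_simplex \<sigma>)"
      using U assms(2) unfolding openin_realization by blast
    then have "openin X {x \<in> topspace X. g x \<in> U \<inter> closed_simplex \<sigma>}"
      using assms(1) unfolding continuous_map by blast
    moreover have "{x \<in> topspace X. g x \<in> U \<inter> closed_simplex \<sigma>} = {x \<in> topspace X. g x \<in> U}"
      using im by blast
    ultimately show ?thesis by simp
  qed
  moreover have "g ` topspace X \<subseteq> topspace (realization K)"
    using im assms(2) unfolding topspace_realization by blast
  ultimately show ?thesis unfolding continuous_map by blast
qed

lemma openin_open_star: "openin (realization K) {q \<in> topspace (realization K). 0 < q x}"
  unfolding openin_realization
proof (intro conjI ballI)
  show "{q \<in> topspace (realization K). 0 < q x} \<subseteq> (\<Union>\<sigma>\<in>K. closed_simplex \<sigma>)"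
    unfolding topspace_realization by blast
  fix \<sigma> assume \<sigma>: "\<sigma> \<in> K"
  have "open {q :: 'a \<Rightarrow> real. 0 < q x}"
    by (intro open_Collect_less continuous_intros continuous_on_product_coordinates)
  moreover have "{q \<in> topspace (realization K). 0 < q x} \<inter> closed_simplex \<sigma> = closed_simplex \<sigma> \<inter> {q. 0 < q x}"
    using \<sigma> unfolding topspace_realization by blast
  ultimately show "openin (top_of_set (closed_simplex \<sigma>)) ({q \<in> topspace (realization K). 0 < q x} \<inter> closed_simplex \<sigma>)"
    by (metis openin_open)
qed

text \<open>Used to read simplices off a homotopy: open stars with a common point have centres that
  span a simplex.\<close>

lemma carrier_simplex:
  assumes "simplicial_complex K" "q \<in> topspace (realization K)" "S \<noteq> {}" "\<And>v. v \<in> S \<Longrightarrow> 0 < q v"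
  shows "S \<in> K"
proof -
  obtain \<sigma> where \<sigma>: "\<sigma> \<in> K" "q \<in> closed_simplex \<sigma>"
    using assms(2) unfolding topspace_realization by blast
  then have "S \<subseteq> \<sigma>"
    using assms(4) unfolding closed_simplex_def by fastforce
  then show ?thesis using simplicial_complex_face assms \<sigma> by blast
qed

lemma realization_positive_coordinate:
  assumes "q \<in> topspace (realization K)"
  shows "\<exists>x. 0 < q x"
proof (rule ccontr)
  assume *: "\<nexists>x. 0 < q x"
  obtain \<sigma> where \<sigma>: "\<sigma> \<in> K" "q \<in> closed_simplex \<sigma>"
    using assms unfolding topspace_realization by blast
  then have "q x = 0" for x using * unfolding closed_simplex_def by (force simp: not_less intro: antisym)
  then show False using \<sigma> unfolding closed_simplex_def by simp
qed

text \<open>The path that runs linearly from \<open>x k\<close> to \<open>x (k + 1)\<close> during the \<open>k\<close>-th of \<open>L\<close> equal time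
  intervals.\<close>

definition edge_path :: "nat \<Rightarrow> (nat \<Rightarrow> 'v) \<Rightarrow> real \<Rightarrow> 'v \<Rightarrow> real" where
  "edge_path L x t = (\<lambda>v. \<Sum>k\<le>L. of_bool (x k = v) * max 0 (1 - \<bar>real L * t - real k\<bar>))"

lemma edge_path_segment:
  assumes "k < L" "real k \<le> real L * t" "real L * t \<le> real (Suc k)"
  shows "edge_path L x t v =
    of_bool (x k = v) * (1 - (real L * t - real k)) + of_bool (x (Suc k) = v) * (real L * t - real k)"
proof -
  let ?f = "\<lambda>j. of_bool (x j = v) * max 0 (1 - \<bar>real L * t - real j\<bar>)"
  have "?f j = 0" if "j \<notin> {k, Suc k}" for j
  proof -
    have "real j \<le> real k - 1 \<or> real j \<ge> real k + 2"
      using that by (cases "j < k") auto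
    then show ?thesis using assms by auto
  qed
  then have "sum ?f {..L} = sum ?f {k, Suc k}"
    using assms(1) by (intro sum.mono_neutral_right) auto
  then show ?thesis
    using assms unfolding edge_path_def by auto
qed

lemma edge_path_in_simplex:
  assumes "k < L" "real k \<le> real L * t" "real L * t \<le> real (Suc k)"
  shows "edge_path L x t \<in> closed_simplex {x k, x (Suc k)}"
  using assms(2,3) unfolding closed_simplex_def
  by (cases "x k = x (Suc k)") (auto simp: edge_path_segment[OF assms])

lemma unit_interval_segment:
  assumes "0 < L" "0 \<le> t" "t \<le> 1"
  shows "\<exists>k<L. real k \<le> real L * t \<and> real L * t \<le> real (Suc k)"
proof (cases "t = 1")
  case True
  then show ?thesis using assms by (intro exI[of _ "L - 1"]) auto
next
  case False
  then have t: "real L * t < real L" "0 \<le> real L * t" using assms by auto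
  let ?k = "nat \<lfloor>real L * t\<rfloor>"
  have "?k < L" using t by linarith
  moreover have "real ?k \<le> real L * t \<and> real L * t \<le> real (Suc ?k)" using t by linarith
  ultimately show ?thesis by blast
qed

text \<open>Continuity in each coordinate does not suffice for the weak topology. The linear pieces,
  each inside one closed simplex, are pasted along finitely many closed time intervals
  instead.\<close>

lemma pathin_edge_path:
  assumes "0 < L" "\<And>k. k < L \<Longrightarrow> {x k, x (Suc k)} \<in> K"
  shows "pathin (realization K) (edge_path L x)"
  unfolding pathin_def
proof (rule pasting_lemma_closed[where I = "{..<L}" and f = "\<lambda>_. edge_path L x"
      and T = "\<lambda>k. {t. real k \<le> real L * t \<and> real L * t \<le> real (Suc k)} \<inter> {0..1}"])
  have closed: "closed {t. real k \<le> real L * t \<and> real L * t \<le> real (Suc k)}" for k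
    by (intro closed_Collect_conj closed_Collect_le continuous_intros)
  show "closedin (top_of_set {0..1}) ({t. real k \<le> real L * t \<and> real L * t \<le> real (Suc k)} \<inter> {0..1})" for k
    using closed by (simp add: closedin_closed_Int Int_commute)
  show "continuous_map (subtopology (top_of_set {0..1}) ({t. real k \<le> real L * t \<and> real L * t \<le> real (Suc k)} \<inter> {0..1}))
      (realization K) (edge_path L x)" if "k \<in> {..<L}" for k
  proof (rule continuous_map_into_realization)
    have "continuous_on UNIV (edge_path L x)"
      unfolding edge_path_def by (intro continuous_on_coordinatewise_then_product continuous_intros)
    then have "continuous_on T (edge_path L x)" for T
      using continuous_on_subset by blast
    then show "continuous_map (subtopology (top_of_set {0..1}) ({t. real k \<le> real L * t \<and> real L * t \<le> real (Suc k)} \<inter> {0..1}))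
      (top_of_set (closed_simplex {x k, x (Suc k)})) (edge_path L x)"
      using that edge_path_in_simplex[of k L _ x]
      by (auto simp: subtopology_subtopology)
  qed (use assms that in auto)
  show "\<exists>k. k \<in> {..<L} \<and> t \<in> {t. real k \<le> real L * t \<and> real L * t \<le> real (Suc k)} \<inter> {0..1} \<and> edge_path L x t = edge_path L x t"
    if "t \<in> topspace (top_of_set {0..1})" for t
    using unit_interval_segment[OF assms(1), of t] that by auto
qed auto

text \<open>A homotopy contracting a closed edge path, subdivided so finely that every small square is
  mapped into an open star; \<open>c i j\<close> is the centre of such a star.\<close>

lemma contraction_grid:
  fixes x :: "nat \<Rightarrow> 'v"
  assumes K: "simplicial_complex K" and sc: "simply_connected_space (realization K)"
    and L: "0 < L" and x: "\<And>k. k < L \<Longrightarrow> {x k, x (Suc k)} \<in> K" "x L = x 0"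
  obtains M N c where "0 < M" "N = L * M"
    "\<And>j. j < N \<Longrightarrow> {x (j div M), x (Suc j div M), c 0 j, c 0 (Suc j mod N)} \<in> K"
    "\<And>i j. Suc i < N \<Longrightarrow> j < N \<Longrightarrow>
      {c i j, c i (Suc j mod N), c (Suc i) j, c (Suc i) (Suc j mod N)} \<in> K"
    "c (N - 1) ` {..<N} \<in> K"
proof -
  define p where "p = edge_path L x"
  define I where "I = {0..1::real} \<times> {0..1::real}"
  have p: "pathin (realization K) p"
    unfolding p_def by (intro pathin_edge_path L x)
  have "p 1 = p 0"
  proof
    fix v
    obtain L' where L': "L = Suc L'" using L by (cases L) auto
    show "p 1 v = p 0 v"
      using edge_path_segment[of L' L 1 x v] edge_path_segment[of 0 L 0 x v] L x(2)
      unfolding p_def by (simp add: L')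
  qed
  moreover have "pathin (realization K) (\<lambda>_. p 0)"
    using path_start_in_topspace[OF p] by simp
  ultimately have "homotopic_with (\<lambda>r. r 1 = r 0) (top_of_set {0..1}) (realization K) p (\<lambda>_. p 0)"
    using sc p unfolding simply_connected_space_def by blast
  then obtain h where h: "continuous_map (prod_topology (top_of_set {0..1}) (top_of_set {0..1})) (realization K) h"
    and h0: "\<And>t. h (0, t) = p t" and h1: "\<And>t. h (1, t) = p 0"
    and loop: "\<And>s. s \<in> {0..1::real} \<Longrightarrow> h (s, 1::real) = h (s, 0)"
    unfolding homotopic_with_def by blast
  have h: "continuous_map (top_of_set I) (realization K) h"
    using h unfolding I_def by (simp add: prod_topology_subtopology subtopology_subtopology Times_Int_Times)
  have hI: "h z \<in> topspace (realization K)" if "z \<in> I" for z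
    using continuous_map_image_subset_topspace[OF h] that by auto
  \<comment> \<open>Open sets whose part in the square is sent into a single open star;
    \<open>\<epsilon>\<close> will be a Lebesgue number of this cover.\<close>
  define \<G> where "\<G> = {G. open G \<and> (\<exists>v. \<forall>z\<in>I \<inter> G. 0 < h z v)}"
  have "I \<subseteq> \<Union>\<G>"
  proof
    fix z assume z: "z \<in> I"
    obtain v where v: "0 < h z v" using realization_positive_coordinate[OF hI[OF z]] by blast
    have "openin (top_of_set I) {z \<in> topspace (top_of_set I). h z \<in> {q \<in> topspace (realization K). 0 < q v}}"
      by (rule openin_continuous_map_preimage[OF h openin_open_star])
    then obtain G where "open G" "{z \<in> I. h z \<in> {q \<in> topspace (realization K). 0 < q v}} = I \<inter> G"
      unfolding openin_open by auto
    moreover from this have "\<forall>z\<in>I \<inter> G. 0 < h z v" by blast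
    ultimately have "G \<in> \<G>" "z \<in> G" using z v hI unfolding \<G>_def by blast+
    then show "z \<in> \<Union>\<G>" by blast
  qed
  moreover have "compact I" unfolding I_def by (intro compact_Times compact_Icc)
  ultimately obtain \<epsilon> where \<epsilon>: "0 < \<epsilon>" "\<And>z. z \<in> I \<Longrightarrow> \<exists>G\<in>\<G>. ball z \<epsilon> \<subseteq> G"
    using Heine_Borel_lemma[of I \<G>] unfolding \<G>_def by blast
  \<comment> \<open>\<open>N\<close> will be a multiple of \<open>L\<close>, so that the grid
    refines the time intervals of the edges; \<open>2 / N\<close> bounds the distance from a corner
    within a grid square.\<close>
  obtain M :: nat where M: "2 / \<epsilon> < real M" using reals_Archimedean2 by blast
  have M0: "0 < M" using M \<epsilon>(1) by (metis divide_pos_pos less_trans of_nat_0_less_iff zero_less_numeral)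
  define N where "N = L * M"
  have N0: "0 < N" unfolding N_def using L M0 by simp
  have "M \<le> N" unfolding N_def using L by (cases L) auto
  then have "2 / real N \<le> 2 / real M" using M0 by (intro divide_left_mono) auto
  also have "2 / real M < \<epsilon>" using M \<epsilon>(1) M0 by (simp add: field_simps)
  finally have N: "2 / real N < \<epsilon>" .
  have frac: "real k / real N \<in> {0..1}" "real (Suc k) / real N \<in> {0..1}" if "k < N" for k
    using that N0 by (auto simp: field_simps)
  have seg01: "0 \<le> s \<and> s \<le> 1" if "k < N" "real k / real N \<le> s" "s \<le> real (Suc k) / real N" for k s
  proof
    show "0 \<le> s" using that(2) by (rule order_trans[rotated]) simp
    show "s \<le> 1" using that(3) frac(2)[OF that(1)] by simp
  qed
  define Q where "Q i j = {real i / real N..real (Suc i) / real N} \<times> {real j / real N..real (Suc j) / real N}" for i j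
  have "\<exists>v. \<forall>z\<in>Q i j. 0 < h z v" if "i < N" "j < N" for i j
  proof -
    let ?z = "(real i / real N, real j / real N)"
    have "?z \<in> I" using frac that unfolding I_def by blast
    then obtain G where G: "G \<in> \<G>" "ball ?z \<epsilon> \<subseteq> G" using \<epsilon>(2) by blast
    have "z \<in> I \<inter> ball ?z \<epsilon>" if "z \<in> Q i j" for z
    proof -
      obtain s t where z: "z = (s, t)" by (cases z)
      have st: "real i / real N \<le> s" "s \<le> real (Suc i) / real N" "real j / real N \<le> t" "t \<le> real (Suc j) / real N"
        using that unfolding z Q_def by auto
      have d: "\<bar>real i / real N - s\<bar> \<le> 1 / real N" "\<bar>real j / real N - t\<bar> \<le> 1 / real N"
        using st by (auto simp: add_divide_distrib)
      have "dist ?z z \<le> \<bar>real i / real N - s\<bar> + \<bar>real j / real N - t\<bar>"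
        unfolding z dist_Pair_Pair dist_real_def by (rule order_trans[OF sqrt_sum_squares_le_sum_abs]) simp
      also have "\<dots> \<le> 2 / real N" using d by simp
      finally have "dist ?z z < \<epsilon>" using N by simp
      moreover have "z \<in> I"
        using seg01[OF \<open>i < N\<close> st(1,2)] seg01[OF \<open>j < N\<close> st(3,4)] unfolding z I_def by simp
      ultimately show ?thesis by simp
    qed
    then show ?thesis using G unfolding \<G>_def by blast
  qed
  then obtain c where c: "\<And>i j z. i < N \<Longrightarrow> j < N \<Longrightarrow> z \<in> Q i j \<Longrightarrow> 0 < h z (c i j)"
    by metis
  \<comment> \<open>The line at \<open>(j + 1) / N\<close> belongs to square \<open>j\<close> and to
    the next one. For the last \<open>j\<close> the next one is square 0, because every stage of the
    homotopy is a loop.\<close>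
  have corner: "0 < h (s, real (Suc j) / real N) (c i j)" "0 < h (s, real (Suc j) / real N) (c i (Suc j mod N))"
    if "i < N" "j < N" "s \<in> {real i / real N..real (Suc i) / real N}" for i j s
  proof -
    show "0 < h (s, real (Suc j) / real N) (c i j)"
      using that by (intro c) (auto simp: Q_def divide_right_mono)
    show "0 < h (s, real (Suc j) / real N) (c i (Suc j mod N))"
    proof (cases "Suc j = N")
      case True
      have "s \<in> {0..1}"
        using seg01[OF that(1)] that(3) by simp
      then have "h (s, real (Suc j) / real N) = h (s, 0)"
        using loop True N0 by simp
      moreover have "0 < h (s, 0) (c i 0)"
        using that N0 by (intro c) (auto simp: Q_def)
      ultimately show ?thesis using True by simp
    next
      case False
      then show ?thesis
        using that by (intro c) (auto simp: Q_def divide_right_mono)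
    qed
  qed
  have inI: "(real i / real N, real j / real N) \<in> I" if "i \<le> N" "j \<le> N" for i j
    using that N0 unfolding I_def by (auto simp: field_simps)
  show thesis
  proof (rule that)
    show "0 < M" "N = L * M" using M0 N_def by auto
  next
    fix j assume j: "j < N"
    define k where "k = j div M"
    have k: "k < L" using j unfolding k_def N_def by (simp add: less_mult_imp_div_less)
    have "k * M \<le> j" "j < Suc k * M"
      using M0 unfolding k_def by (simp_all add: dividend_less_div_times div_times_less_eq_dividend)
    then have "real k * real M \<le> real (Suc j)" "real (Suc j) \<le> real (Suc k) * real M"
      by (metis le_SucI of_nat_le_iff of_nat_mult, metis Suc_leI of_nat_le_iff of_nat_mult)
    moreover have "real L * (real (Suc j) / real N) = real (Suc j) / real M"
      using L unfolding N_def by simp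
    ultimately have seg: "real k \<le> real L * (real (Suc j) / real N)" "real L * (real (Suc j) / real N) \<le> real (Suc k)"
      using M0 by (simp_all only: le_divide_eq divide_le_eq) simp_all
    have pos: "v \<in> {x k, x (Suc k)}" if "0 < p (real (Suc j) / real N) v" for v
      using edge_path_in_simplex[OF k seg, of x] that unfolding p_def closed_simplex_def by fastforce
    have "c 0 j \<in> {x k, x (Suc k)}" "c 0 (Suc j mod N) \<in> {x k, x (Suc k)}"
      by (rule pos; use corner[of 0 j 0] N0 j h0 in simp)+
    moreover have "Suc j div M \<in> {k, Suc k}"
      unfolding k_def by (simp add: div_Suc)
    ultimately have "{x (j div M), x (Suc j div M), c 0 j, c 0 (Suc j mod N)} \<subseteq> {x k, x (Suc k)}"
      unfolding k_def by auto
    then show "{x (j div M), x (Suc j div M), c 0 j, c 0 (Suc j mod N)} \<in> K"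
      using simplicial_complex_face[OF K x(1)[OF k]] by blast
  next
    fix i j assume ij: "Suc i < N" "j < N"
    let ?z = "(real (Suc i) / real N, real (Suc j) / real N)"
    have "0 < h ?z v" if "v \<in> {c i j, c i (Suc j mod N), c (Suc i) j, c (Suc i) (Suc j mod N)}" for v
      using that corner[of i j "real (Suc i) / real N"] corner[of "Suc i" j "real (Suc i) / real N"] ij
      by (auto simp: divide_right_mono)
    then show "{c i j, c i (Suc j mod N), c (Suc i) j, c (Suc i) (Suc j mod N)} \<in> K"
      using carrier_simplex[OF K hI[OF inI[of "Suc i" "Suc j"]]] ij by (metis Suc_leI insert_not_empty less_imp_le)
  next
    \<comment> \<open>The homotopy ends in a constant loop, so all centres of the last row lie in
      the carrier of the one point \<open>p 0\<close>.\<close>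
    have "0 < p 0 v" if "v \<in> c (N - 1) ` {..<N}" for v
      using that corner(1)[of "N - 1" _ 1] N0 h1 by (auto simp: field_simps)
    then show "c (N - 1) ` {..<N} \<in> K"
      using carrier_simplex[OF K path_start_in_topspace[OF p], of "c (N - 1) ` {..<N}"] N0 by auto
  qed
qed

text \<open>Over a simply connected base a covering is injective on components. Here
  \<open>f\<close> is the covering and \<open>A\<close> its reflexive adjacency; \<open>lift\<close>
  and \<open>full\<close> lift edges and triangles, and \<open>inj\<close> makes lifts unique.
  Closedness of lifts is passed on through the rows of the contracting grid, from the last row back
  to the given walk.\<close>

lemma simply_connected_lift_closed:
  fixes A :: "'y \<Rightarrow> 'y \<Rightarrow> bool" and f :: "'y \<Rightarrow> 'v"
  assumes K: "simplicial_complex K" and sc: "simply_connected_space (realization K)"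
    and A_refl: "\<And>x y. A x y \<Longrightarrow> A x x" and A_sym: "\<And>x y. A x y \<Longrightarrow> A y x"
    and A_K: "\<And>x y. A x y \<Longrightarrow> {f x, f y} \<in> K"
    and lift: "\<And>y z. A y y \<Longrightarrow> {f y, z} \<in> K \<Longrightarrow> \<exists>x. A y x \<and> f x = z"
    and full: "\<And>y x x'. A y x \<Longrightarrow> A y x' \<Longrightarrow> {f y, f x, f x'} \<in> K \<Longrightarrow> A x x'"
    and inj: "\<And>x y. A x y \<Longrightarrow> f x = f y \<Longrightarrow> x = y"
    and y: "A\<^sup>*\<^sup>* y y'" "f y = f y'"
  shows "y = y'"
proof -
  define \<tau> where "\<tau> y z = (SOME x. A y x \<and> f x = z)" for y z
  have \<tau>: "A y (\<tau> y z)" "f (\<tau> y z) = z" "A (\<tau> y z) (\<tau> y z)" if "A y y" "{f y, z} \<in> K" for y z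
  proof -
    show "A y (\<tau> y z)" "f (\<tau> y z) = z"
      using someI_ex[OF lift[OF that]] unfolding \<tau>_def by blast+
    then show "A (\<tau> y z) (\<tau> y z)" using A_sym A_refl by blast
  qed
  have \<tau>_eq: "\<tau> y (f x) = x" if "A y x" for y x
  proof -
    have t: "A y (\<tau> y (f x))" "f (\<tau> y (f x)) = f x"
      using \<tau>[OF A_refl[OF that] A_K[OF that]] by auto
    then have "A x (\<tau> y (f x))"
      using full[OF that, of "\<tau> y (f x)"] A_K[OF that] by simp
    then show ?thesis using inj[of x "\<tau> y (f x)"] t by simp
  qed
  have sub: "\<tau>' \<in> K" if "\<sigma> \<in> K" "\<tau>' \<subseteq> \<sigma>" "\<tau>' \<noteq> {}" for \<sigma> \<tau>'
    using simplicial_complex_face[OF K that] .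
  \<comment> \<open>No holonomy around a triangle: the lift over \<open>b\<close> is the same
    whether reached directly or via \<open>a\<close>.\<close>
  have flat: "\<tau> (\<tau> y a) b = \<tau> y b" if y: "A y y" "{f y, a, b} \<in> K" for y a b
  proof -
    have K2: "{f y, a} \<in> K" "{f y, b} \<in> K" by (rule sub[OF y(2)]; blast)+
    have "A (\<tau> y a) (\<tau> y b)"
      using full[OF \<tau>(1)[OF y(1) K2(1)] \<tau>(1)[OF y(1) K2(2)]] \<tau>(2)[OF y(1) K2(1)] \<tau>(2)[OF y(1) K2(2)] y(2)
      by simp
    from \<tau>_eq[OF this] show ?thesis using \<tau>(2)[OF y(1) K2(2)] by simp
  qed
  \<comment> \<open>The end of the lift of the walk \<open>r 0, ..., r j\<close> that starts at
    \<open>y\<close>.\<close>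
  define hol where "hol y r j = rec_nat y (\<lambda>j a. \<tau> a (r (Suc j))) j" for y r j
  have hol_0: "hol y r 0 = y" and hol_Suc: "hol y r (Suc j) = \<tau> (hol y r j) (r (Suc j))" for y r j
    unfolding hol_def by simp_all
  \<comment> \<open>Neighbouring rows form a ladder. Each square of it lies in a simplex, so two
    applications of \<open>flat\<close> carry the rung from column \<open>j\<close> to the
    next.\<close>
  have compare: "A (hol y r j) (hol y r j) \<and> f (hol y r j) = r j \<and>
      hol (\<tau> y (s 0)) s j = \<tau> (hol y r j) (s j)"
    if rs: "\<And>j. j < N \<Longrightarrow> {r j, r (Suc j), s j, s (Suc j)} \<in> K" and y: "A y y" "f y = r 0" and j: "j \<le> N"
    for r s y j and N :: nat
    using j
  proof (induction j)
    case 0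
    then show ?case using y by (simp add: hol_0)
  next
    case (Suc j)
    let ?a = "hol y r j"
    have a: "A ?a ?a" "f ?a = r j" "hol (\<tau> y (s 0)) s j = \<tau> ?a (s j)"
      using Suc by auto
    have 1: "{f ?a, r (Suc j)} \<in> K" "{f ?a, s j, s (Suc j)} \<in> K" "{f ?a, r (Suc j), s (Suc j)} \<in> K"
      unfolding a using Suc.prems by (auto intro: sub[OF rs[of j]])
    show ?case
      using \<tau>(2,3)[OF a(1) 1(1)] flat[OF a(1) 1(2)] flat[OF a(1) 1(3)] a(3) by (simp add: hol_Suc)
  qed
  \<comment> \<open>By \<open>compare\<close>, going around row \<open>r\<close> and crossing to row
    \<open>s\<close> is the same as crossing and going around \<open>s\<close>; crossing is
    invertible, so closed lifts of \<open>s\<close> close those of \<open>r\<close>.\<close>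
  have transfer: "hol y r N = y"
    if rs: "\<And>j. j < N \<Longrightarrow> {r j, r (Suc j), s j, s (Suc j)} \<in> K" and N: "0 < N" and per: "r N = r 0" "s N = s 0"
      and y: "A y y" "f y = r 0" and s: "\<And>z. A z z \<Longrightarrow> f z = s 0 \<Longrightarrow> hol z s N = z"
    for r s y and N :: nat
  proof -
    let ?b = "hol y r N"
    have b: "A ?b ?b" "f ?b = r 0" "hol (\<tau> y (s 0)) s N = \<tau> ?b (s 0)"
      using compare[OF rs y, of N] per by auto
    have K0: "{r 0, s 0} \<in> K" "{r 0, s 0, r 0} \<in> K" by (rule sub[OF rs[OF N]]; blast)+
    have "hol (\<tau> y (s 0)) s N = \<tau> y (s 0)"
      using s[of "\<tau> y (s 0)"] \<tau>[OF y(1), of "s 0"] y(2) K0 by simp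
    then have "\<tau> ?b (s 0) = \<tau> y (s 0)" using b by simp
    moreover have "\<tau> (\<tau> z (s 0)) (r 0) = z" if "A z z" "f z = r 0" for z
      using flat[OF that(1), of "s 0" "r 0"] \<tau>_eq[OF that(1)] that(2) K0 by simp
    ultimately show ?thesis using b y by metis
  qed
  obtain L \<gamma> where \<gamma>: "\<gamma> 0 = y" "\<gamma> L = y'" "\<And>k. k < L \<Longrightarrow> A (\<gamma> k) (\<gamma> (Suc k))"
    using y(1) by (auto simp: rtranclp_power relpowp_fun_conv)
  show ?thesis
  proof (cases "L = 0")
    case True
    then show ?thesis using \<gamma> by simp
  next
    case False
    define x where "x k = f (\<gamma> k)" for k
    have x: "{x k, x (Suc k)} \<in> K" if "k < L" for k
      unfolding x_def using A_K \<gamma>(3) that by blast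
    have "x L = x 0" unfolding x_def using \<gamma> y(2) by simp
    then obtain M N c where M: "0 < M" "N = L * M"
      and bottom: "\<And>j. j < N \<Longrightarrow> {x (j div M), x (Suc j div M), c 0 j, c 0 (Suc j mod N)} \<in> K"
      and mid: "\<And>i j. Suc i < N \<Longrightarrow> j < N \<Longrightarrow>
        {c i j, c i (Suc j mod N), c (Suc i) j, c (Suc i) (Suc j mod N)} \<in> K"
      and top: "c (N - 1) ` {..<N} \<in> K"
      using contraction_grid[OF K sc, of L x] x False by blast
    have N: "0 < N" using M False by simp
    define row where "row i j = c i (j mod N)" for i j
    have row_N: "row i N = row i 0" for i unfolding row_def by simp
    \<comment> \<open>Induction from the last row downwards. That row lies in one simplex, where
      every vertex of a lift is a single transport from its start \<open>z\<close>.\<close>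
    have row: "hol z (row i) N = z" if "i < N" "A z z" "f z = row i 0" for i z
      using that
    proof (induction "N - 1 - i" arbitrary: i z)
      case 0
      then have i: "i = N - 1" by simp
      have "hol z (row i) j = \<tau> z (row i j)" for j
      proof (induction j)
        case 0
        then show ?case using \<tau>_eq[of z z] \<open>A z z\<close> \<open>f z = row i 0\<close> by (simp add: hol_0)
      next
        case (Suc j)
        have "{f z, row i j, row i (Suc j)} \<in> K"
          using \<open>f z = row i 0\<close> N unfolding row_def i by (auto intro!: sub[OF top])
        then show ?case using Suc flat \<open>A z z\<close> by (simp add: hol_Suc)
      qed
      from this[of N] show ?case
        using \<tau>_eq[of z z] 0 N row_N by simp
    next
      case (Suc d)
      have i: "Suc i < N" using Suc(2) by linarith
      show ?case
      proof (rule transfer[where s = "row (Suc i)"])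
        show "{row i j, row i (Suc j), row (Suc i) j, row (Suc i) (Suc j)} \<in> K" if "j < N" for j
          using mid[OF i that] that unfolding row_def by simp
        show "hol z (row (Suc i)) N = z" if "A z z" "f z = row (Suc i) 0" for z
          using Suc(1)[of "Suc i" z] Suc(2) i that by simp
      qed (use N Suc row_N in auto)
    qed
    \<comment> \<open>The given walk with every vertex repeated \<open>M\<close> times, to match the
      \<open>N = L * M\<close> columns of the grid.\<close>
    define e where "e j = x (j div M)" for j
    have "hol y e N = y"
    proof (rule transfer[where s = "row 0"])
      show "{e j, e (Suc j), row 0 j, row 0 (Suc j)} \<in> K" if "j < N" for j
        using bottom[OF that] that unfolding e_def row_def by simp
      show "e N = e 0" using M \<open>x L = x 0\<close> unfolding e_def by simp
      show "A y y" using A_refl \<gamma>(1,3) False by blast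
      show "f y = e 0" unfolding e_def x_def using \<gamma>(1) by simp
    qed (use N row row_N in auto)
    moreover have "hol y e j = \<gamma> (j div M)" if "j \<le> N" for j
      using that
    proof (induction j)
      case 0
      then show ?case using \<gamma>(1) by (simp add: hol_0)
    next
      case (Suc j)
      have "j div M < L" using Suc.prems M(2) by (simp add: less_mult_imp_div_less)
      then have "A (\<gamma> (j div M)) (\<gamma> (Suc j div M))"
        using \<gamma>(3) A_refl by (simp add: div_Suc) blast
      then show ?case
        using Suc \<tau>_eq by (simp add: hol_Suc e_def x_def)
    qed
    ultimately show ?thesis using \<gamma>(2) M by simp
  qed
qed

section \<open>Short cycles in bridged graphs\<close>

text \<open>\<open>R\<close> is adjacency or equality, so \<open>R ^^ k\<close> is the ball of radius \<open>k\<close>. Distances need not be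
  exact in \<open>tri\<close> and \<open>conv\<close> since both are trivial for vertices closer to \<open>c\<close>.\<close>

locale bridged =
  fixes R :: "'v \<Rightarrow> 'v \<Rightarrow> bool"
  assumes refl [simp, intro]: "R x x"
    and sym: "R x y \<Longrightarrow> R y x"
    and tri: "\<lbrakk>(R ^^ Suc k) c x; (R ^^ Suc k) c y; R x y\<rbrakk> \<Longrightarrow> \<exists>z. (R ^^ k) c z \<and> R z x \<and> R z y"
    and conv: "\<lbrakk>(R ^^ k) c y; (R ^^ k) c z; R x y; R x z\<rbrakk> \<Longrightarrow> (R ^^ k) c x \<or> R y z"
    and pent: "\<lbrakk>R a b; R b c; R c d; R d e; R e a\<rbrakk> \<Longrightarrow> R a c \<or> R a d \<or> R b d \<or> R b e \<or> R c e"
begin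

definition B2 :: "'v \<Rightarrow> 'v \<Rightarrow> bool" where "B2 x y \<longleftrightarrow> (\<exists>z. R x z \<and> R z y)"
definition B3 :: "'v \<Rightarrow> 'v \<Rightarrow> bool" where "B3 x y \<longleftrightarrow> (\<exists>z. B2 x z \<and> R z y)"
definition B4 :: "'v \<Rightarrow> 'v \<Rightarrow> bool" where "B4 x y \<longleftrightarrow> (\<exists>z. B3 x z \<and> R z y)"

lemma relpowp_B: "R ^^ Suc 0 = R" "R ^^ Suc (Suc 0) = B2" "R ^^ Suc (Suc (Suc 0)) = B3"
  "R ^^ Suc (Suc (Suc (Suc 0))) = B4"
proof -
  show 1: "R ^^ Suc 0 = R" by (auto simp: fun_eq_iff relcompp_apply)
  show 2: "R ^^ Suc (Suc 0) = B2" using 1 by (auto simp: fun_eq_iff B2_def relcompp_apply)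
  show 3: "R ^^ Suc (Suc (Suc 0)) = B3" using 2 by (auto simp: fun_eq_iff B3_def relcompp_apply)
  show "R ^^ Suc (Suc (Suc (Suc 0))) = B4" using 3 by (auto simp: fun_eq_iff B4_def relcompp_apply)
qed

lemma B2I: "R x z \<Longrightarrow> R z y \<Longrightarrow> B2 x y" and B3I: "B2 x z \<Longrightarrow> R z y \<Longrightarrow> B3 x y"
  and B4I: "B3 x z \<Longrightarrow> R z y \<Longrightarrow> B4 x y"
  by (auto simp: B2_def B3_def B4_def)

lemma B3_sym: "B3 x y \<Longrightarrow> B3 y x"
  unfolding B3_def B2_def using sym by blast

lemmas tri1 = tri[of "Suc 0", unfolded relpowp_B]
  and tri2 = tri[of "Suc (Suc 0)", unfolded relpowp_B]
  and tri3 = tri[of "Suc (Suc (Suc 0))", unfolded relpowp_B]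
  and conv2 = conv[of "Suc (Suc 0)", unfolded relpowp_B]
  and conv3 = conv[of "Suc (Suc (Suc 0))", unfolded relpowp_B]

text \<open>Convexity of the 1-ball of \<open>a\<close>, applied to \<open>c\<close> and its
  neighbours \<open>b\<close> and \<open>d\<close>.\<close>

lemma quad: "\<lbrakk>R a b; R b c; R c d; R d a\<rbrakk> \<Longrightarrow> R a c \<or> R b d"
  using conv[of "Suc 0" a b d c, unfolded relpowp_B] sym by blast

text \<open>\<open>a3\<close> has the nonadjacent neighbours \<open>a2\<close> and \<open>a4\<close>
  in the 2-ball of \<open>a0\<close>, hence lies in that ball. A vertex \<open>x\<close> between
  \<open>a0\<close> and \<open>a3\<close> cuts the hexagon into two pentagons, whose diagonals all
  end at \<open>x\<close>.\<close>

lemma hexagon: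
  assumes "R a0 a1" "R a1 a2" "R a2 a3" "R a3 a4" "R a4 a5" "R a5 a0"
    and "\<not> R a0 a2" "\<not> R a0 a3" "\<not> R a0 a4" "\<not> R a1 a3" "\<not> R a1 a4" "\<not> R a1 a5"
      "\<not> R a2 a4" "\<not> R a2 a5" "\<not> R a3 a5"
  shows "\<exists>c. R c a0 \<and> R c a1 \<and> R c a2 \<and> R c a3 \<and> R c a4 \<and> R c a5"
proof -
  have "B2 a0 a2" "B2 a0 a4" using assms sym by (blast intro: B2I)+
  then have "B2 a0 a3" using conv2[of a0 a2 a4 a3] assms sym by blast
  then obtain x where x: "R a0 x" "R x a3" by (auto simp: B2_def)
  have 1: "R x a1 \<or> R x a2"
    using pent[of a0 a1 a2 a3 x] assms x sym by blast
  have 2: "R x a1 \<and> R x a2"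
    using 1 quad[of x a1 a2 a3] quad[of a0 a1 a2 x] assms x sym by blast
  have 3: "R x a5 \<or> R x a4"
    using pent[of a0 a5 a4 a3 x] assms x sym by blast
  have 4: "R x a5 \<and> R x a4"
    using 3 quad[of x a5 a4 a3] quad[of a0 a5 a4 x] assms x sym by blast
  show ?thesis using 2 4 x sym by blast
qed

text \<open>\<open>x\<close> cuts the heptagon into a pentagon and the hexagon
  \<open>a0 x a3 a4 a5 a6\<close>. If the hexagon has a chord at \<open>x\<close>, then
  \<open>x\<close> itself is the centre. Otherwise the centre of the hexagon is again adjacent to
  \<open>a0\<close> and \<open>a3\<close>, and the pentagon argument \<open>fill\<close> applies to
  it.\<close>

lemma heptagon_aux:
  assumes "R a0 a1" "R a1 a2" "R a2 a3" "R a3 a4" "R a4 a5" "R a5 a6" "R a6 a0"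
    and nd: "\<not> R a0 a2" "\<not> R a0 a3" "\<not> R a0 a4" "\<not> R a0 a5" "\<not> R a1 a3" "\<not> R a1 a4" "\<not> R a1 a5"
      "\<not> R a1 a6" "\<not> R a2 a4" "\<not> R a2 a5" "\<not> R a2 a6" "\<not> R a3 a5" "\<not> R a3 a6" "\<not> R a4 a6"
    and x: "R x a0" "R x a3"
  shows "\<exists>c. R c a0 \<and> R c a1 \<and> R c a2 \<and> R c a3 \<and> R c a4 \<and> R c a5 \<and> R c a6"
proof -
  have fill: "R y a1 \<and> R y a2" if y: "R y a0" "R y a3" for y
  proof -
    have 1: "R y a1 \<or> R y a2"
      using pent[of a0 a1 a2 a3 y] assms y sym by blast
    show ?thesis
      using 1 quad[of y a1 a2 a3] quad[of a0 a1 a2 y] assms y sym by blast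
  qed
  consider "R x a4" | "R x a5" | "R x a6" | "\<not> R x a4" "\<not> R x a5" "\<not> R x a6" by blast
  then show ?thesis
  proof cases
    case 1
    then have "R x a5 \<or> R x a6"
      using pent[of x a4 a5 a6 a0] assms sym by blast
    then have "R x a5 \<and> R x a6"
      using 1 quad[of x a4 a5 a6] quad[of x a5 a6 a0] assms sym by blast
    with 1 fill[of x] x show ?thesis by blast
  next
    case 2
    then have "R x a6" "R x a4"
      using quad[of x a5 a6 a0] quad[of x a3 a4 a5] assms sym by blast+
    with 2 fill[of x] x show ?thesis by blast
  next
    case 3
    then have "R x a4 \<or> R x a5"
      using pent[of x a3 a4 a5 a6] assms sym by blast
    then have "R x a4 \<and> R x a5"
      using 3 quad[of x a3 a4 a5] quad[of x a4 a5 a6] assms sym by blast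
    with 3 fill[of x] x show ?thesis by blast
  next
    case 4
    obtain c where c: "R c a0" "R c x" "R c a3" "R c a4" "R c a5" "R c a6"
      using hexagon[of a0 x a3 a4 a5 a6] assms 4 sym by blast
    with fill[of c] show ?thesis by blast
  qed
qed

text \<open>The edge \<open>a3 a4\<close> opposite to \<open>a0\<close> has a common neighbour
  \<open>z\<close> within distance 2 of \<open>a0\<close>. Either \<open>a3\<close> or
  \<open>a4\<close> is that close itself, or convexity makes \<open>z\<close> adjacent to
  \<open>a2\<close> and \<open>a5\<close>; each case is a rotation of
  \<open>heptagon_aux\<close>.\<close>

lemma heptagon:
  assumes "R a0 a1" "R a1 a2" "R a2 a3" "R a3 a4" "R a4 a5" "R a5 a6" "R a6 a0"
    and nd: "\<not> R a0 a2" "\<not> R a0 a3" "\<not> R a0 a4" "\<not> R a0 a5" "\<not> R a1 a3" "\<not> R a1 a4" "\<not> R a1 a5"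
      "\<not> R a1 a6" "\<not> R a2 a4" "\<not> R a2 a5" "\<not> R a2 a6" "\<not> R a3 a5" "\<not> R a3 a6" "\<not> R a4 a6"
  shows "\<exists>c. R c a0 \<and> R c a1 \<and> R c a2 \<and> R c a3 \<and> R c a4 \<and> R c a5 \<and> R c a6"
proof -
  have nd': "\<not> R a2 a0" "\<not> R a3 a0" "\<not> R a4 a0" "\<not> R a5 a0" "\<not> R a3 a1" "\<not> R a4 a1" "\<not> R a5 a1"
    "\<not> R a6 a1" "\<not> R a4 a2" "\<not> R a5 a2" "\<not> R a6 a2" "\<not> R a5 a3" "\<not> R a6 a3" "\<not> R a6 a4"
    using nd sym by blast+
  have B3: "B3 a0 a3" "B3 a0 a4"
    using assms sym by (blast intro: B2I B3I)+
  then obtain z where z: "B2 a0 z" "R z a3" "R z a4" using tri2 assms(4) by blast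
  consider "B2 a0 a3" | "B2 a0 a4" | "\<not> B2 a0 a3" "\<not> B2 a0 a4" by blast
  then show ?thesis
  proof cases
    case 1
    then obtain x where "R x a0" "R x a3" unfolding B2_def using sym by blast
    with heptagon_aux[of a0 a1 a2 a3 a4 a5 a6 x] assms show ?thesis by blast
  next
    case 2
    then obtain x where "R x a4" "R x a0" unfolding B2_def using sym by blast
    with heptagon_aux[of a4 a5 a6 a0 a1 a2 a3 x] assms nd' show ?thesis by blast
  next
    case 3
    have "R a2 z"
      using conv2[of a0 a2 z a3] 3 z assms sym by (blast intro: B2I)
    moreover have "R a5 z"
      using conv2[of a0 a5 z a4] 3 z assms sym by (blast intro: B2I)
    ultimately show ?thesis
      using heptagon_aux[of a2 a3 a4 a5 a6 a0 a1 z] assms nd' sym by blast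
  qed
qed


text \<open>Integer indices let the dihedral group act by formulas. As \<open>R\<close> includes
  equality, the last clause also restricts coincidences, to index distance 0 or 1; those at distance
  1 are excluded in \<open>walk_cycle\<close>.\<close>

definition induced_cycle :: "int \<Rightarrow> (int \<Rightarrow> 'v) \<Rightarrow> bool" where
  "induced_cycle m w \<longleftrightarrow> (\<forall>i. w (i + m) = w i) \<and> (\<forall>i. R (w i) (w (i + 1))) \<and>
     (\<forall>i j. R (w i) (w j) \<longrightarrow> (j - i) mod m \<in> {0, 1, m - 1})"

lemma induced_cycleD:
  assumes "induced_cycle m w"
  shows "w (i + m) = w i" "R (w i) (w (i + 1))" "R (w i) (w j) \<Longrightarrow> (j - i) mod m \<in> {0, 1, m - 1}"
  using assms unfolding induced_cycle_def by blast+

lemma induced_cycle_shift: "induced_cycle m w \<Longrightarrow> induced_cycle m (\<lambda>j. w (i + j))"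
  unfolding induced_cycle_def by (metis add.assoc add_diff_cancel_left)

lemma induced_cycle_mirror:
  assumes w: "induced_cycle m w"
  shows "induced_cycle m (\<lambda>j. w (- j))"
proof -
  have "w (- (i + m)) = w (- i)" for i
    using induced_cycleD(1)[OF w, of "- (i + m)"] by simp
  moreover have "R (w (- i)) (w (- (i + 1)))" for i
    using induced_cycleD(2)[OF w, of "- (i + 1)"] sym by simp
  moreover have "(j - i) mod m \<in> {0, 1, m - 1}" if "R (w (- i)) (w (- j))" for i j
    using induced_cycleD(3)[OF w sym[OF that]] by simp
  ultimately show ?thesis unfolding induced_cycle_def by blast
qed

lemma periodic_mod:
  fixes w :: "int \<Rightarrow> 'a"
  assumes per: "\<And>i. w (i + m) = w i" and eq: "i mod m = j mod m"
  shows "w i = w j"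
proof -
  have nat: "w (i + int k * m) = w i" for i k
  proof (induction k)
    case (Suc k)
    then show ?case using per[of "i + int k * m"] by (simp add: algebra_simps)
  qed simp
  have "w (i + k * m) = w i" for i k
  proof (cases "k \<ge> 0")
    case True
    then show ?thesis using nat[of i "nat k"] by simp
  next
    case False
    then show ?thesis using nat[of "i + k * m" "nat (- k)"] by simp
  qed
  moreover obtain k where "j = i + k * m"
    using eq by (metis mod_eqE mult.commute)
  ultimately show ?thesis by simp
qed

lemma periodic_diff:
  fixes w :: "int \<Rightarrow> 'a"
  assumes per: "\<And>i. w (i + m) = w i" and eq: "(j - i) mod m = d"
  shows "w j = w (i + d)"
proof (rule periodic_mod[of w m])
  have "(i + (j - i) mod m) mod m = (i + (j - i)) mod m"
    by (rule mod_add_right_eq)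
  then show "j mod m = (i + d) mod m"
    using eq by simp
qed (rule per)

text \<open>The pentagon formed by \<open>y\<close> and \<open>w 0, ..., w 3\<close> can only have
  diagonals at \<open>y\<close>, and either of them forces the other through a quadrangle.\<close>

lemma induced_cycle_fill3:
  assumes w: "induced_cycle m w" and m: "m \<ge> 6" and y: "R y (w 0)" "R y (w 3)"
  shows "R y (w 1) \<and> R y (w 2)"
proof -
  have a: "R (w 0) (w 1)" "R (w 1) (w 2)" "R (w 2) (w 3)"
    using induced_cycleD(2)[OF w, of 0] induced_cycleD(2)[OF w, of 1] induced_cycleD(2)[OF w, of 2] by auto
  have n: "\<not> R (w 0) (w 2)" "\<not> R (w 0) (w 3)" "\<not> R (w 1) (w 3)"
    using induced_cycleD(3)[OF w, of 0 2] induced_cycleD(3)[OF w, of 0 3]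
      induced_cycleD(3)[OF w, of 1 3] m by auto
  have 1: "R y (w 1) \<or> R y (w 2)"
    using pent[of "w 0" "w 1" "w 2" "w 3" y] a n y sym by blast
  show ?thesis
    using 1 quad[of y "w 1" "w 2" "w 3"] quad[of "w 0" "w 1" "w 2" y] a n y sym by blast
qed

text \<open>Any chord at \<open>y\<close> of the hexagon formed by \<open>y\<close> and
  \<open>w 0, ..., w 4\<close> forces the others; without chords the hexagon has a centre. In that
  case the vertex obtained is not the given one.\<close>

lemma induced_cycle_fill4:
  assumes w: "induced_cycle m w" and m: "m \<ge> 6" and y: "R y (w 0)" "R y (w 4)"
  shows "\<exists>y. R y (w 0) \<and> R y (w 1) \<and> R y (w 2) \<and> R y (w 3) \<and> R y (w 4)"
proof -
  have a: "R (w 0) (w 1)" "R (w 1) (w 2)" "R (w 2) (w 3)" "R (w 3) (w 4)"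
    using induced_cycleD(2)[OF w, of 0] induced_cycleD(2)[OF w, of 1]
      induced_cycleD(2)[OF w, of 2] induced_cycleD(2)[OF w, of 3] by auto
  have n: "\<not> R (w 0) (w 2)" "\<not> R (w 0) (w 3)" "\<not> R (w 1) (w 3)" "\<not> R (w 0) (w 4)" "\<not> R (w 1) (w 4)"
    "\<not> R (w 2) (w 4)"
    using induced_cycleD(3)[OF w, of 0 2] induced_cycleD(3)[OF w, of 0 3]
      induced_cycleD(3)[OF w, of 1 3] induced_cycleD(3)[OF w, of 0 4] induced_cycleD(3)[OF w, of 1 4]
      induced_cycleD(3)[OF w, of 2 4] m by auto
  have f1: "R y (w 1) \<and> R y (w 2)" if "R y (w 3)"
    using induced_cycle_fill3[OF w m] y that by blast
  have f2: "R y (w 3) \<and> R y (w 2)" if "R y (w 1)"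
    using induced_cycle_fill3[OF induced_cycle_shift[OF w, of 1] m] y that by simp
  have f3: "R y (w 1)" if "R y (w 2)"
    using quad[of "w 0" "w 1" "w 2" y] a n y that sym by blast
  show ?thesis
    using hexagon[of "w 0" "w 1" "w 2" "w 3" "w 4" y] a n y f1 f2 f3 sym by blast
qed

text \<open>Why five: a rotation moves indices by 2, so a common neighbour of five consecutive
  vertices and its rotated image still share two vertices at index distance 2, which are not
  adjacent. A quadrangle then makes the two neighbours adjacent.\<close>

definition five_star :: "(int \<Rightarrow> 'v) \<Rightarrow> bool" where
  "five_star w \<longleftrightarrow> (\<exists>y i. R y (w i) \<and> R y (w (i + 1)) \<and> R y (w (i + 2)) \<and> R y (w (i + 3)) \<and> R y (w (i + 4)))"

lemma five_star_shift: "five_star (\<lambda>j. w (k + j)) \<Longrightarrow> five_star w"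
  unfolding five_star_def by (metis add.assoc)

lemma no_five_star4:
  assumes w: "induced_cycle m w" and m: "m \<ge> 6" and N: "\<not> five_star w"
    and y: "R y (w i)" "R y (w j)" "(j - i) mod m = 4"
  shows False
proof -
  have "w j = w (i + 4)"
    using y(3) by (intro periodic_diff[of w m] induced_cycleD(1)[OF w])
  then have "\<exists>y. R y (w i) \<and> R y (w (i + 1)) \<and> R y (w (i + 2)) \<and> R y (w (i + 3)) \<and> R y (w (i + 4))"
    using induced_cycle_fill4[OF induced_cycle_shift[OF w, of i] m, of y] y by simp
  then show False using N unfolding five_star_def by blast
qed

text \<open>Without a star of five, no vertex is adjacent to cycle vertices at index distance 4, and
  \<open>aux\<close> excludes index distance 3 as well. Then distances from \<open>w 0\<close>
  produce an induced heptagon whose centre violates this.\<close>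

lemma octagon:
  assumes w: "induced_cycle 8 w"
  shows "five_star w"
proof (rule ccontr)
  assume N: "\<not> ?thesis"
  note per = induced_cycleD(1)[OF w] and adj = induced_cycleD(2)[OF w] and nR = induced_cycleD(3)[OF w]
  have F: False if "R y (w i)" "R y (w j)" "(j - i) mod 8 = 4" for y i j
    using no_five_star4[OF w _ N that] by simp
  \<comment> \<open>From \<open>w 0\<close>, the triangle condition on the edge
    \<open>w 4 w 5\<close> and convexity give \<open>z\<close> adjacent to
    \<open>w 3, ..., w 6\<close>. The walk \<open>w 0, x, w 3, z, w 6, w 7\<close> is then an
    impossible hexagon, or it shortens to an impossible pentagon if \<open>x\<close> and
    \<open>z\<close> are adjacent.\<close>
  have aux: False if w: "induced_cycle 8 w" and x: "R x (w 0)" "R x (w 3)"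
    and F: "\<And>y i j. R y (w i) \<Longrightarrow> R y (w j) \<Longrightarrow> (j - i) mod 8 = 4 \<Longrightarrow> False" for w x
  proof -
    note per = induced_cycleD(1)[OF w] and adj = induced_cycleD(2)[OF w] and nR = induced_cycleD(3)[OF w]
    have a: "R (w 0) (w 1)" "R (w 1) (w 2)" "R (w 2) (w 3)" "R (w 3) (w 4)" "R (w 4) (w 5)"
      "R (w 5) (w 6)" "R (w 6) (w 7)" "R (w 7) (w 0)"
      using adj[of 0] adj[of 1] adj[of 2] adj[of 3] adj[of 4] adj[of 5] adj[of 6] adj[of 7] per[of 0] by auto
    have n: "\<not> R (w 0) (w 3)" "\<not> R (w 3) (w 5)" "\<not> R (w 0) (w 6)" "\<not> R (w 3) (w 6)" "\<not> R (w 3) (w 7)"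
      using nR[of 0 3] nR[of 3 5] nR[of 0 6] nR[of 3 6] nR[of 3 7] by auto
    have NB2: "\<not> B2 (w 0) (w 4)" 
      using F[of _ 0 4] unfolding B2_def using sym by auto
    have B2: "B2 (w 0) (w 3)" "B2 (w 0) (w 6)"
      using x a sym by (blast intro: B2I)+
    have nB2': "\<not> B2 (w 0) (w 5)"
      using conv2[of "w 0" "w 3" "w 5" "w 4"] B2 NB2 a n sym by blast
    have "B3 (w 0) (w 4)" "B3 (w 0) (w 5)"
      using B2 a sym by (blast intro: B3I)+
    then obtain z where z: "B2 (w 0) z" "R z (w 4)" "R z (w 5)"
      using tri2 a by blast
    have z3: "R z (w 3)"
      using conv2[of "w 0" "w 3" z "w 4"] B2 NB2 a z sym by blast
    have z6: "R z (w 6)"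
      using conv2[of "w 0" "w 6" z "w 5"] B2 nB2' a z sym by blast
    have x12: "R x (w 1)" "R x (w 2)"
      using induced_cycle_fill3[OF w _ x] by auto
    have c: "\<not> R (w 0) z" "\<not> R x (w 6)" "\<not> R x (w 7)" "\<not> R z (w 7)"
      using F[of z 0 4] F[of x 2 6] F[of x 3 7] F[of z 3 7] z x x12 z3 sym by auto
    have cc: "\<not> (R c (w 0) \<and> R c (w 3) \<and> R c (w 6))" for c
      using induced_cycle_fill3[OF induced_cycle_shift[OF w, of 3], of c] F[of c 0 4] by auto
    show False
    proof (cases "R x z")
      case True
      then show False using pent[of "w 0" x z "w 6" "w 7"] x z6 c n a sym by blast
    next
      case False
      then show False using hexagon[of "w 0" x "w 3" z "w 6" "w 7"] x z3 z6 c n a cc sym by blast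
    qed
  qed
  have G: False if "R y (w i)" "R y (w j)" "(j - i) mod 8 = 3" for y i j
  proof -
    have "w j = w (i + 3)"
      using that(3) by (intro periodic_diff[of w 8] per)
    then have "R y (w (i + 0))" "R y (w (i + 3))"
      using that by simp_all
    then show False
      using aux[OF induced_cycle_shift[OF w, of i], of y] F by (metis add_diff_cancel_left)
  qed
  have a: "R (w 0) (w 1)" "R (w 1) (w 2)" "R (w 2) (w 3)" "R (w 3) (w 4)" "R (w 4) (w 5)"
      "R (w 5) (w 6)" "R (w 6) (w 7)" "R (w 7) (w 0)"
    using adj[of 0] adj[of 1] adj[of 2] adj[of 3] adj[of 4] adj[of 5] adj[of 6] adj[of 7] per[of 0] by auto
  have n: "\<not> R (w 0) (w 2)" "\<not> R (w 3) (w 5)" "\<not> R (w 0) (w 4)" "\<not> R (w 0) (w 5)" "\<not> R (w 0) (w 6)"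
     "\<not> R (w 4) (w 6)" "\<not> R (w 4) (w 7)" "\<not> R (w 5) (w 7)"
    using nR[of 0 2] nR[of 3 5] nR[of 0 4] nR[of 0 5] nR[of 0 6] nR[of 4 6] nR[of 4 7] nR[of 5 7] by auto
  have B3: "B3 (w 0) (w 3)" "B3 (w 0) (w 5)"
    using a sym by (blast intro: B2I B3I)+
  have "B4 (w 0) (w 4)" "B2 (w 0) (w 2)" using B3 a by (blast intro: B4I B2I)+
  then have B3': "B3 (w 0) (w 4)"
    using conv3[of "w 0" "w 3" "w 5" "w 4"] B3 a n sym by blast
  have NB: "\<not> B2 (w 0) (w 3)"
    using G[of _ 0 3] unfolding B2_def using sym by auto
  obtain z where z: "B2 (w 0) z" "R z (w 3)" "R z (w 4)"
    using tri2 B3 B3' a by blast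
  have z2: "R z (w 2)"
    using conv2[of "w 0" "w 2" z "w 3"] \<open>B2 (w 0) (w 2)\<close> NB a z sym by blast
  obtain c where c: "R c (w 0)" "R c z"
    using z sym unfolding B2_def by blast
  have nz: "\<not> R z (w 0)" "\<not> R z (w 1)" "\<not> R z (w 5)" "\<not> R z (w 6)" "\<not> R z (w 7)"
    using F[of z 0 4] G[of z 1 4] G[of z 2 5] F[of z 2 6] F[of z 3 7] z z2 by auto
  have c2: "R c (w 2)"
    using pent[of "w 0" "w 1" "w 2" z c] quad[of c "w 1" "w 2" z] c nz n a z z2 sym by blast
  have nc: "\<not> R c (w 4)" "\<not> R c (w 5)" "\<not> R c (w 6)" "\<not> R c (w 7)"
    using F[of c 0 4] G[of c 5 0] F[of c 2 6] G[of c 7 2] c c2 by auto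
  \<comment> \<open>The path through \<open>c\<close> and \<open>z\<close> replaces the arc from
    \<open>w 0\<close> to \<open>w 4\<close> and shortens the octagon to a heptagon; this is what
    its centre contradicts.\<close>
  have "\<not> (R e (w 0) \<and> R e (w 4))" for e
    using F[of e 0 4] by auto
  then show False
    using heptagon[of "w 0" c z "w 4" "w 5" "w 6" "w 7"] a c n nz nc z sym by blast
qed

text \<open>Index distance 6 is 4 read backwards. For 5, the vertex \<open>y\<close> closes the arc
  \<open>w 0, ..., w 5\<close> to an induced heptagon, whose centre would give a star of
  five.\<close>

lemma no_five_star_decagon:
  assumes w: "induced_cycle 10 w" and N: "\<not> five_star w"
    and y: "R y (w i)" "R y (w j)" "(j - i) mod 10 \<in> {4, 5, 6}"
  shows False
proof -
  have F4: False if "R y (w i)" "R y (w j)" "(j - i) mod 10 = 4" for i j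
    using no_five_star4[OF w _ N that] by simp
  have F6: False if "R y (w i)" "R y (w j)" "(j - i) mod 10 = 6" for i j
  proof -
    have "(i - j) mod 10 = 4" using that(3) by presburger
    then show False using F4 that by blast
  qed
  have F5: False if w: "induced_cycle 10 w" and y: "R y (w 0)" "R y (w 5)" and N: "\<not> five_star w" for w
  proof -
    note per = induced_cycleD(1)[OF w] and adj = induced_cycleD(2)[OF w] and nR = induced_cycleD(3)[OF w]
    have a: "R (w 0) (w 1)" "R (w 1) (w 2)" "R (w 2) (w 3)" "R (w 3) (w 4)" "R (w 4) (w 5)"
      using adj[of 0] adj[of 1] adj[of 2] adj[of 3] adj[of 4] by auto
    have n: "\<not> R (w 0) (w 2)" "\<not> R (w 0) (w 3)" "\<not> R (w 0) (w 4)" "\<not> R (w 0) (w 5)" "\<not> R (w 1) (w 3)"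
      "\<not> R (w 1) (w 4)" "\<not> R (w 1) (w 5)" "\<not> R (w 2) (w 4)" "\<not> R (w 2) (w 5)" "\<not> R (w 3) (w 5)"
      using nR[of 0 2] nR[of 0 3] nR[of 0 4] nR[of 0 5] nR[of 1 3] nR[of 1 4] nR[of 1 5] nR[of 2 4]
        nR[of 2 5] nR[of 3 5] by auto
    have 1: "\<not> (R c (w 0) \<and> R c (w 4))" "\<not> (R c (w 1) \<and> R c (w 5))" for c
      using no_five_star4[OF w _ N, of c 0 4] no_five_star4[OF w _ N, of c 1 5] by auto
    have 2: "\<not> R y (w 2)" "\<not> R y (w 3)"
      using induced_cycle_fill3[OF w, of y] induced_cycle_fill3[OF induced_cycle_shift[OF w, of 2], of y]
        y 1 by auto
    have "\<exists>c. R c (w 0) \<and> R c (w 1) \<and> R c (w 2) \<and> R c (w 3) \<and> R c (w 4) \<and> R c (w 5) \<and> R c y"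
      using heptagon[of "w 0" "w 1" "w 2" "w 3" "w 4" "w 5" y] a n y 1 2 sym by blast
    then show False using 1 by blast
  qed
  consider "(j - i) mod 10 = 4" | "(j - i) mod 10 = 5" | "(j - i) mod 10 = 6"
    using y by blast
  then show False
  proof cases
    case 2
    have "w j = w (i + 5)"
      by (rule periodic_diff[of w 10, OF induced_cycleD(1)[OF w] 2])
    then have "R y (w (i + 0))" "R y (w (i + 5))"
      using y by simp_all
    then show False
      using F5[OF induced_cycle_shift[OF w, of i]] five_star_shift N by blast
  qed (use F4 F6 y in blast)+
qed

text \<open>The triangle condition descends from the edge \<open>w 4 w 5\<close>, within distance 4
  of \<open>w 0\<close>, through \<open>z\<close>, \<open>e\<close> and \<open>p\<close> within
  distances 3, 2 and 1. Convexity and a quadrangle attach them to the arc, which yields a strip of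
  triangles along this half of the decagon.\<close>

lemma decagon_strip:
  assumes w: "induced_cycle 10 w" and N: "\<not> B3 (w 0) (w 5)" "\<not> B3 (w 0) (w 4)"
  shows "\<exists>z e p. R z (w 3) \<and> R z (w 4) \<and> R z (w 5) \<and> R e z \<and> R e (w 2) \<and> R e (w 3) \<and> R p e \<and>
    R p (w 0) \<and> R p (w 1) \<and> R p (w 2) \<and> B3 (w 0) z"
proof -
  note adj = induced_cycleD(2)[OF w] and nR = induced_cycleD(3)[OF w] and per = induced_cycleD(1)[OF w]
  have a: "R (w 0) (w 1)" "R (w 1) (w 2)" "R (w 2) (w 3)" "R (w 3) (w 4)" "R (w 4) (w 5)"
     "R (w 5) (w 6)" "R (w 6) (w 7)" "R (w 7) (w 8)" "R (w 8) (w 9)" "R (w 9) (w 0)"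
    using adj[of 0] adj[of 1] adj[of 2] adj[of 3] adj[of 4] adj[of 5] adj[of 6] adj[of 7] adj[of 8]
      adj[of 9] per[of 0] by auto
  have n: "\<not> R (w 0) (w 2)" "\<not> R (w 4) (w 6)"
    using nR[of 0 2] nR[of 4 6] by auto
  have B: "B2 (w 0) (w 2)" "B3 (w 0) (w 3)" "B4 (w 0) (w 4)" "B4 (w 0) (w 6)"
    using a sym by (blast intro: B2I B3I B4I)+
  have NB: "\<not> B2 (w 0) (w 3)" using N a by (blast intro: B3I)
  have "B4 (w 0) (w 5)"
    using conv[of "Suc (Suc (Suc (Suc 0)))", unfolded relpowp_B, of "w 0" "w 4" "w 6" "w 5"] B a n sym by blast
  then obtain z where z: "B3 (w 0) z" "R z (w 4)" "R z (w 5)"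
    using tri3 B a by blast
  have z3: "R z (w 3)" using conv3[of "w 0" "w 3" z "w 4"] B z a N sym by blast
  then obtain e where e: "B2 (w 0) e" "R e z" "R e (w 3)" using tri2 B z by blast
  have e2: "R e (w 2)" using conv2[of "w 0" "w 2" e "w 3"] B e a NB sym by blast
  then obtain p where p: "R (w 0) p" "R p e" "R p (w 2)" using tri1 B e by blast
  have "R p (w 1)" using quad[of "w 0" "w 1" "w 2" p] p a n sym by blast
  then show ?thesis using z z3 e e2 p sym by blast
qed

text \<open>The strips along the two halves are joined by the edges \<open>p s\<close> near
  \<open>w 0\<close> and \<open>z z'\<close> near \<open>w 5\<close>, both by convexity. The hole
  \<open>p e z z' g s\<close> left between them is an induced hexagon, and its centre would be
  adjacent to \<open>w 3\<close> and \<open>w 7\<close>, at index distance 4.\<close>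

lemma decagon_far:
  assumes w: "induced_cycle 10 w"
    and B3: "\<not> B3 (w 0) (w 5)" "\<not> B3 (w 0) (w 4)" "\<not> B3 (w 0) (w 6)"
    and B2: "\<And>i j. (j - i) mod 10 = 3 \<Longrightarrow> \<not> B2 (w i) (w j)"
  shows "five_star w"
proof (rule ccontr)
  assume N: "\<not> five_star w"
  note adj = induced_cycleD(2)[OF w] and nR = induced_cycleD(3)[OF w] and per = induced_cycleD(1)[OF w]
  note F = no_five_star_decagon[OF w N]
  have F3: False if "R y (w i)" "R y (w j)" "(j - i) mod 10 = 3" for y i j
    using B2[OF that(3)] that sym unfolding B2_def by blast
  have a: "R (w 0) (w 1)" "R (w 1) (w 2)" "R (w 2) (w 3)" "R (w 3) (w 4)" "R (w 4) (w 5)"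
     "R (w 5) (w 6)" "R (w 6) (w 7)" "R (w 7) (w 8)" "R (w 8) (w 9)" "R (w 9) (w 0)"
    using adj[of 0] adj[of 1] adj[of 2] adj[of 3] adj[of 4] adj[of 5] adj[of 6] adj[of 7] adj[of 8]
      adj[of 9] per[of 0] by auto
  have m: "w (-3) = w 7" "w (-4) = w 6" "w (-5) = w 5" "w (-2) = w 8" "w (-1) = w 9"
    using per[of "-3"] per[of "-4"] per[of "-5"] per[of "-2"] per[of "-1"] by simp_all
  obtain z e p where z: "R z (w 3)" "R z (w 4)" "R z (w 5)" and e: "R e z" "R e (w 2)" "R e (w 3)"
    and p: "R p e" "R p (w 0)" "R p (w 1)" "R p (w 2)" and z0: "B3 (w 0) z"
    using decagon_strip[OF w B3(1,2)] by blast
  obtain z' g s where z': "R z' (w 7)" "R z' (w 6)" "R z' (w 5)" and g: "R g z'" "R g (w 8)" "R g (w 7)"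
    and s: "R s g" "R s (w 0)" "R s (w 9)" "R s (w 8)" and z0': "B3 (w 0) z'"
    using decagon_strip[OF induced_cycle_mirror[OF w]] B3 m by auto
  have n: "\<not> R (w 0) (w 8)" "\<not> R (w 0) (w 2)" "\<not> R (w 5) (w 7)" "\<not> R (w 5) (w 3)"
    using nR[of 0 8] nR[of 0 2] nR[of 5 7] nR[of 5 3] by auto
  have zz: "R z z'"
    using conv3[of "w 0" z z' "w 5"] z z' z0 z0' B3 sym by blast
  have "B3 (w 5) p" "B3 (w 5) s"
    using p e z s g z' sym by (blast intro: B2I B3I)+
  then have ps: "R p s"
    using conv3[of "w 5" p s "w 0"] p s B3 B3_sym sym by blast
  have n1: "\<not> R (w 0) g" "\<not> R (w 0) e"
    using B3 g z' e z sym by (blast intro: B2I B3I)+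
  have n2: "\<not> R (w 5) g" "\<not> R (w 5) e"
    using B3 g s e p sym by (blast intro: B2I B3I)+
  have n3: "\<not> R p z" "\<not> R p z'" "\<not> R s z" "\<not> R s z'"
    using B3 p s z z' sym by (blast intro: B2I B3I)+
  have c1: "\<not> R p (w 8)" "\<not> R p (w 9)" "\<not> R s (w 2)" "\<not> R s (w 1)"
    using F[of p 2 8] F3[of p 9 2] F[of s 2 8] F3[of s 8 1] p s by auto
  have c2: "\<not> R z (w 7)" "\<not> R z (w 6)" "\<not> R z' (w 3)" "\<not> R z' (w 4)"
    using F[of z 3 7] F3[of z 3 6] F[of z' 3 7] F3[of z' 4 7] z z' by auto
  have pg: "\<not> R p g"
    using pent[of "w 0" p g "w 8" "w 9"] quad[of "w 0" p g "w 9"] p g s a n n1 c1 sym by blast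
  have es: "\<not> R e s"
    using pent[of "w 0" s e "w 2" "w 1"] quad[of "w 0" s e "w 1"] p e s a n n1 c1 sym by blast
  have zg: "\<not> R z g"
    using pent[of "w 5" z g "w 7" "w 6"] quad[of "w 5" z g "w 6"] z g z' a n n2 c2 sym by blast
  have ez: "\<not> R e z'"
    using pent[of "w 5" z' e "w 3" "w 4"] quad[of "w 5" z' e "w 4"] z e z' a n n2 c2 sym by blast
  have eg: "\<not> R e g"
    using quad[of p e g s] p ps s pg es sym by blast
  obtain c where c: "R c p" "R c e" "R c z" "R c z'" "R c g" "R c s"
    using hexagon[of p e z z' g s] p e z zz z' g s ps n3 pg es zg ez eg sym by blast
  have d: "\<not> R z (w 2)" "\<not> R z' (w 8)" "\<not> R p (w 3)" "\<not> R s (w 7)"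
    using F3[of z 2 5] F3[of z' 5 8] F3[of p 0 3] F3[of s 7 0] z z' p s by auto
  have "R c (w 3)"
    using pent[of "w 2" "w 3" z c p] quad[of c "w 2" "w 3" z] c p z a d n3 sym by blast
  moreover have "R c (w 7)"
    using pent[of "w 8" "w 7" z' c s] quad[of c "w 8" "w 7" z'] c s z' a d n3 sym by blast
  ultimately show False using F[of c 3 7] by auto
qed

text \<open>Convexity brings \<open>w 4\<close> within distance 3 of \<open>w 0\<close> too, so the
  edge \<open>w 4 w 5\<close> has a common neighbour \<open>z\<close> joined to \<open>w 0\<close>
  through some \<open>q\<close>. With the arc up to \<open>w 3\<close> or \<open>w 4\<close> this
  closes to a hexagon or heptagon, whose centre would be adjacent to \<open>w 0\<close> and
  \<open>w 3\<close>.\<close>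

lemma decagon_wide:
  assumes w: "induced_cycle 10 w" and B3: "B3 (w 0) (w 5)"
    and B2: "\<And>i j. (j - i) mod 10 = 3 \<Longrightarrow> \<not> B2 (w i) (w j)"
  shows "five_star w"
proof (rule ccontr)
  assume N: "\<not> five_star w"
  note adj = induced_cycleD(2)[OF w] and nR = induced_cycleD(3)[OF w] and per = induced_cycleD(1)[OF w]
  note F = no_five_star_decagon[OF w N]
  have F3: False if "R y (w i)" "R y (w j)" "(j - i) mod 10 = 3" for y i j
    using B2[OF that(3)] that sym unfolding B2_def by blast
  have a: "R (w 0) (w 1)" "R (w 1) (w 2)" "R (w 2) (w 3)" "R (w 3) (w 4)" "R (w 4) (w 5)"
    using adj[of 0] adj[of 1] adj[of 2] adj[of 3] adj[of 4] by auto
  have n: "\<not> R (w 0) (w 2)" "\<not> R (w 0) (w 3)" "\<not> R (w 0) (w 4)" "\<not> R (w 1) (w 3)"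
      "\<not> R (w 1) (w 4)" "\<not> R (w 2) (w 4)" "\<not> R (w 3) (w 5)"
    using nR[of 0 2] nR[of 0 3] nR[of 0 4] nR[of 1 3] nR[of 1 4] nR[of 2 4] nR[of 3 5] by auto
  have "B3 (w 0) (w 3)" using a by (blast intro: B2I B3I)
  then have "B4 (w 0) (w 4)" using a by (blast intro: B4I)
  then have "B3 (w 0) (w 4)"
    using conv3[of "w 0" "w 3" "w 5" "w 4"] \<open>B3 (w 0) (w 3)\<close> B3 a n sym by blast
  then obtain z where z: "B2 (w 0) z" "R z (w 4)" "R z (w 5)"
    using tri2 B3 a by blast
  then obtain q where q: "R q (w 0)" "R q z" unfolding B2_def using sym by blast
  have nz: "\<not> R z (w 2)" "\<not> R z (w 1)" "\<not> R z (w 0)" and nq: "\<not> R q (w 3)" "\<not> R q (w 4)"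
    using F3[of z 2 5] F3[of z 1 4] F[of z 0 4] F3[of q 0 3] F[of q 0 4] z q by auto
  have nc: "\<not> (R c (w 0) \<and> R c (w 3))" "\<not> (R c (w 1) \<and> R c (w 4))" for c
    using F3[of c 0 3] F3[of c 1 4] by auto
  show False
  proof (cases "R z (w 3)")
    case True
    have q2: "\<not> R q (w 2)"
      using quad[of q "w 2" "w 3" z] True q a nq nz sym by blast
    have q1: "\<not> R q (w 1)"
      using pent[of q "w 1" "w 2" "w 3" z] True q2 q a nq nz n sym by blast
    show False
      using hexagon[of "w 0" "w 1" "w 2" "w 3" z q] True q1 q2 q a nq nz n nc sym by blast
  next
    case False
    have q2: "\<not> R q (w 2)"
      using pent[of q "w 2" "w 3" "w 4" z] False q z a nq nz n sym by blast
    have q1: "\<not> R q (w 1)"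
      using hexagon[of q "w 1" "w 2" "w 3" "w 4" z] False q2 q z a nq nz n nc sym by blast
    show False
      using heptagon[of "w 0" "w 1" "w 2" "w 3" "w 4" z q] False q1 q2 q z a nq nz n nc sym by blast
  qed
qed

text \<open>The three common neighbours shorten the decagon to
  \<open>w 0, x, w 3, y, w 6, z, w 9\<close>. Each of the possible edges \<open>x y\<close> and
  \<open>y z\<close> shortens it further, and the pentagon, the two hexagons and the heptagon are
  all impossible.\<close>

lemma decagon_both:
  assumes w: "induced_cycle 10 w" and B2: "B2 (w 0) (w 3)" "B2 (w 3) (w 6)" "B2 (w 6) (w 9)"
  shows "five_star w"
proof (rule ccontr)
  assume N: "\<not> five_star w"
  note adj = induced_cycleD(2)[OF w] and nR = induced_cycleD(3)[OF w] and per = induced_cycleD(1)[OF w]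
  note F = no_five_star_decagon[OF w N]
  obtain x y z where x: "R x (w 0)" "R x (w 3)" and y: "R y (w 3)" "R y (w 6)" and z: "R z (w 6)" "R z (w 9)"
    using B2 sym unfolding B2_def by blast
  have a: "R (w 9) (w 0)" using adj[of 9] per[of 0] by auto
  have n: "\<not> R (w 0) (w 3)" "\<not> R (w 0) (w 6)" "\<not> R (w 3) (w 6)" "\<not> R (w 3) (w 9)" "\<not> R (w 6) (w 9)"
    using nR[of 0 3] nR[of 0 6] nR[of 3 6] nR[of 3 9] nR[of 6 9] by auto
  have nx: "\<not> R x (w 6)" "\<not> R x (w 9)" "\<not> R y (w 0)" "\<not> R y (w 9)" "\<not> R z (w 0)" "\<not> R z (w 3)"
    using F[of x 0 6] F[of x 3 9] F[of y 0 6] F[of y 3 9] F[of z 0 6] F[of z 3 9] x y z by auto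
  have nc: "\<not> (R c (w 0) \<and> R c (w 6))" "\<not> (R c (w 3) \<and> R c (w 9))" for c
    using F[of c 0 6] F[of c 3 9] by auto
  have xz: "\<not> R x z"
    using quad[of "w 0" x z "w 9"] x z a nx sym by blast
  have "\<not> (R x y \<and> R y z)"
    using pent[of "w 0" x y z "w 9"] x y z a nx xz sym by blast
  moreover have "\<not> (R x y \<and> \<not> R y z)"
    using hexagon[of "w 0" x y "w 6" z "w 9"] x y z a n nx xz nc sym by blast
  moreover have "\<not> (\<not> R x y \<and> R y z)"
    using hexagon[of "w 0" x "w 3" y z "w 9"] x y z a n nx xz nc sym by blast
  moreover have "\<not> (\<not> R x y \<and> \<not> R y z)"
    using heptagon[of "w 0" x "w 3" y "w 6" z "w 9"] x y z a n nx xz nc sym by blast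
  ultimately show False by blast
qed

text \<open>The octagon result for eight separately given vertices, to be applied to an octagon that
  mixes vertices of the decagon with others. There is one hypothesis for each cyclic run of
  five.\<close>

lemma octagon_vertices:
  assumes a: "R a0 a1" "R a1 a2" "R a2 a3" "R a3 a4" "R a4 a5" "R a5 a6" "R a6 a7" "R a7 a0"
    and n: "\<not> R a0 a2" "\<not> R a0 a3" "\<not> R a0 a4" "\<not> R a0 a5" "\<not> R a0 a6"
      "\<not> R a1 a3" "\<not> R a1 a4" "\<not> R a1 a5" "\<not> R a1 a6" "\<not> R a1 a7"
      "\<not> R a2 a4" "\<not> R a2 a5" "\<not> R a2 a6" "\<not> R a2 a7"
      "\<not> R a3 a5" "\<not> R a3 a6" "\<not> R a3 a7" "\<not> R a4 a6" "\<not> R a4 a7" "\<not> R a5 a7"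
    and N: "\<And>y. \<not> (R y a0 \<and> R y a1 \<and> R y a2 \<and> R y a3 \<and> R y a4)"
      "\<And>y. \<not> (R y a1 \<and> R y a2 \<and> R y a3 \<and> R y a4 \<and> R y a5)"
      "\<And>y. \<not> (R y a2 \<and> R y a3 \<and> R y a4 \<and> R y a5 \<and> R y a6)"
      "\<And>y. \<not> (R y a3 \<and> R y a4 \<and> R y a5 \<and> R y a6 \<and> R y a7)"
      "\<And>y. \<not> (R y a4 \<and> R y a5 \<and> R y a6 \<and> R y a7 \<and> R y a0)"
      "\<And>y. \<not> (R y a5 \<and> R y a6 \<and> R y a7 \<and> R y a0 \<and> R y a1)"
      "\<And>y. \<not> (R y a6 \<and> R y a7 \<and> R y a0 \<and> R y a1 \<and> R y a2)"
      "\<And>y. \<not> (R y a7 \<and> R y a0 \<and> R y a1 \<and> R y a2 \<and> R y a3)"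
  shows False
proof -
  define l where "l = [a0, a1, a2, a3, a4, a5, a6, a7]"
  define w where "w i = l ! nat (i mod 8)" for i :: int
  have r: "i mod 8 \<in> {0, 1, 2, 3, 4, 5, 6, 7}" for i :: int
  proof -
    have "k \<in> {0, 1, 2, 3, 4, 5, 6, 7}" if "0 \<le> k" "k < 8" for k :: int
      using that by (smt (verit) insert_iff)
    then show ?thesis by simp
  qed
  have w_add: "w (i + k) = l ! nat ((i mod 8 + k) mod 8)" for i k
    unfolding w_def by (simp add: mod_add_left_eq)
  have "induced_cycle 8 w"
    unfolding induced_cycle_def
  proof (intro conjI allI impI)
    show "w (i + 8) = w i" for i unfolding w_def by simp
    show "R (w i) (w (i + 1))" for i
      unfolding w_add using r[of i] a by (auto simp: w_def l_def)
    show "(j - i) mod 8 \<in> {0, 1, 8 - 1}" if "R (w i) (w j)" for i j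
    proof -
      have n': "\<not> R a2 a0" "\<not> R a3 a0" "\<not> R a4 a0" "\<not> R a5 a0" "\<not> R a6 a0"
        "\<not> R a3 a1" "\<not> R a4 a1" "\<not> R a5 a1" "\<not> R a6 a1" "\<not> R a7 a1"
        "\<not> R a4 a2" "\<not> R a5 a2" "\<not> R a6 a2" "\<not> R a7 a2"
        "\<not> R a5 a3" "\<not> R a6 a3" "\<not> R a7 a3" "\<not> R a6 a4" "\<not> R a7 a4" "\<not> R a7 a5"
        using n sym by blast+
      have "(j - i) mod 8 = (j mod 8 - i mod 8) mod 8"
        by (simp add: mod_diff_eq)
      moreover have "\<forall>p\<in>{0, 1, 2, 3, 4, 5, 6, 7}. \<forall>q\<in>{0, 1, 2, 3, 4, 5, 6, 7::int}.
          R (l ! nat p) (l ! nat q) \<longrightarrow> (q - p) mod 8 \<in> {0, 1, 8 - 1}"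
        by (simp add: l_def n n')
      ultimately show ?thesis
        using r[of i] r[of j] that unfolding w_def by metis
    qed
  qed
  then obtain y i where y: "R y (w (i + 0))" "R y (w (i + 1))" "R y (w (i + 2))" "R y (w (i + 3))" "R y (w (i + 4))"
    using octagon unfolding five_star_def by fastforce
  have "\<forall>p\<in>{0, 1, 2, 3, 4, 5, 6, 7}. \<not> (
      R y (l ! nat ((p + 0) mod 8)) \<and> R y (l ! nat ((p + 1) mod 8)) \<and> R y (l ! nat ((p + 2) mod 8)) \<and>
      R y (l ! nat ((p + 3) mod 8)) \<and> R y (l ! nat ((p + 4) mod 8)))"
    unfolding ball_simps using N[of y] by (simp add: l_def)
  from bspec[OF this r[of i]] show ?thesis
    using y unfolding w_add by (elim notE) (intro conjI)
qed

text \<open>For even \<open>i\<close> some \<open>x i\<close> covers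
  \<open>w i, ..., w (i + 3)\<close>. Successive ones of these five vertices are adjacent, as
  otherwise an induced octagon appears; those at index distance 4 never are. So the five form a
  pentagon without diagonals.\<close>

lemma decagon_alternating:
  assumes w: "induced_cycle 10 w"
    and B2: "\<And>i. even i \<Longrightarrow> B2 (w i) (w (i + 3))"
    and NB2: "\<And>i j. odd i \<Longrightarrow> (j - i) mod 10 = 3 \<Longrightarrow> \<not> B2 (w i) (w j)"
  shows "five_star w"
proof (rule ccontr)
  assume N: "\<not> five_star w"
  note F = no_five_star_decagon[OF w N]
  note adj = induced_cycleD(2)[OF w] and nR = induced_cycleD(3)[OF w] and per = induced_cycleD(1)[OF w]
  have F3: False if "R y (w i)" "R y (w j)" "(j - i) mod 10 = 3" "odd i" for y i j
    using NB2[OF that(4,3)] that sym unfolding B2_def by blast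
  have "\<exists>x. R x (w i) \<and> R x (w (i + 1)) \<and> R x (w (i + 2)) \<and> R x (w (i + 3))" if i: "even i" for i
  proof -
    obtain x where "R x (w (i + 0))" "R x (w (i + 3))"
      using B2[OF i] sym unfolding B2_def by auto
    then show ?thesis
      using induced_cycle_fill3[OF induced_cycle_shift[OF w, of i], of x] by auto
  qed
  then obtain x' where x': "\<And>i. even i \<Longrightarrow> R (x' i) (w i) \<and> R (x' i) (w (i + 1)) \<and> R (x' i) (w (i + 2)) \<and> R (x' i) (w (i + 3))"
    by metis
  \<comment> \<open>Made 10-periodic, so that the five vertices close up to a cycle.\<close>
  define x where "x i = x' (i mod 10)" for i
  have x: "R (x i) (w i) \<and> R (x i) (w (i + 1)) \<and> R (x i) (w (i + 2)) \<and> R (x i) (w (i + 3))" if i: "even i" for i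
  proof -
    have "w (i mod 10 + k) = w (i + k)" for k
      by (rule periodic_mod[of w 10, OF per]) (simp add: mod_add_left_eq)
    from this[of 0] this show ?thesis
      using x'[of "i mod 10"] i unfolding x_def by (simp add: dvd_mod)
  qed
  have far: "\<not> R (x i) (x (i + 4))" if i: "even i" for i
  proof
    assume *: "R (x i) (x (i + 4))"
    have "R (w (i + 3)) (w (i + 4))" using adj[of "i + 3"] by (simp add: add.assoc)
    then have "R (x i) (w (i + 4)) \<or> R (w (i + 3)) (x (i + 4))"
      using quad[of "x i" "w (i + 3)" "w (i + 4)" "x (i + 4)"] * x[OF i] x[of "i + 4"] i sym by auto
    then show False
      using F[of "x i" i "i + 4"] F[of "x (i + 4)" "i + 3" "i + 4 + 3"] x[OF i] x[of "i + 4"] i sym by auto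
  qed
  \<comment> \<open>\<open>i + 8\<close> is \<open>i - 2\<close> modulo 10. If the two vertices were
    not adjacent, they would form an induced octagon with \<open>x (i + 4)\<close> and five vertices
    of the decagon.\<close>
  have near: "R (x i) (x j)" if i: "even i" "even j" "j = i + 8" for i j
  proof (rule ccontr)
    assume nij: "\<not> R (x i) (x j)"
    define X Y Z where "X = x i" and "Y = x (i + 4)" and "Z = x (i + 8)"
    define v where "v k = w (i + k)" for k
    have X: "R X (v 0)" "R X (v 1)" "R X (v 2)" "R X (v 3)"
      using x[of i] i unfolding v_def X_def by auto
    have Y: "R Y (v 4)" "R Y (v 5)" "R Y (v 6)" "R Y (v 7)"
      using x[of "i + 4"] i unfolding v_def Y_def by (auto simp: add.assoc)
    have per': "v (k + 10) = v k" for k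
      using per[of "i + k"] unfolding v_def by (simp add: add.assoc)
    have Z: "R Z (v 8)" "R Z (v 9)" "R Z (v 0)" "R Z (v 1)"
      using x[of "i + 8"] i per'[of 0] per'[of 1] unfolding v_def Z_def by (auto simp: add.assoc)
    have v: "induced_cycle 10 v"
      using induced_cycle_shift[OF w, of i] unfolding v_def .
    have Nv: "\<not> five_star v"
      using five_star_shift N unfolding v_def by blast
    note F = no_five_star_decagon[OF v Nv] and adj = induced_cycleD(2)[OF v] and nR = induced_cycleD(3)[OF v]
    have F3: False if "R y (v k)" "R y (v l)" "(l - k) mod 10 = 3" "odd k" for y k l
      using F3[of y "i + k" "i + l"] that i unfolding v_def by auto
    have a: "R (v 3) (v 4)" "R (v 7) (v 8)"
      using adj[of 3] adj[of 7] by auto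
    have n: "\<not> R (v 3) (v 7)" "\<not> R (v 3) (v 8)" "\<not> R (v 3) (v 1)" "\<not> R (v 4) (v 7)" "\<not> R (v 4) (v 8)"
       "\<not> R (v 4) (v 1)" "\<not> R (v 7) (v 1)" "\<not> R (v 8) (v 1)"
      using nR[of 3 7] nR[of 3 8] nR[of 3 1] nR[of 4 7] nR[of 4 8] nR[of 4 1] nR[of 7 1] nR[of 8 1] by auto
    have XY: "\<not> R X Y" and YZ: "\<not> R Y Z" and XZ: "\<not> R X Z"
      using far[of i] far[of "i + 4"] i nij unfolding X_def Y_def Z_def by (auto simp: add.assoc)
    have nn: "\<not> R X (v 4)" "\<not> R X (v 7)" "\<not> R X (v 8)" "\<not> R (v 3) Y" "\<not> R (v 3) Z" "\<not> R (v 4) Z"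
       "\<not> R Y (v 8)" "\<not> R Y (v 1)" "\<not> R (v 7) Z"
      using F[of X 0 4] F[of X 3 7] F[of X 2 8] F[of Y 3 7] F[of Z 3 8] F[of Z 4 8] F[of Y 4 8]
        F[of Y 1 5] F[of Z 7 1] X Y Z sym by auto
    have fv: "\<not> (R y (v 3) \<and> R y (v 7))" "\<not> (R y (v 4) \<and> R y (v 8))" "\<not> (R y (v 7) \<and> R y (v 1))"
      "\<not> (R y (v 8) \<and> R y (v 3))" "\<not> (R y (v 1) \<and> R y (v 4))" for y
      using F[of y 3 7] F[of y 4 8] F[of y 7 1] F[of y 8 3] F3[of y 1 4] by auto
    show False
    proof (rule octagon_vertices[of X "v 3" "v 4" Y "v 7" "v 8" Z "v 1"])
    qed (use X Y Z a n nn XY YZ XZ fv sym in blast)+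
  qed
  have "x 16 = x 6" "x 14 = x 4" "x 12 = x 2" "x 10 = x 0"
    unfolding x_def by simp_all
  note xs = this
  have "R (x 0) (x 8)" "R (x 8) (x 16)" "R (x 6) (x 14)" "R (x 4) (x 12)" "R (x 2) (x 10)"
    by (rule near; simp)+
  moreover have "\<not> R (x 0) (x 4)" "\<not> R (x 6) (x 10)" "\<not> R (x 4) (x 8)" "\<not> R (x 2) (x 6)" "\<not> R (x 8) (x 12)"
    using far[of 0] far[of 6] far[of 4] far[of 2] far[of 8] by simp_all
  ultimately show False
    using pent[of "x 0" "x 8" "x 6" "x 4" "x 2"] sym unfolding xs by blast
qed

text \<open>Invariance under even shifts leaves one question for each parity: do vertices at index
  distance 3 have a common neighbour? If neither parity has one, the distance between the opposite
  vertices \<open>w 0\<close> and \<open>w 5\<close> decides.\<close>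

lemma decagon:
  assumes w: "induced_cycle 10 w"
    and B2: "\<And>i j k. even k \<Longrightarrow> B2 (w i) (w j) \<Longrightarrow> B2 (w (i + k)) (w (j + k))"
    and B3: "\<And>i j k. even k \<Longrightarrow> B3 (w i) (w j) \<Longrightarrow> B3 (w (i + k)) (w (j + k))"
  shows "five_star w"
proof -
  note adj = induced_cycleD(2)[OF w] and nR = induced_cycleD(3)[OF w] and per = induced_cycleD(1)[OF w]
  have ev: "B2 (w i) (w (i + 3)) \<longleftrightarrow> B2 (w 0) (w 3)" if "even i" for i
    using B2(1)[of i 0 3] B2(1)[of "- i" i "i + 3"] that by (auto simp: add.commute)
  have od: "B2 (w i) (w (i + 3)) \<longleftrightarrow> B2 (w 1) (w 4)" if "odd i" for i
    using B2(1)[of "i - 1" 1 4] B2(1)[of "1 - i" i "i + 3"] that by (auto simp: algebra_simps)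
  have wj: "w j = w (i + 3)" if "(j - i) mod 10 = 3" for i j
    using that by (intro periodic_diff[of w 10] per)
  consider "B2 (w 0) (w 3)" "B2 (w 1) (w 4)" | "B2 (w 0) (w 3)" "\<not> B2 (w 1) (w 4)"
    | "\<not> B2 (w 0) (w 3)" "B2 (w 1) (w 4)" | "\<not> B2 (w 0) (w 3)" "\<not> B2 (w 1) (w 4)" by blast
  then show ?thesis
  proof cases
    case 1
    then show ?thesis
      using decagon_both[OF w] od[of 3] ev[of 6] by simp
  next
    case 2
    show ?thesis
    proof (rule decagon_alternating[OF w])
      show "B2 (w i) (w (i + 3))" if "even i" for i
        using ev[OF that] 2 by simp
      show "\<not> B2 (w i) (w j)" if "odd i" "(j - i) mod 10 = 3" for i j
        using od[OF that(1)] wj[OF that(2)] 2 by simp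
    qed
  next
    case 3
    have "five_star (\<lambda>j. w (1 + j))"
    proof (rule decagon_alternating[OF induced_cycle_shift[OF w]])
      show "B2 (w (1 + i)) (w (1 + (i + 3)))" if "even i" for i
        using od[of "1 + i"] 3 that by (simp add: add.assoc)
      show "\<not> B2 (w (1 + i)) (w (1 + j))" if "odd i" "(j - i) mod 10 = 3" for i j
        using ev[of "1 + i"] wj[of "1 + j" "1 + i"] 3 that by auto
    qed
    then show ?thesis by (rule five_star_shift)
  next
    case 4
    have N: "\<not> B2 (w i) (w j)" if "(j - i) mod 10 = 3" for i j
      using ev[of i] od[of i] wj[OF that] 4 by auto
    show ?thesis
    proof (cases "B3 (w 0) (w 5)")
      case True
      then show ?thesis using decagon_wide[OF w] N by blast
    next
      case False
      \<comment> \<open>Rotations make \<open>w 4\<close> and \<open>w 6\<close> equally close to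
        \<open>w 0\<close>; if both were within distance 3, convexity would put \<open>w 5\<close>
        there as well.\<close>
      have "B3 (w 0) (w 4) \<longleftrightarrow> B3 (w 0) (w 6)"
      proof
        assume "B3 (w 0) (w 4)"
        from B3[OF _ this, of 6] have "B3 (w 6) (w 10)" by simp
        then show "B3 (w 0) (w 6)" using per[of 0] B3_sym by simp
      next
        assume "B3 (w 0) (w 6)"
        from B3[OF _ this, of 4] have "B3 (w 4) (w 10)" by simp
        then show "B3 (w 0) (w 4)" using per[of 0] B3_sym by simp
      qed
      moreover have "\<not> (B3 (w 0) (w 4) \<and> B3 (w 0) (w 6))"
        using conv3[of "w 0" "w 4" "w 6" "w 5"] adj[of 4] adj[of 5] nR[of 4 6] False sym by auto
      ultimately show ?thesis
        using decagon_far[OF w] False N by blast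
    qed
  qed
qed

end

section \<open>Closed walks with dihedral symmetry\<close>

context bridged begin

text \<open>The dihedral symmetry reduces the relation to \<open>E d\<close>, \<open>d\<close> modulo \<open>m\<close>: adjacency of \<open>w 0\<close> and
  \<open>w d\<close>.\<close>

lemma dihedral_walk_complete:
  fixes n :: nat and w :: "int \<Rightarrow> 'v"
  assumes n: "1 \<le> n" "n \<le> 5"
    and per: "\<And>i. w (i + 2 * int n) = w i"
    and step: "\<And>i. R (w i) (w (i + 1))"
    and rot: "\<And>i j k. even k \<Longrightarrow> R (w i) (w j) \<Longrightarrow> R (w (i + k)) (w (j + k))"
    and refl': "\<And>i j. R (w i) (w j) \<Longrightarrow> R (w (1 - i)) (w (1 - j))"
    and diag: "n \<le> 2 \<or> (\<exists>i j. R (w i) (w j) \<and> (j - i) mod (2 * int n) \<notin> {0, 1, 2 * int n - 1})"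
  shows "R (w i) (w j)"
proof -
  define m where "m = 2 * int n"
  define E where "E d = R (w 0) (w d)" for d
  have per: "w (i + m) = w i" for i using per unfolding m_def .
  have E_mod: "E d = E (d mod m)" for d
    unfolding E_def using periodic_mod[of w m d "d mod m"] per by simp
  have even: "R (w i) (w j) = E ((j - i) mod m)" if "even i" for i j
    unfolding E_mod[symmetric] unfolding E_def
    using rot[of "- i" i j] rot[of i 0 "j - i"] that by auto
  \<comment> \<open>A reflection reverses orientation, so from an odd index the difference is read
    backwards. Symmetry of \<open>R\<close> therefore identifies \<open>E d\<close> with
    \<open>E (- d)\<close> for even \<open>d\<close> only.\<close>
  have odd: "R (w i) (w j) = E ((i - j) mod m)" if "odd i" for i j
  proof -
    have "R (w i) (w j) = R (w (1 - i)) (w (1 - j))"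
      using refl'[of i j] refl'[of "1 - i" "1 - j"] by auto
    then show ?thesis using even[of "1 - i" "1 - j"] that by simp
  qed
  have E_neg: "E d = E ((- d) mod m)" if "even d" for d
    using even[of d 0] that sym unfolding E_def by auto
  have E0: "E 0" "E 1" "E ((-1) mod m)"
    using step[of 0] step[of "-1"] odd[of "-1" 0] E_mod[of "-1"] unfolding E_def by (auto intro: sym)
  have all: "R (w i) (w j)" if "\<And>d. 0 \<le> d \<Longrightarrow> d < m \<Longrightarrow> E d" for i j
    using that even[of i j] odd[of i j] n unfolding m_def by (cases "even i") auto
  have dg: "n \<le> 2 \<or> (\<exists>d. E d \<and> 0 \<le> d \<and> d < m \<and> d \<notin> {0, 1, m - 1})"
  proof (cases "n \<le> 2")
    case False
    then obtain i j where ij: "R (w i) (w j)" "(j - i) mod m \<notin> {0, 1, m - 1}"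
      using diag unfolding m_def by blast
    have m: "m > 2" using False unfolding m_def by simp
    show ?thesis
    proof (cases "even i")
      case True
      then show ?thesis using even[OF True, of j] ij m by (intro disjI2 exI[of _ "(j - i) mod m"]) auto
    next
      case odd': False
      have "(i - j) mod m \<notin> {0, 1, m - 1}"
      proof
        assume "(i - j) mod m \<in> {0, 1, m - 1}"
        moreover have "(j - i) mod m = (- ((i - j) mod m)) mod m"
          by (simp add: mod_minus_eq)
        ultimately have "(j - i) mod m \<in> {0, (- 1) mod m, (1 - m) mod m}" by auto
        moreover have "(- 1) mod m = m - 1" "(1 - m) mod m = 1"
          using m by (auto simp: zmod_minus1 mod_diff_right_eq[symmetric])
        ultimately show False using ij(2) by auto
      qed
      then show ?thesis using odd[OF odd', of j] ij m by (intro disjI2 exI[of _ "(i - j) mod m"]) auto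
    qed
  qed simp
  have Q: "R (w a) (w c) \<or> R (w b) (w d)"
    if "R (w a) (w b)" "R (w b) (w c)" "R (w c) (w d)" "R (w d) (w a)" for a b c d
    by (rule quad[OF that])
  \<comment> \<open>The even vertices in steps of 2 and in steps of 4: for \<open>n = 5\<close> the
    diagonals of these pentagons turn \<open>E 2\<close> into \<open>E 4\<close> and
    conversely.\<close>
  note P = pent[of "w 0" "w 2" "w 4" "w 6" "w 8"] pent[of "w 0" "w 4" "w 8" "w 2" "w 6"]
  have range: "d \<in> {0, 1, 2, 3, 4, 5, 6, 7, 8, 9}" if "0 \<le> d" "d < m" for d
  proof -
    have "d < 10" using that n unfolding m_def by linarith
    with that(1) show ?thesis by (smt (verit) insert_iff)
  qed
  consider "n = 1" | "n = 2" | "n = 3" | "n = 4" | "n = 5" using n by linarith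
  then show ?thesis
  proof cases
    case 1
    then have m: "m = 2" unfolding m_def by simp
    have "E d" if "0 \<le> d" "d < m" for d
    proof -
      have "d = 0 \<or> d = 1" using that m by linarith
      then show ?thesis using E0 by auto
    qed
    then show ?thesis by (rule all)
  next
    case 2
    then have m: "m = 4" unfolding m_def by simp
    note RE = even[unfolded m] odd[unfolded m]
    have e: "E 0" "E 1" "E 3" using E0 unfolding m by auto
    have "E 2" using Q[of 0 1 2 3] e by (simp add: RE)
    then have "E d" if "0 \<le> d" "d < m" for d
      using range[OF that] that m e by auto
    then show ?thesis by (rule all)
  next
    case 3
    then have m: "m = 6" unfolding m_def by simp
    note RE = even[unfolded m] odd[unfolded m]
    have e: "E 0" "E 1" "E 5" using E0 unfolding m by auto
    have s: "E 4 = E 2" using E_neg[of 4] unfolding m by simp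
    obtain d where d: "E d" "0 \<le> d" "d < m" "d \<notin> {0, 1, m - 1}" using dg 3 by auto
    have "E 2 \<or> E 3"
      using d range[OF d(2,3)] s unfolding m by auto
    moreover have "E 3" if "E 2" using Q[of 0 2 3 5] e s that by (simp add: RE)
    moreover have "E 2" if "E 3" using Q[of 0 1 2 3] e s that by (simp add: RE)
    ultimately have "E 2" "E 3" by blast+
    then have "E d" if "0 \<le> d" "d < m" for d
      using range[OF that] that m e s by auto
    then show ?thesis by (rule all)
  next
    case 4
    then have m: "m = 8" unfolding m_def by simp
    note RE = even[unfolded m] odd[unfolded m]
    have e: "E 0" "E 1" "E 7" using E0 unfolding m by auto
    have s: "E 6 = E 2" using E_neg[of 6] unfolding m by simp
    obtain d where d: "E d" "0 \<le> d" "d < m" "d \<notin> {0, 1, m - 1}" using dg 4 by auto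
    have "E 2 \<or> E 3 \<or> E 4 \<or> E 5"
      using d range[OF d(2,3)] s unfolding m by auto
    moreover have "E 2" if "E 3" using Q[of 0 1 2 3] e s that by (simp add: RE)
    moreover have "E 2" if "E 5" using Q[of 0 7 6 5] e s that by (simp add: RE)
    moreover have "E 4" if "E 2" using Q[of 0 2 4 6] e s that by (simp add: RE)
    moreover have "E 5" if "E 4" using Q[of 0 4 5 1] e s that by (simp add: RE)
    moreover have "E 3" if "E 4" using Q[of 0 4 3 7] e s that by (simp add: RE)
    ultimately have "E 2" "E 3" "E 4" "E 5" by blast+
    then have "E d" if "0 \<le> d" "d < m" for d
      using range[OF that] that m e s by auto
    then show ?thesis by (rule all)
  next
    case 5
    then have m: "m = 10" unfolding m_def by simp
    note RE = even[unfolded m] odd[unfolded m]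
    have e: "E 0" "E 1" "E 9" using E0 unfolding m by auto
    have s: "E 8 = E 2" "E 6 = E 4" using E_neg[of 8] E_neg[of 6] unfolding m by auto
    obtain d where d: "E d" "0 \<le> d" "d < m" "d \<notin> {0, 1, m - 1}" using dg 5 by auto
    have "E 2 \<or> E 3 \<or> E 4 \<or> E 5 \<or> E 7"
      using d range[OF d(2,3)] s unfolding m by auto
    moreover have "E 2" if "E 3" using Q[of 0 1 2 3] e s that by (simp add: RE)
    moreover have "E 2" if "E 7" using Q[of 0 9 8 7] e s that by (simp add: RE)
    moreover have "E 4" if "E 5" using Q[of 0 5 4 9] e s that by (simp add: RE)
    moreover have "E 4" if "E 2" using P(1) e s that by (simp add: RE)
    moreover have "E 2" if "E 4" using P(2) e s that by (simp add: RE)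
    ultimately have e24: "E 2" "E 4" by blast+
    have e5: "E 5" using Q[of 0 1 5 6] e s e24 by (simp add: RE)
    have "E 7" using Q[of 0 2 7 9] e s e24 e5 by (simp add: RE)
    moreover have "E 3" using Q[of 0 2 3 5] e s e24 e5 by (simp add: RE)
    ultimately have "E d" if "0 \<le> d" "d < m" for d
      using range[OF that] that m e s e24 e5 by auto
    then show ?thesis by (rule all)
  qed
qed

end

section \<open>The universal cover of a locally 6-large complex\<close>

text \<open>Flagness and 6-largeness of links, spelled out for triples. Vertices may coincide, which
  spares later case distinctions; degenerate instances follow by passing to faces.\<close>

locale locally_six_large =
  fixes K :: "'v set set"
  assumes face: "\<lbrakk>\<sigma> \<in> K; \<tau> \<subseteq> \<sigma>; \<tau> \<noteq> {}\<rbrakk> \<Longrightarrow> \<tau> \<in> K"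
    and link_flag: "\<lbrakk>{c, x, y} \<in> K; {c, x, z} \<in> K; {c, y, z} \<in> K\<rbrakk> \<Longrightarrow> {x, y, z} \<in> K"
    and link_square: "\<lbrakk>{c, x, y} \<in> K; {c, y, z} \<in> K; {c, z, t} \<in> K; {c, t, x} \<in> K\<rbrakk> \<Longrightarrow>
      {c, x, z} \<in> K \<or> {c, y, t} \<in> K"
    and link_pentagon: "\<lbrakk>{c, x, y} \<in> K; {c, y, z} \<in> K; {c, z, t} \<in> K; {c, t, s} \<in> K; {c, s, x} \<in> K\<rbrakk> \<Longrightarrow>
      {c, x, z} \<in> K \<or> {c, x, t} \<in> K \<or> {c, y, t} \<in> K \<or> {c, y, s} \<in> K \<or> {c, z, s} \<in> K"
begin

abbreviation E :: "'v \<Rightarrow> 'v \<Rightarrow> bool" where "E x y \<equiv> {x, y} \<in> K"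
abbreviation T :: "'v \<Rightarrow> 'v \<Rightarrow> 'v \<Rightarrow> bool" where "T x y z \<equiv> {x, y, z} \<in> K"

lemma T_perm: "T x y z \<Longrightarrow> T x z y" "T x y z \<Longrightarrow> T y x z" "T x y z \<Longrightarrow> T z x y"
    "T x y z \<Longrightarrow> T y z x" "T x y z \<Longrightarrow> T z y x"
  by (simp_all add: insert_commute)

lemma T_E: "T x y z \<Longrightarrow> E x y" "T x y z \<Longrightarrow> E x z" "T x y z \<Longrightarrow> E y z"
  by (erule face; blast)+

lemma E_sym: "E x y \<Longrightarrow> E y x"
  by (simp add: insert_commute)

end

text \<open>The vertices of the universal cover of the component of \<open>r\<close> are represented by certain walks
  starting at \<open>r\<close>. The covering map is \<^const>\<open>last\<close>, the distance from the base point \<open>[r]\<close> is the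
  length of the walk minus 1, and \<open>A\<close> is adjacency or equality.\<close>

locale cover_graph = locally_six_large K for K :: "'v set set" +
  fixes r :: 'v and V :: "'v list set" and A :: "'v list \<Rightarrow> 'v list \<Rightarrow> bool"
  assumes V_ne: "y \<in> V \<Longrightarrow> y \<noteq> []"
    and root: "[r] \<in> V" "\<lbrakk>y \<in> V; length y = 1\<rbrakk> \<Longrightarrow> y = [r]"
    and A_V: "A x y \<Longrightarrow> x \<in> V" "A x y \<Longrightarrow> y \<in> V"
    and A_E: "A x y \<Longrightarrow> E (last x) (last y)"
    and A_len: "A x y \<Longrightarrow> length y \<le> Suc (length x)"
    and A_sym: "A x y \<Longrightarrow> A y x"
    and A_refl: "x \<in> V \<Longrightarrow> A x x"
    and A_inj: "\<lbrakk>A x y; last x = last y\<rbrakk> \<Longrightarrow> x = y"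
    and down_clique: "\<lbrakk>A p y; A q y; length y = Suc (length p); length y = Suc (length q)\<rbrakk> \<Longrightarrow>
      A p q \<and> T (last p) (last q) (last y)"
    and down_edge: "\<lbrakk>A x y; length x = length y; length y > 1\<rbrakk> \<Longrightarrow>
      \<exists>p. A p x \<and> A p y \<and> length y = Suc (length p) \<and> T (last p) (last x) (last y)"

text \<open>The induction invariant for the ball of radius \<open>n\<close>. Boundary vertices have
  length \<open>Suc n\<close>; lifting and fullness are required only for vertices inside the
  boundary.\<close>

locale cover_ball = cover_graph K r V A for K :: "'v set set" and r :: 'v and n :: nat
    and V :: "'v list set" and A :: "'v list \<Rightarrow> 'v list \<Rightarrow> bool" +
  assumes V_len: "y \<in> V \<Longrightarrow> length y \<le> Suc n"
    and lift: "\<lbrakk>y \<in> V; length y \<le> n; E (last y) z\<rbrakk> \<Longrightarrow> \<exists>x. A y x \<and> last x = z"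
    and full: "\<lbrakk>length y \<le> n; A y x; A y x'; T (last y) (last x) (last x')\<rbrakk> \<Longrightarrow> A x x'"
begin

text \<open>The interior vertex \<open>p\<close> has a neighbour \<open>x'\<close> over
  \<open>last x\<close>, and the point is that \<open>x' = x\<close>. A common lower neighbour
  \<open>q\<close> of \<open>x\<close> and \<open>y\<close> is adjacent to \<open>p\<close>;
  flagness of the link of \<open>last y\<close> fills the triangle over \<open>p\<close>,
  \<open>q\<close>, \<open>x\<close>, so fullness at \<open>q\<close> makes \<open>x\<close> and
  \<open>x'\<close> adjacent.\<close>

lemma full_lower:
  assumes len: "length y = Suc n" and A: "A y p" "A y x" "length y = Suc (length p)"
    and T: "T (last y) (last p) (last x)"
  shows "A p x"
proof (cases "length x = Suc n")
  case False
  have "length x = n"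
    using A_len[OF A_sym[OF A(2)]] V_len[OF A_V(2)[OF A(2)]] False len by simp
  then show ?thesis
    using down_clique[of p y x] A len A_sym by auto
next
  case True
  have lp: "length p = n" using A len by simp
  then have n: "length y > 1" using V_ne[OF A_V(2)[OF A(1)]] len by auto
  obtain x' where x': "A p x'" "last x' = last x"
    using lift[of p "last x"] T_E[OF T] A_V(2)[OF A(1)] lp by auto
  have yx': "A y x'"
    using full[of p y x'] x' T_perm(2)[OF T] A_sym[OF A(1)] lp by simp
  obtain q where q: "A q y" "A q x" "length x = Suc (length q)" "T (last q) (last y) (last x)"
    using down_edge[OF A(2)] len True n by auto
  have pq: "A p q" "T (last p) (last q) (last y)"
    using down_clique[of p y q] A q True len A_sym by auto
  have "T (last p) (last q) (last x)"
    using link_flag[of "last y" "last p" "last q" "last x"] pq q T T_perm by blast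
  then have "A q x'"
    using full[of p q x'] x' pq lp by simp
  then have "A x x'"
    using full[of q x x'] q True x' T_E[OF q(4)] by (simp add: insert_commute)
  then show ?thesis
    using A_inj[of x x'] x' by simp
qed

text \<open>If \<open>x\<close> and \<open>x'\<close> both lie on the boundary, the common lower
  neighbours \<open>p\<close> of \<open>x\<close>, \<open>y\<close> and \<open>p'\<close> of
  \<open>x'\<close>, \<open>y\<close> give the square \<open>x p p' x'\<close> in the link of
  \<open>last y\<close>. A diagonal of it makes \<open>p\<close> or \<open>p'\<close> a common lower
  neighbour of all three, where fullness is known.\<close>

lemma full_top:
  assumes len: "length y = Suc n" and A: "A y x" "A y x'"
    and T: "T (last y) (last x) (last x')"
  shows "A x x'"
proof (cases "n = 0")
  case True
  then have "x = [r]" "x' = [r]"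
    using A V_len[OF A_V(2)] V_ne[OF A_V(2)] root(2)[OF A_V(2)]
    by (metis One_nat_def le_antisym length_0_conv less_one not_less)+
  then show ?thesis using A_refl[OF root(1)] by simp
next
  case False
  have l: "length x = n \<or> length x = Suc n" "length x' = n \<or> length x' = Suc n"
    using A_len[OF A_sym[OF A(1)]] V_len[OF A_V(2)[OF A(1)]]
      A_len[OF A_sym[OF A(2)]] V_len[OF A_V(2)[OF A(2)]] len by auto
  show ?thesis
  proof (cases "length x = Suc n \<and> length x' = Suc n")
    case False
    then show ?thesis
      using full_lower[OF len A(1,2) _ T] A_sym[OF full_lower[OF len A(2,1) _ T_perm(1)[OF T]]] l len by auto
  next
    case True
    obtain p where p: "A p y" "A p x" "length x = Suc (length p)" "T (last p) (last y) (last x)"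
      using down_edge[OF A(1)] len True \<open>n \<noteq> 0\<close> by auto
    obtain p' where p': "A p' y" "A p' x'" "length x' = Suc (length p')" "T (last p') (last y) (last x')"
      using down_edge[OF A(2)] len True \<open>n \<noteq> 0\<close> by auto
    have pp: "T (last p) (last p') (last y)"
      using down_clique[OF p(1) p'(1)] p p' True len by simp
    have *: "A x x'" if p: "A p y" "A p x" "length x = Suc (length p)" "T (last p) (last y) (last x)"
      and A: "A y x" "A y x'" and T: "T (last y) (last x) (last x')" and px: "T (last y) (last p) (last x')"
      and True: "length x = Suc n \<and> length x' = Suc n" for p x x'
    proof -
      have "A p x'"
        using full_lower[OF len _ A(2) _ px] p True len A_sym by simp
      moreover have "T (last p) (last x) (last x')"
        using link_flag[of "last y" "last p" "last x" "last x'"] p px T T_perm by blast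
      ultimately show ?thesis
        using full[of p x x'] p True by simp
    qed
    have "T (last y) (last p) (last x') \<or> T (last y) (last p') (last x)"
      using link_square[of "last y" "last x" "last p" "last p'" "last x'"] p p' pp T T_perm by blast
    then show ?thesis
      using *[OF p A T _ True] A_sym[OF *[OF p' A(2,1) T_perm(1)[OF T]]] True by blast
  qed
qed

lemma full_all:
  assumes "A y x" "A y x'" "T (last y) (last x) (last x')"
  shows "A x x'"
  using full[OF _ assms] full_top[OF _ assms] V_len[OF A_V(1)[OF assms(1)]] by linarith

text \<open>A pair \<open>(y, z)\<close> with \<open>cand y z\<close> stands for a missing neighbour above \<open>z\<close> of the boundary
  vertex \<open>y\<close>; the pairs related by \<open>same\<close> share their missing neighbour.\<close>

definition cand :: "'v list \<Rightarrow> 'v \<Rightarrow> bool" where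
  "cand y z \<longleftrightarrow> y \<in> V \<and> length y = Suc n \<and> E (last y) z \<and> (\<forall>x. A y x \<longrightarrow> last x \<noteq> z)"

definition same :: "'v \<Rightarrow> 'v list \<Rightarrow> 'v list \<Rightarrow> bool" where
  "same z y y' \<longleftrightarrow> cand y z \<and> cand y' z \<and> A y y' \<and> T (last y) (last y') z"

lemma same_refl: "cand y z \<Longrightarrow> same z y y"
  unfolding same_def cand_def using A_refl by simp

lemma same_sym: "same z y y' \<Longrightarrow> same z y' y"
  unfolding same_def using A_sym T_perm by blast

text \<open>Otherwise the neighbour could be lifted from the interior vertex \<open>p\<close>, and
  fullness at \<open>p\<close> would make it a neighbour of \<open>y\<close>.\<close>

lemma cand_lower:
  assumes "cand y z" "A p y" "length y = Suc (length p)"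
  shows "\<not> T (last y) (last p) z"
proof
  assume T: "T (last y) (last p) z"
  then obtain x where x: "A p x" "last x = z"
    using lift[of p z] assms(1,3) A_V(1)[OF assms(2)] T_E(3)[OF T] unfolding cand_def by auto
  then have "A y x"
    using full[of p y x] assms T_perm(2)[OF T] unfolding cand_def by simp
  then show False using assms x unfolding cand_def by blast
qed

lemma cand_neighbour:
  assumes "cand y z" "A y y'" "T (last y) (last y') z"
  shows "same z y y'"
proof -
  have y: "y \<in> V" "length y = Suc n" "y' \<in> V"
    using assms A_V unfolding cand_def by auto
  have "length y' \<noteq> n"
    using cand_lower[OF assms(1) A_sym[OF assms(2)]] assms(3) y(2) by metis
  then have "length y' = Suc n"
    using A_len[OF A_sym[OF assms(2)]] V_len[OF y(3)] y by simp
  moreover have "last x \<noteq> z" if "A y' x" for x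
  proof
    assume "last x = z"
    then have "A y x" using full_all[of y' y x] that assms A_sym T_perm by blast
    then show False using assms \<open>last x = z\<close> unfolding cand_def by blast
  qed
  ultimately show ?thesis
    using assms y T_E unfolding same_def cand_def by blast
qed

text \<open>The one place in the construction that needs pentagons. With lower neighbours
  \<open>p\<close> and \<open>q\<close>, the link of \<open>last y2\<close> contains the pentagon
  \<open>z y1 p q y3\<close>. Diagonals from \<open>z\<close> to \<open>p\<close> or
  \<open>q\<close> are excluded by \<open>cand_lower\<close>, and any other diagonal leads, through
  a square if necessary, to \<open>y1 y3\<close>.\<close>

lemma same_trans:
  assumes "same z y1 y2" "same z y2 y3"
  shows "same z y1 y3"
proof -
  have c: "cand y1 z" "cand y2 z" "cand y3 z" and A: "A y1 y2" "A y2 y3"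
    and T: "T (last y1) (last y2) z" "T (last y2) (last y3) z"
    using assms unfolding same_def by auto
  then have len: "length y1 = Suc n" "length y2 = Suc n" "length y3 = Suc n"
    and V: "y1 \<in> V" "y2 \<in> V" "y3 \<in> V" unfolding cand_def by auto
  show ?thesis
  proof (cases "n = 0")
    case True
    then have "y1 = y3" using root(2)[of y1] root(2)[of y3] len V by simp
    then show ?thesis using c same_refl by simp
  next
    case False
    obtain p where p: "A p y1" "A p y2" "length y2 = Suc (length p)" "T (last p) (last y1) (last y2)"
      using down_edge[OF A(1)] len False by auto
    obtain q where q: "A q y2" "A q y3" "length y3 = Suc (length q)" "T (last q) (last y2) (last y3)"
      using down_edge[OF A(2)] len False by auto
    have pq: "T (last p) (last q) (last y2)"
      using down_clique[OF p(2) q(1)] p q len by simp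
    have n: "\<not> T (last y2) (last p) z" "\<not> T (last y2) (last q) z"
      using cand_lower[OF c(2)] p q len by auto
    have "T (last y2) (last y1) (last y3) \<or> T (last y2) (last y1) (last q) \<or> T (last y2) (last p) (last y3)"
      using link_pentagon[of "last y2" z "last y1" "last p" "last q" "last y3"] p q pq T n T_perm by blast
    moreover have "T (last y2) (last y1) (last y3)" if "T (last y2) (last y1) (last q)"
      using link_square[of "last y2" z "last y1" "last q" "last y3"] that q T n T_perm by blast
    moreover have "T (last y2) (last y1) (last y3)" if "T (last y2) (last p) (last y3)"
      using link_square[of "last y2" z "last y1" "last p" "last y3"] that p T n T_perm by blast
    ultimately have T3: "T (last y2) (last y1) (last y3)" by blast
    then have "A y1 y3" using full_all[of y2 y1 y3] A A_sym by blast
    moreover have "T (last y1) (last y3) z"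
      using link_flag[of "last y2" "last y1" "last y3" z] T3 T T_perm by blast
    ultimately show ?thesis using c unfolding same_def by blast
  qed
qed

text \<open>A canonical name for a class of \<open>same z\<close>: related vertices have equal
  predicates, so the choice operator picks the same representative. Appending \<open>z\<close> gives
  the right endpoint and the right length.\<close>

definition new :: "'v list \<Rightarrow> 'v \<Rightarrow> 'v list" where
  "new y z = (SOME y'. same z y y') @ [z]"

lemma new_eq_iff:
  assumes "cand y z" "cand y' z'"
  shows "new y z = new y' z' \<longleftrightarrow> z = z' \<and> same z y y'"
proof
  assume eq: "new y z = new y' z'"
  then have z: "z = z'" and s: "(SOME x. same z y x) = (SOME x. same z y' x)"
    unfolding new_def by auto
  have "same z y (SOME x. same z y x)" "same z y' (SOME x. same z y' x)"
    using someI[of "same z y", OF same_refl] someI[of "same z y'", OF same_refl] assms z by simp_all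
  then show "z = z' \<and> same z y y'"
    using s z same_sym same_trans by metis
next
  assume "z = z' \<and> same z y y'"
  then have "same z y = same z y'" "z = z'"
    using same_sym same_trans by blast+
  then show "new y z = new y' z'" unfolding new_def by simp
qed

lemma last_new [simp]: "last (new y z) = z"
  by (simp add: new_def)

lemma length_new:
  assumes "cand y z"
  shows "length (new y z) = Suc (Suc n)"
proof -
  have "same z y (SOME x. same z y x)"
    using someI[of "same z y", OF same_refl] assms by simp
  then have "length (SOME x. same z y x) = Suc n" unfolding same_def cand_def by blast
  then show ?thesis unfolding new_def by simp
qed

definition below :: "'v list \<Rightarrow> 'v list \<Rightarrow> bool" where
  "below y x \<longleftrightarrow> (\<exists>z. cand y z \<and> x = new y z)"

lemma belowD:
  assumes "below y x"
  shows "cand y (last x)" "x = new y (last x)" "length x = Suc (Suc n)" "y \<in> V" "length y = Suc n"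
    "E (last y) (last x)" "x \<notin> V"
proof -
  obtain z where z: "cand y z" "x = new y z" using assms unfolding below_def by blast
  then show "cand y (last x)" "x = new y (last x)" "length x = Suc (Suc n)" "y \<in> V" "length y = Suc n"
    "E (last y) (last x)"
    using length_new unfolding cand_def by auto
  then show "x \<notin> V" using V_len by fastforce
qed

lemma below_same: "below y x \<Longrightarrow> below y' x \<Longrightarrow> same (last x) y y'"
  using belowD[of y x] belowD[of y' x] new_eq_iff by metis

definition V' :: "'v list set" where "V' = V \<union> {x. \<exists>y. below y x}"

text \<open>Horizontal edges of the new sphere, loops included. Requiring a filled triangle over the
  old boundary is what provides \<open>down_edge\<close>.\<close>

definition H' :: "'v list \<Rightarrow> 'v list \<Rightarrow> bool" where
  "H' x x' \<longleftrightarrow> (\<exists>y. below y x \<and> below y x' \<and> T (last y) (last x) (last x'))"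

definition A' :: "'v list \<Rightarrow> 'v list \<Rightarrow> bool" where
  "A' x x' \<longleftrightarrow> A x x' \<or> below x x' \<or> below x' x \<or> H' x x'"

lemma A'_cases [consumes 1, case_names old up down top]:
  assumes "A' x y"
  obtains "A x y" "x \<in> V" "y \<in> V" "length x \<le> Suc n" "length y \<le> Suc n"
    | "below x y" "x \<in> V" "length x = Suc n" "length y = Suc (Suc n)"
    | "below y x" "y \<in> V" "length y = Suc n" "length x = Suc (Suc n)"
    | "H' x y" "length x = Suc (Suc n)" "length y = Suc (Suc n)"
proof -
  consider "A x y" | "below x y" | "below y x" | "H' x y"
    using assms unfolding A'_def by blast
  then show thesis
  proof cases
    case 1
    then show thesis using that(1) V_len A_V by blast
  next
    case 2
    then show thesis using that(2) belowD by blast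
  next
    case 3
    then show thesis using that(3) belowD by blast
  next
    case 4
    then show thesis using that(4) belowD(3) unfolding H'_def by blast
  qed
qed

lemma V'_cases [consumes 1, case_names old new]:
  assumes "x \<in> V'"
  obtains "x \<in> V" "length x \<le> Suc n" | y where "below y x" "length x = Suc (Suc n)"
  using assms V_len belowD(3) unfolding V'_def by blast

lemma cover_ball_Suc: "cover_ball K r (Suc n) V' A'"
proof unfold_locales
  show "y \<noteq> []" "length y \<le> Suc (Suc n)" if "y \<in> V'" for y
    using that V_ne by (cases rule: V'_cases; fastforce)+
  show "[r] \<in> V'" unfolding V'_def using root(1) by blast
  show "y = [r]" if "y \<in> V'" "length y = 1" for y
    using that(1)
  proof (cases rule: V'_cases)
    case old
    then show ?thesis using root(2) that(2) by blast
  qed (use that in simp)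
  show "A' x y \<Longrightarrow> x \<in> V'" "A' x y \<Longrightarrow> y \<in> V'" for x y
    unfolding A'_def V'_def H'_def using A_V belowD(4) by blast+
  show "E (last x) (last y)" if "A' x y" for x y
    using that
  proof (cases rule: A'_cases)
    case top
    then show ?thesis using T_E(3) unfolding H'_def by blast
  qed (use A_E belowD(6) E_sym in blast)+
  show "length y \<le> Suc (length x)" if "A' x y" for x y
    using that by (cases rule: A'_cases) (use A_len in auto)
  show "A' x y \<Longrightarrow> A' y x" for x y
    unfolding A'_def H'_def using A_sym T_perm by blast
  show "A' x x" if "x \<in> V'" for x
    using that
  proof (cases rule: V'_cases)
    case old
    then show ?thesis using A_refl unfolding A'_def by blast
  next
    case (new y)
    then show ?thesis using belowD(6)[OF new(1)] unfolding A'_def H'_def by auto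
  qed
  show "x = y" if xy: "A' x y" "last x = last y" for x y
  proof -
    have "\<not> below x y" if "last x = last y" for x y :: "'v list"
      using belowD(1,4)[of x y] A_refl that unfolding cand_def by metis
    moreover have "x = y" if "H' x y"
      using that belowD(2) xy(2) unfolding H'_def by metis
    ultimately show "x = y"
      using xy A_inj unfolding A'_def by metis
  qed
  show "A' p q \<and> T (last p) (last q) (last y)"
    if "A' p y" "A' q y" "length y = Suc (length p)" "length y = Suc (length q)" for p y q
  proof (cases "length y = Suc (Suc n)")
    case True
    have "below p y" if "A' p y" "length y = Suc (length p)" for p
      using that(1) by (cases rule: A'_cases) (use that True in auto)
    then have "below p y" "below q y" using that by blast+
    then show ?thesis
      using below_same[of p y q] unfolding same_def A'_def by blast
  next
    case False
    have "A p y" if "A' p y" "length y = Suc (length p)" for p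
      using that(1) by (cases rule: A'_cases) (use that False in auto)
    then have "A p y" "A q y" using that by blast+
    then show ?thesis
      using down_clique that unfolding A'_def by blast
  qed
  show "\<exists>p. A' p x \<and> A' p y \<and> length y = Suc (length p) \<and> T (last p) (last x) (last y)"
    if "A' x y" "length x = length y" "length y > 1" for x y
  proof (cases "A x y")
    case True
    then show ?thesis using down_edge that unfolding A'_def by blast
  next
    case False
    have "H' x y"
      using that(1) by (cases rule: A'_cases) (use that False in auto)
    then show ?thesis using belowD(3,5) unfolding H'_def A'_def by metis
  qed
  show "\<exists>x. A' y x \<and> last x = z" if y: "y \<in> V'" "length y \<le> Suc n" "E (last y) z" for y z
  proof -
    have yV: "y \<in> V" using y(1) by (cases rule: V'_cases) (use y(2) in auto)
    show ?thesis
    proof (cases "length y = Suc n")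
      case True
      then show ?thesis
        using yV y unfolding A'_def below_def cand_def by (metis last_new)
    next
      case False
      then show ?thesis using lift[OF yV, of z] y unfolding A'_def by auto
    qed
  qed
  show "A' x x'" if A: "length y \<le> Suc n" "A' y x" "A' y x'" "T (last y) (last x) (last x')" for y x x'
  proof -
    have *: "A y x \<or> below y x" if "A' y x" for x
      using that by (cases rule: A'_cases) (use A(1) in auto)
    \<comment> \<open>If \<open>y\<close> lacks the neighbour \<open>x'\<close>, then so does its
      neighbour \<open>x\<close>, by \<open>cand_neighbour\<close>; both pairs therefore name the
      same new vertex.\<close>
    have **: "below x x'" if "A y x" "below y x'" "T (last y) (last x) (last x')" for x x'
    proof -
      have "same (last x') y x"
        using cand_neighbour[of y "last x'" x] belowD(1)[OF that(2)] that by blast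
      then show ?thesis
        using belowD(1,2)[OF that(2)] new_eq_iff unfolding below_def same_def by metis
    qed
    show ?thesis
      using *[OF A(2)] *[OF A(3)] **[of x x'] **[of x' x] full_all[of y x x'] A(4) T_perm
      unfolding A'_def H'_def by blast
  qed
qed

end

locale universal_cover = cover_graph +
  assumes lift: "\<lbrakk>y \<in> V; E (last y) z\<rbrakk> \<Longrightarrow> \<exists>x. A y x \<and> last x = z"
    and full: "\<lbrakk>A y x; A y x'; T (last y) (last x) (last x')\<rbrakk> \<Longrightarrow> A x x'"

section \<open>Union of the balls\<close>

context locally_six_large begin

lemma cover_ball_0:
  assumes "{r} \<in> K"
  shows "cover_ball K r 0 {[r]} (\<lambda>x y. x = [r] \<and> y = [r])"
  using assms by unfold_locales auto

text \<open>Balls are chosen one inside the next and united. Each axiom concerns finitely many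
  vertices and edges, hence can be checked in one sufficiently large ball.\<close>

lemma universal_cover_exists:
  assumes "{r} \<in> K"
  shows "\<exists>V A. universal_cover K r V A"
proof -
  define P where "P n B \<longleftrightarrow> cover_ball K r n (fst B) (snd B)" for n B
  define Q where "Q B B' \<longleftrightarrow> fst B \<subseteq> fst B' \<and> (\<forall>x y. snd B x y \<longrightarrow> snd B' x y)"
    for B B' :: "'v list set \<times> ('v list \<Rightarrow> 'v list \<Rightarrow> bool)"
  have "\<exists>B'. P (Suc n) B' \<and> Q B B'" if "P n B" for n B
  proof -
    interpret cover_ball K r n "fst B" "snd B" using that unfolding P_def .
    have "Q B (V', A')"
      unfolding Q_def V'_def A'_def by auto
    then show ?thesis
      using cover_ball_Suc unfolding P_def by (intro exI[of _ "(V', A')"]) simp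
  qed
  moreover have "\<exists>B. P 0 B"
    using cover_ball_0[OF assms] unfolding P_def by (intro exI[of _ "({[r]}, \<lambda>x y. x = [r] \<and> y = [r])"]) simp
  ultimately obtain B where B: "\<And>n. P n (B n)" and Q: "\<And>n. Q (B n) (B (Suc n))"
    using dependent_nat_choice[of P "\<lambda>n. Q"] by blast
  have mono: "Q (B m) (B n)" if "m \<le> n" for m n
    using that
  proof (induction n rule: dec_induct)
    case base
    then show ?case unfolding Q_def by blast
  next
    case (step n)
    then show ?case using Q[of n] unfolding Q_def by blast
  qed
  define V where "V = (\<Union>n. fst (B n))"
  define A where "A x y \<longleftrightarrow> (\<exists>n. snd (B n) x y)" for x y
  have ball: "cover_ball K r n (fst (B n)) (snd (B n))" for n
    using B unfolding P_def .
  \<comment> \<open>The bound \<open>k\<close> will be the length of a vertex: a ball provides lifts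
    and fullness only below its boundary.\<close>
  have Vn: "\<exists>n\<ge>k. y \<in> fst (B n)" if y: "y \<in> V" for y k
  proof -
    obtain m where "y \<in> fst (B m)" using y unfolding V_def by blast
    moreover have "Q (B m) (B (max k m))" by (intro mono) simp
    ultimately have "y \<in> fst (B (max k m))" unfolding Q_def by blast
    then show ?thesis using max.cobounded1 by blast
  qed
  have An: "\<exists>n\<ge>k. snd (B n) x y \<and> snd (B n) x' y'" if xy: "A x y" "A x' y'" for x y x' y' k
  proof -
    obtain m m' where m: "snd (B m) x y" "snd (B m') x' y'" using xy unfolding A_def by blast
    define N where "N = max k (max m m')"
    have "Q (B m) (B N)" "Q (B m') (B N)"
      unfolding N_def by (intro mono; simp)+
    then have "snd (B N) x y" "snd (B N) x' y'" using m unfolding Q_def by blast+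
    moreover have "k \<le> N" unfolding N_def by simp
    ultimately show ?thesis by blast
  qed
  have AI: "A x y" if "snd (B n) x y" for n x y using that unfolding A_def by blast
  have VI: "y \<in> V" if "y \<in> fst (B n)" for n y using that unfolding V_def by blast
  have "universal_cover K r V A"
  proof unfold_locales
    note graph = ball[THEN cover_ball.axioms(1)]
    show "[r] \<in> V" using cover_graph.root(1)[OF graph] VI by blast
    {
      fix y assume "y \<in> V"
      then obtain n where n: "y \<in> fst (B n)" using Vn by blast
      show "y \<noteq> []" using cover_graph.V_ne[OF graph n] .
      show "y = [r]" if "length y = 1" using cover_graph.root(2)[OF graph n that] .
      show "A y y" using AI[OF cover_graph.A_refl[OF graph n]] .
    }
    {
      fix x y assume "A x y"
      then obtain n where n: "snd (B n) x y" unfolding A_def by blast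
      show "x \<in> V" "y \<in> V" using VI[OF cover_graph.A_V(1)[OF graph n]] VI[OF cover_graph.A_V(2)[OF graph n]] .
      show "E (last x) (last y)" using cover_graph.A_E[OF graph n] .
      show "length y \<le> Suc (length x)" using cover_graph.A_len[OF graph n] .
      show "A y x" using AI[OF cover_graph.A_sym[OF graph n]] .
      show "x = y" if "last x = last y" using cover_graph.A_inj[OF graph n that] .
      show "\<exists>p. A p x \<and> A p y \<and> length y = Suc (length p) \<and> T (last p) (last x) (last y)"
        if "length x = length y" "length y > 1"
        using cover_graph.down_edge[OF graph n that] AI by blast
    }
    show "A p q \<and> T (last p) (last q) (last y)"
      if *: "A p y" "A q y" "length y = Suc (length p)" "length y = Suc (length q)" for p y q
    proof -
      obtain n where n: "snd (B n) p y" "snd (B n) q y" using An[OF *(1,2)] by blast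
      show ?thesis using cover_graph.down_clique[OF graph n *(3,4)] AI by blast
    qed
    show "\<exists>x. A y x \<and> last x = z" if *: "y \<in> V" "E (last y) z" for y z
    proof -
      obtain n where n: "length y \<le> n" "y \<in> fst (B n)" using Vn[OF *(1)] by blast
      show ?thesis using cover_ball.lift[OF ball n(2,1) *(2)] AI by blast
    qed
    show "A x x'" if *: "A y x" "A y x'" "T (last y) (last x) (last x')" for y x x'
    proof -
      obtain n where n: "length y \<le> n" "snd (B n) y x" "snd (B n) y x'" using An[OF *(1,2)] by blast
      show ?thesis using cover_ball.full[OF ball n *(3)] AI by blast
    qed
  qed
  then show ?thesis by blast
qed

end

text \<open>If the universal cover is the component of \<open>r\<close> itself, distances from \<open>r\<close> are lengths of walks
  in \<open>V\<close>.\<close>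

locale trivial_cover = universal_cover +
  assumes closed: "\<lbrakk>A\<^sup>*\<^sup>* x y; last x = last y\<rbrakk> \<Longrightarrow> x = y"
begin

lemma A_root: "y \<in> V \<Longrightarrow> A\<^sup>*\<^sup>* [r] y"
proof (induction "length y" arbitrary: y rule: less_induct)
  case less
  show ?case
  proof (cases "length y > 1")
    case True
    \<comment> \<open>Applied to the loop at \<open>y\<close>, \<open>down_edge\<close> yields a
      lower neighbour.\<close>
    then obtain p where "A p y" "length y = Suc (length p)"
      using down_edge[OF A_refl[OF less(2)]] by blast
    then show ?thesis using less(1)[of p] A_V(1) by fastforce
  next
    case False
    then show ?thesis using root(2)[OF less(2)] V_ne[OF less(2)] by (cases y) auto
  qed
qed

lemma last_inj:
  assumes "x \<in> V" "y \<in> V" "last x = last y"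
  shows "x = y"
proof -
  have "symp A" using A_sym by (auto intro: sympI)
  then have "A\<^sup>*\<^sup>* x [r]" using A_root[OF assms(1)] by (metis sympD symp_rtranclp)
  then show ?thesis using A_root[OF assms(2)] assms(3) closed by (meson rtranclp_trans)
qed

lemma A_iff:
  assumes "x \<in> V" "y \<in> V"
  shows "A x y \<longleftrightarrow> E (last x) (last y)"
  using assms A_E lift[OF assms(1), of "last y"] last_inj A_V(2) by metis

definition R :: "'a \<Rightarrow> 'a \<Rightarrow> bool" where "R x y \<longleftrightarrow> x = y \<or> E x y"

lemma R_lift:
  assumes "x \<in> V" "R (last x) z"
  shows "\<exists>y. A x y \<and> last y = z"
  using assms A_refl lift unfolding R_def by metis

lemma ball_iff: "(R ^^ k) r x \<longleftrightarrow> (\<exists>y\<in>V. last y = x \<and> length y \<le> Suc k)"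
proof (induction k arbitrary: x)
  case 0
  show ?case
  proof
    assume "(R ^^ 0) r x"
    then show "\<exists>y\<in>V. last y = x \<and> length y \<le> Suc 0"
      using root(1) by (intro bexI[of _ "[r]"]) auto
  next
    assume "\<exists>y\<in>V. last y = x \<and> length y \<le> Suc 0"
    then obtain y where y: "y \<in> V" "last y = x" "length y \<le> Suc 0" by blast
    then have "length y = 1" using V_ne[OF y(1)] by (cases y) auto
    then show "(R ^^ 0) r x" using root(2)[OF y(1)] y(2) by simp
  qed
next
  case (Suc k)
  show ?case
  proof
    assume "(R ^^ Suc k) r x"
    then obtain z where "(R ^^ k) r z" "R z x" by (rule relpowp_Suc_E)
    then obtain y where y: "y \<in> V" "last y = z" "length y \<le> Suc k" "R z x"
      using Suc.IH by blast
    then obtain y' where "A y y'" "last y' = x" using R_lift by blast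
    then have "y' \<in> V" "last y' = x" "length y' \<le> Suc (Suc k)"
      using A_V(2)[of y y'] A_len[of y y'] y(3) by auto
    then show "\<exists>y\<in>V. last y = x \<and> length y \<le> Suc (Suc k)" by blast
  next
    assume "\<exists>y\<in>V. last y = x \<and> length y \<le> Suc (Suc k)"
    then obtain y where y: "y \<in> V" "last y = x" "length y \<le> Suc (Suc k)" by blast
    show "(R ^^ Suc k) r x"
    proof (cases "length y \<le> Suc k")
      case True
      then have "(R ^^ k) r x" using Suc.IH y by blast
      then show ?thesis using relpowp_Suc_I[of k R r x x] unfolding R_def by simp
    next
      case False
      then obtain p where p: "A p y" "length y = Suc (length p)"
        using down_edge[OF A_refl[OF y(1)]] by auto
      have "(R ^^ k) r (last p)"
        unfolding Suc.IH using A_V(1)[OF p(1)] p(2) y(3) by (intro bexI[of _ p]) auto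
      moreover have "R (last p) x"
        using A_E[OF p(1)] y(2) unfolding R_def by blast
      ultimately show ?thesis by (rule relpowp_Suc_I)
    qed
  qed
qed

lemma triangle_condition:
  assumes "(R ^^ Suc k) r x" "(R ^^ Suc k) r y" "R x y"
  shows "\<exists>z. (R ^^ k) r z \<and> R z x \<and> R z y"
proof -
  obtain x' y' where x': "x' \<in> V" "last x' = x" "length x' \<le> Suc (Suc k)"
    and y': "y' \<in> V" "last y' = y" "length y' \<le> Suc (Suc k)"
    using assms unfolding ball_iff by blast
  have A: "A x' y'" using R_lift[of x' y] last_inj[of _ y'] x' y' A_V(2) assms(3) by metis
  consider "length x' \<le> Suc k" | "length y' \<le> Suc k" | "length x' = Suc (Suc k)" "length y' = Suc (Suc k)"
    using x' y' by linarith
  then show ?thesis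
  proof cases
    case 1
    then show ?thesis using x' assms(3) unfolding ball_iff R_def by blast
  next
    case 2
    then show ?thesis using y' assms(3) unfolding ball_iff R_def by (metis E_sym)
  next
    case 3
    then obtain p where p: "A p x'" "A p y'" "length y' = Suc (length p)"
      using down_edge[OF A] by auto
    have "(R ^^ k) r (last p)"
      unfolding ball_iff using A_V(1)[OF p(1)] p(3) 3 by (intro bexI[of _ p]) auto
    moreover have "R (last p) x" "R (last p) y"
      using A_E[OF p(1)] A_E[OF p(2)] x'(2) y'(2) unfolding R_def by blast+
    ultimately show ?thesis by blast
  qed
qed

text \<open>If \<open>x\<close> lies outside the ball, then the lifts of \<open>y\<close> and
  \<open>z\<close> are lower neighbours of its lift, and lower neighbours form a clique.\<close>

lemma ball_convex:
  assumes "(R ^^ k) r y" "(R ^^ k) r z" "R x y" "R x z"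
  shows "(R ^^ k) r x \<or> R y z"
proof -
  obtain y' z' where y': "y' \<in> V" "last y' = y" "length y' \<le> Suc k"
    and z': "z' \<in> V" "last z' = z" "length z' \<le> Suc k"
    using assms unfolding ball_iff by blast
  have "R y x" "R z x" using assms(3,4) E_sym unfolding R_def by blast+
  then obtain x' where x': "A y' x'" "last x' = x" and x'': "A z' x'"
    using R_lift[of y' x] R_lift[of z' x] last_inj y' z' A_V(2) by metis
  show ?thesis
  proof (cases "length x' \<le> Suc k")
    case True
    then show ?thesis using x' A_V(2) unfolding ball_iff by blast
  next
    case False
    then have "A y' z'"
      using down_clique[OF x'(1) x''] A_len[OF x'(1)] A_len[OF x''] y' z' by auto
    then show ?thesis using A_E y' z' unfolding R_def by blast
  qed
qed

text \<open>The lifts of \<open>x\<close> and \<open>y\<close> are at distance 1 from the base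
  point, so the only vertex that \<open>down_edge\<close> can put below them is
  \<open>[r]\<close>.\<close>

lemma triangle_filled:
  assumes "E r x" "E r y" "E x y" "r \<noteq> x" "r \<noteq> y"
  shows "T r x y"
proof -
  obtain x' y' where x': "A [r] x'" "last x' = x" and y': "A [r] y'" "last y' = y"
    using lift[OF root(1)] assms by (metis last.simps)
  have A: "A x' y'" using A_iff x' y' A_V(2) assms(3) by metis
  have len: "length z = 2" if "A [r] z" "last z \<noteq> r" for z
  proof -
    have "length z \<le> 2" using A_len[OF that(1)] by simp
    moreover have "length z \<noteq> 0" "length z \<noteq> 1"
      using V_ne[OF A_V(2)[OF that(1)]] root(2)[OF A_V(2)[OF that(1)]] that(2) by auto
    ultimately show ?thesis by linarith
  qed
  have l: "length x' = 2" "length y' = 2" using len x' y' assms by auto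
  then obtain p where p: "A p x'" "A p y'" "length y' = Suc (length p)" "T (last p) (last x') (last y')"
    using down_edge[OF A] by auto
  then have "p = [r]" using root(2)[OF A_V(1)[OF p(1)]] l by simp
  then show ?thesis using p x' y' by simp
qed

end

section \<open>Systolic complexes are bridged\<close>

lemma flag_complexD:
  assumes "flag_complex K" "finite S" "S \<noteq> {}" "S \<subseteq> vertices K"
    and "\<forall>x\<in>S. \<forall>y\<in>S. x \<noteq> y \<longrightarrow> adjacent K x y"
  shows "S \<in> K"
  using assms unfolding flag_complex_def by simp

lemma adjacent_link_iff:
  assumes "simplicial_complex K"
  shows "adjacent (link K c) x y \<longleftrightarrow> x \<noteq> y \<and> c \<noteq> x \<and> c \<noteq> y \<and> {c, x, y} \<in> K"
  using simplicial_complex_face[OF assms, of "{c, x, y}" "{x, y}"] unfolding adjacent_def link_def by auto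

lemma adjacent_sym:
  assumes "adjacent K x y"
  shows "adjacent K y x"
proof -
  have "{y, x} = {x, y}" by blast
  then show ?thesis using assms unfolding adjacent_def by metis
qed

lemma has_diagonal_4:
  assumes "has_diagonal K [x, y, z, t]"
  shows "adjacent K x z \<or> adjacent K y t"
proof -
  have len: "length [x, y, z, t] = 4" by simp
  obtain i j where ij: "i < 4" "j < 4" "i \<noteq> j" "j \<noteq> Suc i mod 4" "i \<noteq> Suc j mod 4"
     "adjacent K ([x, y, z, t] ! i) ([x, y, z, t] ! j)"
    using assms unfolding has_diagonal_def len by blast
  have "i \<in> {0, 1, 2, 3}" "j \<in> {0, 1, 2, 3}" using ij(1,2) by auto
  then have "adjacent K x z \<or> adjacent K z x \<or> adjacent K y t \<or> adjacent K t y"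
    using ij(3-) by (elim insertE emptyE; hypsubst; simp)
  then show ?thesis using adjacent_sym by metis
qed

lemma is_cycle_4I:
  assumes "distinct [x, y, z, t]" "adjacent K x y" "adjacent K y z" "adjacent K z t" "adjacent K t x"
  shows "is_cycle K [x, y, z, t]"
proof -
  have "adjacent K ([x, y, z, t] ! i) ([x, y, z, t] ! (Suc i mod 4))" if "i < 4" for i
  proof -
    have "i \<in> {0, 1, 2, 3}" using that by auto
    then show ?thesis using assms(2-) by (elim insertE emptyE; hypsubst; simp)
  qed
  then show ?thesis using assms(1) unfolding is_cycle_def by simp
qed

lemma has_diagonal_5:
  assumes "has_diagonal K [x, y, z, t, s]"
  shows "adjacent K x z \<or> adjacent K x t \<or> adjacent K y t \<or> adjacent K y s \<or> adjacent K z s"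
proof -
  have len: "length [x, y, z, t, s] = 5" by simp
  obtain i j where ij: "i < 5" "j < 5" "i \<noteq> j" "j \<noteq> Suc i mod 5" "i \<noteq> Suc j mod 5"
     "adjacent K ([x, y, z, t, s] ! i) ([x, y, z, t, s] ! j)"
    using assms unfolding has_diagonal_def len by blast
  have "i \<in> {0, 1, 2, 3, 4}" "j \<in> {0, 1, 2, 3, 4}" using ij(1,2) by auto
  then have "adjacent K x z \<or> adjacent K x t \<or> adjacent K y t \<or> adjacent K y s \<or> adjacent K z s \<or>
    adjacent K z x \<or> adjacent K t x \<or> adjacent K t y \<or> adjacent K s y \<or> adjacent K s z"
    using ij(3-) by (elim insertE emptyE; hypsubst; simp)
  then show ?thesis using adjacent_sym by metis
qed

lemma is_cycle_5I:
  assumes "distinct [x, y, z, t, s]" "adjacent K x y" "adjacent K y z" "adjacent K z t" "adjacent K t s" "adjacent K s x"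
  shows "is_cycle K [x, y, z, t, s]"
proof -
  have "adjacent K ([x, y, z, t, s] ! i) ([x, y, z, t, s] ! (Suc i mod 5))" if "i < 5" for i
  proof -
    have "i \<in> {0, 1, 2, 3, 4}" using that by auto
    then show ?thesis using assms(2-) by (elim insertE emptyE; hypsubst; simp)
  qed
  then show ?thesis using assms(1) unfolding is_cycle_def by simp
qed

lemma systolic_locally_six_large:
  assumes sys: "systolic K"
  shows "locally_six_large K"
proof -
  have K: "simplicial_complex K" using sys unfolding systolic_def by blast
  note face = simplicial_complex_face[OF K]
  have large: "large 6 (link K c)" if "{c, x, y} \<in> K" for c x y
  proof -
    have "c \<in> vertices K" using that unfolding vertices_def by blast
    then show ?thesis using sys unfolding systolic_def by blast
  qed
  show ?thesis
  proof
    show "\<tau> \<in> K" if "\<sigma> \<in> K" "\<tau> \<subseteq> \<sigma>" "\<tau> \<noteq> {}" for \<sigma> \<tau> using face that .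
  next
    fix c x y z assume T: "{c, x, y} \<in> K" "{c, x, z} \<in> K" "{c, y, z} \<in> K"
    show "{x, y, z} \<in> K"
    proof (cases "distinct [c, x, y, z]")
      case False
      then show ?thesis
        using T face[OF T(1), of "{x, y, z}"] face[OF T(2), of "{x, y, z}"] face[OF T(3), of "{x, y, z}"]
        by auto
    next
      case True
      have "{x} \<in> link K c" "{y} \<in> link K c" "{z} \<in> link K c"
        using True face[OF T(1), of "{x}"] face[OF T(1), of "{y}"] face[OF T(2), of "{z}"]
          face[OF T(1), of "{c, x}"] face[OF T(1), of "{c, y}"] face[OF T(2), of "{c, z}"]
        unfolding link_def by auto
      then have "{x, y, z} \<subseteq> vertices (link K c)"
        unfolding vertices_def by auto
      moreover have "\<forall>a\<in>{x, y, z}. \<forall>b\<in>{x, y, z}. a \<noteq> b \<longrightarrow> adjacent (link K c) a b"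
      proof -
        have a: "adjacent (link K c) x y" "adjacent (link K c) x z" "adjacent (link K c) y z"
          using True T by (auto simp: adjacent_link_iff[OF K])
        show ?thesis using a a[THEN adjacent_sym] by simp
      qed
      moreover have "flag_complex (link K c)"
        using large[OF T(1)] unfolding large_def by (rule conjunct1)
      ultimately have "{x, y, z} \<in> link K c"
        by (intro flag_complexD) simp_all
      then show ?thesis unfolding link_def by blast
    qed
  next
    fix c x y z t assume T: "{c, x, y} \<in> K" "{c, y, z} \<in> K" "{c, z, t} \<in> K" "{c, t, x} \<in> K"
    show "{c, x, z} \<in> K \<or> {c, y, t} \<in> K"
    proof (cases "distinct [c, x, y, z, t]")
      case False
      then show ?thesis
        using face[OF T(1), of "{c, x, z}"] face[OF T(2), of "{c, x, z}"] face[OF T(3), of "{c, x, z}"] face[OF T(4), of "{c, x, z}"]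
          face[OF T(1), of "{c, y, t}"] face[OF T(2), of "{c, y, t}"] face[OF T(3), of "{c, y, t}"] face[OF T(4), of "{c, y, t}"]
        by auto
    next
      case True
      have "is_cycle (link K c) [x, y, z, t]"
        using True T by (intro is_cycle_4I) (auto simp: adjacent_link_iff[OF K])
      then have "has_diagonal (link K c) [x, y, z, t]"
        using large[OF T(1)] unfolding large_def by simp
      then show ?thesis
        using has_diagonal_4[of "link K c" x y z t] unfolding adjacent_link_iff[OF K] by fast
    qed
  next
    fix c x y z t s
    assume T: "{c, x, y} \<in> K" "{c, y, z} \<in> K" "{c, z, t} \<in> K" "{c, t, s} \<in> K" "{c, s, x} \<in> K"
    show "{c, x, z} \<in> K \<or> {c, x, t} \<in> K \<or> {c, y, t} \<in> K \<or> {c, y, s} \<in> K \<or> {c, z, s} \<in> K"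
    proof (cases "distinct [c, x, y, z, t, s]")
      case False
      then show ?thesis
        using face[OF T(1), of "{c, x, z}"] face[OF T(2), of "{c, x, z}"] face[OF T(3), of "{c, x, z}"] face[OF T(4), of "{c, x, z}"] face[OF T(5), of "{c, x, z}"]
          face[OF T(1), of "{c, x, t}"] face[OF T(2), of "{c, x, t}"] face[OF T(3), of "{c, x, t}"] face[OF T(4), of "{c, x, t}"] face[OF T(5), of "{c, x, t}"]
          face[OF T(1), of "{c, y, t}"] face[OF T(2), of "{c, y, t}"] face[OF T(3), of "{c, y, t}"] face[OF T(4), of "{c, y, t}"] face[OF T(5), of "{c, y, t}"]
          face[OF T(1), of "{c, y, s}"] face[OF T(2), of "{c, y, s}"] face[OF T(3), of "{c, y, s}"] face[OF T(4), of "{c, y, s}"] face[OF T(5), of "{c, y, s}"]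
          face[OF T(1), of "{c, z, s}"] face[OF T(2), of "{c, z, s}"] face[OF T(3), of "{c, z, s}"] face[OF T(4), of "{c, z, s}"] face[OF T(5), of "{c, z, s}"]
        by auto
    next
      case True
      have "is_cycle (link K c) [x, y, z, t, s]"
        using True T by (intro is_cycle_5I) (auto simp: adjacent_link_iff[OF K])
      then have "has_diagonal (link K c) [x, y, z, t, s]"
        using large[OF T(1)] unfolding large_def by simp
      then show ?thesis
        using has_diagonal_5[of "link K c" x y z t s] unfolding adjacent_link_iff[OF K] by fast
    qed
  qed
qed

lemma systolic_trivial_cover:
  assumes sys: "systolic K" and c: "{c} \<in> K"
  shows "\<exists>V A. trivial_cover K c V A"
proof -
  have K: "simplicial_complex K" "simply_connected_space (realization K)"
    using sys unfolding systolic_def by blast+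
  obtain V A where "universal_cover K c V A"
    using locally_six_large.universal_cover_exists[OF systolic_locally_six_large[OF sys] c] by blast
  then interpret universal_cover K c V A .
  have "trivial_cover K c V A"
  proof unfold_locales
    show "x = y" if "A\<^sup>*\<^sup>* x y" "last x = last y" for x y
    proof (rule simply_connected_lift_closed[OF K, where A = A and f = last])
      show "A x x" if "A x y" for x y by (rule A_refl[OF A_V(1)[OF that]])
      show "\<exists>x. A y x \<and> last x = z" if "A y y" "{last y, z} \<in> K" for y z
        by (rule lift[OF A_V(1)[OF that(1)] that(2)])
    qed (fact A_sym A_E full A_inj that)+
  qed
  then show ?thesis by blast
qed

lemma systolic_triangle_filled:
  assumes sys: "systolic K" and a: "adjacent K x y" "adjacent K y z" "adjacent K x z"
  shows "{x, y, z} \<in> K"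
proof -
  have "simplicial_complex K" using sys unfolding systolic_def by blast
  then have "{x} \<in> K" using simplicial_complex_face[of K "{x, y}" "{x}"] a unfolding adjacent_def by blast
  then obtain V A where "trivial_cover K x V A" using systolic_trivial_cover[OF sys] by blast
  then show ?thesis
    using trivial_cover.triangle_filled[of K x V A y z] a unfolding adjacent_def by blast
qed

text \<open>Filled triangles make \<open>S\<close> without \<open>x\<close> a clique in the link of
  \<open>x\<close>, and links are flag by hypothesis.\<close>

lemma systolic_clique:
  assumes sys: "systolic K" and S: "finite S" "S \<noteq> {}" "S \<subseteq> vertices K"
    and adj: "\<And>x y. \<lbrakk>x \<in> S; y \<in> S; x \<noteq> y\<rbrakk> \<Longrightarrow> adjacent K x y"
  shows "S \<in> K"
proof -
  have K: "simplicial_complex K" using sys unfolding systolic_def by blast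
  note face = simplicial_complex_face[OF K]
  obtain x where x: "x \<in> S" using S by blast
  show ?thesis
  proof (cases "S = {x}")
    case True
    obtain \<sigma> where "\<sigma> \<in> K" "x \<in> \<sigma>" using x S(3) unfolding vertices_def by blast
    then show ?thesis using face[of \<sigma> "{x}"] True by simp
  next
    case False
    let ?S = "S - {x}"
    have "y \<in> vertices (link K x)" if "y \<in> ?S" for y
    proof -
      have "{x, y} \<in> K" using adj[of x y] that x unfolding adjacent_def by blast
      then have "{y} \<in> link K x" using face[of "{x, y}" "{y}"] that unfolding link_def by auto
      then show ?thesis unfolding vertices_def by blast
    qed
    moreover have "adjacent (link K x) y z" if "y \<in> ?S" "z \<in> ?S" "y \<noteq> z" for y z
      unfolding adjacent_link_iff[OF K]
      using systolic_triangle_filled[OF sys adj adj adj, of x y z] that x by auto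
    moreover have "?S \<noteq> {}" "finite ?S" using False x S by auto
    moreover have "flag_complex (link K x)"
      using sys x S(3) unfolding systolic_def large_def by auto
    ultimately have "?S \<in> link K x"
      by (intro flag_complexD) auto
    then show ?thesis using x unfolding link_def by (simp add: insert_absorb)
  qed
qed

lemma systolic_bridged:
  assumes sys: "systolic K"
  shows "bridged (\<lambda>x y. x = y \<or> adjacent K x y)"
proof -
  define R where "R x y \<longleftrightarrow> x = y \<or> adjacent K x y" for x y
  have K: "simplicial_complex K" using sys unfolding systolic_def by blast
  note face = simplicial_complex_face[OF K]
  have R_E: "R x y \<longleftrightarrow> x = y \<or> {x, y} \<in> K" for x y
    unfolding R_def adjacent_def by blast
  have sym: "R y x" if "R x y" for x y
    using that unfolding R_E by (auto simp: insert_commute)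
  \<comment> \<open>The type may contain points that are not vertices of \<open>K\<close>; such a
    point is alone in all its balls.\<close>
  have isolated: "x = c" if "(R ^^ k) c x" "{c} \<notin> K" for k c x
    using that(1)
  proof (induction k arbitrary: x)
    case (Suc k)
    then obtain y where "(R ^^ k) c y" "R y x" by (meson relpowp_Suc_E)
    then have "R c x" using Suc.IH by blast
    then show ?case using face[of "{c, x}" "{c}"] that(2) unfolding R_E by blast
  qed simp
  have loop: "(R ^^ k) c c" for k c
  proof (induction k)
    case (Suc k)
    then show ?case using relpowp_Suc_I[of k R c c c] unfolding R_def by blast
  qed simp
  have cover: "\<exists>V A. trivial_cover K c V A \<and> trivial_cover.R K = R" if c: "{c} \<in> K" for c
  proof -
    obtain V A where VA: "trivial_cover K c V A" using systolic_trivial_cover[OF sys c] by blast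
    then have "trivial_cover.R K = R"
      unfolding fun_eq_iff by (simp add: trivial_cover.R_def[OF VA] R_E)
    then show ?thesis using VA by blast
  qed
  have tri: "\<exists>z. (R ^^ k) c z \<and> R z x \<and> R z y"
    if xy: "(R ^^ Suc k) c x" "(R ^^ Suc k) c y" "R x y" for k c x y
  proof (cases "{c} \<in> K")
    case True
    then obtain V A where VA: "trivial_cover K c V A" "trivial_cover.R K = R" using cover by blast
    show ?thesis using trivial_cover.triangle_condition[OF VA(1)] xy unfolding VA(2) by blast
  next
    case False
    then have "x = c" "y = c" using isolated xy by blast+
    then show ?thesis using loop unfolding R_def by blast
  qed
  have conv: "(R ^^ k) c x \<or> R y z"
    if xy: "(R ^^ k) c y" "(R ^^ k) c z" "R x y" "R x z" for k c x y z
  proof (cases "{c} \<in> K")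
    case True
    then obtain V A where VA: "trivial_cover K c V A" "trivial_cover.R K = R" using cover by blast
    show ?thesis using trivial_cover.ball_convex[OF VA(1)] xy unfolding VA(2) by blast
  next
    case False
    then have "y = c" "z = c" using isolated xy by blast+
    then show ?thesis unfolding R_def by blast
  qed
  have R1: "(R ^^ Suc 0) x y \<longleftrightarrow> R x y" for x y
    by (auto simp: relcompp_apply)
  have R2: "(R ^^ Suc (Suc 0)) x y" if "R x z" "R z y" for x y z
    using that R1 by (auto intro: relpowp_Suc_I)
  have quad: "R a c \<or> R b d" if "R a b" "R b c" "R c d" "R d a" for a b c d
    using conv[of "Suc 0" a b d c] that sym unfolding R1 by blast
  \<comment> \<open>In a pentagon without diagonals, the triangle condition from \<open>a\<close> on
    the edge \<open>c d\<close> gives \<open>z\<close>, which quadrangles make adjacent to all five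
    vertices. With triangles filled, the pentagon lies in the link of \<open>z\<close>, where it has
    a diagonal.\<close>
  have pent: "R a c \<or> R a d \<or> R b d \<or> R b e \<or> R c e"
    if abc: "R a b" "R b c" "R c d" "R d e" "R e a" for a b c d e
  proof (rule ccontr)
    assume N: "\<not> ?thesis"
    obtain z where z: "R a z" "R z c" "R z d"
      using tri[of "Suc 0" a c d] R2[of a b c] R2[of a e d] abc sym unfolding R1 by blast
    have zb: "R z b" "R z e"
      using quad[of a b c z] quad[of a e d z] z abc sym N by blast+
    have ne: "z \<noteq> a" "z \<noteq> b" "z \<noteq> c" "z \<noteq> d" "z \<noteq> e"
      using z zb abc N sym by blast+
    have fill: "{z, x, y} \<in> K" if "R z x" "R z y" "R x y" "z \<noteq> x" "z \<noteq> y" for x y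
    proof (cases "x = y")
      case True
      then show ?thesis using that unfolding R_E by simp
    next
      case False
      then show ?thesis using systolic_triangle_filled[OF sys, of z x y] that unfolding R_def by blast
    qed
    have unfill: "R x y" if "{z, x, y} \<in> K" for x y
      using face[OF that, of "{x, y}"] unfolding R_E by blast
    have "R z a" using z sym by blast
    then have "{z, a, b} \<in> K" "{z, b, c} \<in> K" "{z, c, d} \<in> K" "{z, d, e} \<in> K" "{z, e, a} \<in> K"
      using fill z zb ne abc by blast+
    from locally_six_large.link_pentagon[OF systolic_locally_six_large[OF sys] this]
    show False using unfill N by blast
  qed
  have "bridged R"
    using sym tri conv pent by unfold_locales (auto simp: R_def)
  then show ?thesis unfolding R_def[abs_def] .
qed

section \<open>Dihedral groups acting on systolic complexes\<close>

locale dihedral_systolic =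
  fixes n :: nat and H :: "('g, 'm) monoid_scheme" and u v :: 'g
    and X :: "'v set set" and \<phi> :: "'g \<Rightarrow> 'v \<Rightarrow> 'v"
  assumes n: "1 \<le> n" "n \<le> 5"
    and dih: "dihedral_generated_by n H u v"
    and sys: "systolic X"
    and act: "simplicial_action H X \<phi>"
begin

abbreviation V :: "'v set" where "V \<equiv> vertices X"

definition R :: "'v \<Rightarrow> 'v \<Rightarrow> bool" where "R x y \<longleftrightarrow> x = y \<or> adjacent X x y"

sublocale group H
  using dih unfolding dihedral_generated_by_def by blast

sublocale action: group_action H V \<phi>
  using act unfolding simplicial_action_def by blast

sublocale bridged R
  using systolic_bridged[OF sys] unfolding R_def[abs_def] .

lemma uv_closed [simp]: "u \<in> carrier H" "v \<in> carrier H"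
  using dih unfolding dihedral_generated_by_def by blast+

lemma involution: "u \<otimes>\<^bsub>H\<^esub> u = \<one>\<^bsub>H\<^esub>" "v \<otimes>\<^bsub>H\<^esub> v = \<one>\<^bsub>H\<^esub>"
proof -
  have "u [^]\<^bsub>H\<^esub> (2::nat) = \<one>\<^bsub>H\<^esub>" "v [^]\<^bsub>H\<^esub> (2::nat) = \<one>\<^bsub>H\<^esub>"
    using dih pow_ord_eq_1[of u] pow_ord_eq_1[of v] unfolding dihedral_generated_by_def by metis+
  then show "u \<otimes>\<^bsub>H\<^esub> u = \<one>\<^bsub>H\<^esub>" "v \<otimes>\<^bsub>H\<^esub> v = \<one>\<^bsub>H\<^esub>"
    by (simp_all add: numeral_2_eq_2)
qed

definition \<rho> :: 'g where "\<rho> = u \<otimes>\<^bsub>H\<^esub> v"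

lemma \<rho>_closed [simp]: "\<rho> \<in> carrier H"
  unfolding \<rho>_def by simp

lemma u_\<rho>: "u \<otimes>\<^bsub>H\<^esub> \<rho> = v"
  unfolding \<rho>_def using involution by (simp add: m_assoc[symmetric])

lemma inv_\<rho>: "inv\<^bsub>H\<^esub> \<rho> = v \<otimes>\<^bsub>H\<^esub> u"
  using inv_equality[of "v \<otimes>\<^bsub>H\<^esub> u" \<rho>] involution u_\<rho> by (simp add: m_assoc)

lemma u_pow: "u \<otimes>\<^bsub>H\<^esub> \<rho> [^]\<^bsub>H\<^esub> (k::int) = \<rho> [^]\<^bsub>H\<^esub> (- k) \<otimes>\<^bsub>H\<^esub> u"
proof -
  have inv_u: "inv\<^bsub>H\<^esub> \<rho> \<otimes>\<^bsub>H\<^esub> u = u \<otimes>\<^bsub>H\<^esub> \<rho>"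
    unfolding inv_\<rho> u_\<rho> using involution by (simp add: m_assoc)
  have nat: "u \<otimes>\<^bsub>H\<^esub> \<rho> [^]\<^bsub>H\<^esub> int k = \<rho> [^]\<^bsub>H\<^esub> (- int k) \<otimes>\<^bsub>H\<^esub> u" for k
  proof (induction k)
    case (Suc k)
    have "u \<otimes>\<^bsub>H\<^esub> \<rho> [^]\<^bsub>H\<^esub> int (Suc k) = u \<otimes>\<^bsub>H\<^esub> \<rho> [^]\<^bsub>H\<^esub> int k \<otimes>\<^bsub>H\<^esub> \<rho>"
      using int_pow_mult[of \<rho> "int k" 1] by (simp add: m_assoc add.commute)
    also have "\<dots> = \<rho> [^]\<^bsub>H\<^esub> (- int k) \<otimes>\<^bsub>H\<^esub> (u \<otimes>\<^bsub>H\<^esub> \<rho>)"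
      unfolding Suc by (simp add: m_assoc)
    also have "\<dots> = \<rho> [^]\<^bsub>H\<^esub> (- int k) \<otimes>\<^bsub>H\<^esub> \<rho> [^]\<^bsub>H\<^esub> (- 1 :: int) \<otimes>\<^bsub>H\<^esub> u"
      by (simp add: m_assoc int_pow_neg inv_u[symmetric])
    also have "\<dots> = \<rho> [^]\<^bsub>H\<^esub> (- int (Suc k)) \<otimes>\<^bsub>H\<^esub> u"
    proof -
      have e: "- int (Suc k) = - int k + - 1" by simp
      show ?thesis unfolding e int_pow_mult[OF \<rho>_closed] ..
    qed
    finally show ?case .
  qed simp
  show ?thesis
  proof (cases "k \<ge> 0")
    case True
    then show ?thesis using nat[of "nat k"] by simp
  next
    case False
    define p q where "p = \<rho> [^]\<^bsub>H\<^esub> k" and "q = \<rho> [^]\<^bsub>H\<^esub> (- k)"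
    have c: "p \<in> carrier H" "q \<in> carrier H" unfolding p_def q_def by simp_all
    have qp: "q \<otimes>\<^bsub>H\<^esub> p = \<one>\<^bsub>H\<^esub>"
      unfolding p_def q_def int_pow_mult[OF \<rho>_closed, symmetric] by simp
    have uq: "u \<otimes>\<^bsub>H\<^esub> q = p \<otimes>\<^bsub>H\<^esub> u"
      using nat[of "nat (- k)"] False unfolding p_def q_def by simp
    have "u \<otimes>\<^bsub>H\<^esub> p = (q \<otimes>\<^bsub>H\<^esub> p) \<otimes>\<^bsub>H\<^esub> (u \<otimes>\<^bsub>H\<^esub> p)"
      unfolding qp using c by simp
    also have "\<dots> = q \<otimes>\<^bsub>H\<^esub> (p \<otimes>\<^bsub>H\<^esub> u) \<otimes>\<^bsub>H\<^esub> p" using c by (simp add: m_assoc)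
    also have "\<dots> = q \<otimes>\<^bsub>H\<^esub> u \<otimes>\<^bsub>H\<^esub> (q \<otimes>\<^bsub>H\<^esub> p)" unfolding uq[symmetric] using c by (simp add: m_assoc)
    also have "\<dots> = q \<otimes>\<^bsub>H\<^esub> u" unfolding qp using c by simp
    finally show ?thesis unfolding p_def q_def .
  qed
qed

text \<open>The cycle \<open>1, u, u v, u v u, ...\<close> of the Cayley graph: right multiplication
  by \<open>u\<close> or \<open>v\<close> moves to a neighbouring index, and left multiplication
  acts by rotations and reflections of the indices. Since \<open>div\<close> rounds down,
  \<open>el (- 1) = v\<close>.\<close>

definition el :: "int \<Rightarrow> 'g" where
  "el i = (if even i then \<rho> [^]\<^bsub>H\<^esub> (i div 2) else \<rho> [^]\<^bsub>H\<^esub> (i div 2) \<otimes>\<^bsub>H\<^esub> u)"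

lemma el_closed [simp]: "el i \<in> carrier H"
  unfolding el_def by simp

lemma el_0: "el 0 = \<one>\<^bsub>H\<^esub>" and el_1: "el 1 = u"
  unfolding el_def by simp_all

lemma pow_el: "\<rho> [^]\<^bsub>H\<^esub> k \<otimes>\<^bsub>H\<^esub> el i = el (i + 2 * k)"
proof -
  have "\<rho> [^]\<^bsub>H\<^esub> k \<otimes>\<^bsub>H\<^esub> \<rho> [^]\<^bsub>H\<^esub> (i div 2) = \<rho> [^]\<^bsub>H\<^esub> (i div 2 + k)"
    using int_pow_mult[OF \<rho>_closed, of k "i div 2"] by (simp only: add.commute)
  then show ?thesis
    unfolding el_def by (simp add: m_assoc[symmetric] add.commute[of k])
qed

lemma u_el: "u \<otimes>\<^bsub>H\<^esub> el i = el (1 - i)"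
proof (cases "even i")
  case True
  then obtain k where "i = 2 * k" by blast
  then have "i div 2 = k" "(1 - i) div 2 = - k" "odd (1 - i)" by auto
  then show ?thesis unfolding el_def using True u_pow[of k] by simp
next
  case False
  then obtain k where "i = 2 * k + 1" by (elim oddE)
  then have "i div 2 = k" "(1 - i) div 2 = - k" "even (1 - i)" by auto
  then show ?thesis
    unfolding el_def using False by (simp add: m_assoc[symmetric] u_pow) (simp add: m_assoc involution)
qed

lemma v_el: "v \<otimes>\<^bsub>H\<^esub> el i = el (- 1 - i)"
proof -
  have "v \<otimes>\<^bsub>H\<^esub> el i = u \<otimes>\<^bsub>H\<^esub> (\<rho> [^]\<^bsub>H\<^esub> (1::int) \<otimes>\<^bsub>H\<^esub> el i)"
    using m_assoc[of u \<rho> "el i"] by (simp add: u_\<rho>)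
  also have "\<dots> = el (1 - (i + 2))" unfolding pow_el u_el by simp
  finally show ?thesis by simp
qed

lemma el_period: "el (i + 2 * int n) = el i"
proof -
  have "\<rho> [^]\<^bsub>H\<^esub> n = \<one>\<^bsub>H\<^esub>"
    using dih pow_ord_eq_1[of \<rho>] unfolding dihedral_generated_by_def \<rho>_def by simp
  then show ?thesis using pow_el[of "int n" i] by (simp add: int_pow_int)
qed

lemma el_surj:
  assumes "g \<in> carrier H"
  shows "\<exists>i. g = el i"
proof -
  \<comment> \<open>Stated for all \<open>i\<close> so that a product can be absorbed one factor at
    a time.\<close>
  have "\<forall>i. \<exists>j. g \<otimes>\<^bsub>H\<^esub> el i = el j" if "g \<in> generate H {u, v}" for g
    using that
  proof induction
    case one
    then show ?case by (metis l_one el_closed)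
  next
    case (incl h)
    then show ?case using u_el v_el by blast
  next
    case (inv h)
    have "inv\<^bsub>H\<^esub> u = u" "inv\<^bsub>H\<^esub> v = v"
      using inv_equality[of u u] inv_equality[of v v] involution by simp_all
    then show ?case using inv u_el v_el by auto
  next
    case (eng h1 h2)
    have "h1 \<in> carrier H" "h2 \<in> carrier H"
      using eng(1,2) generate_in_carrier[of "{u, v}"] by auto
    then show ?case using eng(3,4) by (metis m_assoc el_closed)
  qed
  moreover have "g \<in> generate H {u, v}"
    using assms dih unfolding dihedral_generated_by_def by simp
  ultimately show ?thesis using el_0 assms by (metis r_one)
qed

lemma act_closed: "g \<in> carrier H \<Longrightarrow> x \<in> V \<Longrightarrow> \<phi> g x \<in> V"
  using action.element_image by blast

lemma act_inv: "g \<in> carrier H \<Longrightarrow> x \<in> V \<Longrightarrow> \<phi> (inv\<^bsub>H\<^esub> g) (\<phi> g x) = x"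
  "g \<in> carrier H \<Longrightarrow> x \<in> V \<Longrightarrow> \<phi> g (\<phi> (inv\<^bsub>H\<^esub> g) x) = x"
proof -
  have one: "\<phi> \<one>\<^bsub>H\<^esub> x = x" if "x \<in> V" for x
    using action.id_eq_one that by (metis restrict_apply')
  show "g \<in> carrier H \<Longrightarrow> x \<in> V \<Longrightarrow> \<phi> (inv\<^bsub>H\<^esub> g) (\<phi> g x) = x"
    "g \<in> carrier H \<Longrightarrow> x \<in> V \<Longrightarrow> \<phi> g (\<phi> (inv\<^bsub>H\<^esub> g) x) = x"
    using action.composition_rule[of x "inv\<^bsub>H\<^esub> g" g] action.composition_rule[of x g "inv\<^bsub>H\<^esub> g"] one
    by simp_all
qed

lemma adjacent_V: "adjacent X x y \<Longrightarrow> x \<in> V" "adjacent X x y \<Longrightarrow> y \<in> V"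
  unfolding adjacent_def vertices_def by blast+

lemma R_V: "R x y \<Longrightarrow> x \<in> V \<Longrightarrow> y \<in> V" "R x y \<Longrightarrow> y \<in> V \<Longrightarrow> x \<in> V"
  unfolding R_def using adjacent_V by blast+

lemma R_act:
  assumes g: "g \<in> carrier H" and R: "R x y"
  shows "R (\<phi> g x) (\<phi> g y)"
proof (cases "x = y")
  case False
  then have xy: "x \<in> V" "y \<in> V" "{x, y} \<in> X"
    using R adjacent_V unfolding R_def adjacent_def vertices_def by blast+
  then have "\<phi> g ` {x, y} \<in> X"
    using act g unfolding simplicial_action_def by blast
  then show ?thesis unfolding R_def adjacent_def by auto
qed simp

lemma B2_act: "g \<in> carrier H \<Longrightarrow> B2 x y \<Longrightarrow> B2 (\<phi> g x) (\<phi> g y)"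
  unfolding B2_def using R_act by blast

lemma B3_act: "g \<in> carrier H \<Longrightarrow> B3 x y \<Longrightarrow> B3 (\<phi> g x) (\<phi> g y)"
  unfolding B3_def using R_act B2_act by blast

text \<open>Successive vertices are the images of \<open>b\<close> and of \<open>\<phi> u b\<close>
  or \<open>\<phi> v b\<close> under one group element, so both edges at \<open>b\<close> determine
  the whole walk.\<close>

definition w :: "'v \<Rightarrow> int \<Rightarrow> 'v" where "w b i = \<phi> (el i) b"

lemma w_V: "b \<in> V \<Longrightarrow> w b i \<in> V"
  unfolding w_def using act_closed by simp

lemma w_0: "b \<in> V \<Longrightarrow> w b 0 = b"
  unfolding w_def el_0 using action.id_eq_one by (metis restrict_apply')

lemma act_w:
  assumes "b \<in> V"
  shows "\<phi> (\<rho> [^]\<^bsub>H\<^esub> (k::int)) (w b i) = w b (i + 2 * k)" "\<phi> u (w b i) = w b (1 - i)"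
    "\<phi> v (w b i) = w b (- 1 - i)"
  unfolding w_def using assms action.composition_rule pow_el u_el v_el
  by (metis el_closed int_pow_closed \<rho>_closed uv_closed)+

lemma w_per: "w b (i + 2 * int n) = w b i"
  unfolding w_def el_period ..

lemma w_shift:
  assumes "b \<in> V" "c \<in> V" "R (w b i) (w c j)" "even k"
  shows "R (w b (i + k)) (w c (j + k))"
  using R_act[OF _ assms(3), of "\<rho> [^]\<^bsub>H\<^esub> (k div 2)"] act_w(1) assms by simp

lemma w_reflect:
  assumes "b \<in> V" "c \<in> V" "R (w b i) (w c j)"
  shows "R (w b (1 - i)) (w c (1 - j))"
  using R_act[OF _ assms(3), of u] act_w(2) assms by simp

lemma orbit_eq: "orbit H \<phi> b = range (w b)"
  unfolding orbit_def w_def using el_surj by fastforce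

lemma orbit_finite: "finite (orbit H \<phi> b)"
proof -
  have "card (carrier H) > 0"
    using dih n unfolding dihedral_generated_by_def order_def by simp
  then have "finite (carrier H)" using card_gt_0_iff by blast
  then show ?thesis unfolding orbit_def by (simp add: Setcompr_eq_image)
qed

lemma act_orbit:
  assumes "g \<in> carrier H" "b \<in> V"
  shows "\<phi> g ` orbit H \<phi> b = orbit H \<phi> b"
proof
  have sub: "\<phi> g ` orbit H \<phi> b \<subseteq> orbit H \<phi> b" if "g \<in> carrier H" for g
  proof -
    have "\<phi> g (\<phi> h b) = \<phi> (g \<otimes>\<^bsub>H\<^esub> h) b" if "h \<in> carrier H" for h
      using action.composition_rule assms \<open>g \<in> carrier H\<close> that by simp
    then show ?thesis using that unfolding orbit_def by fastforce
  qed
  show "\<phi> g ` orbit H \<phi> b \<subseteq> orbit H \<phi> b" using sub assms by blast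
  show "orbit H \<phi> b \<subseteq> \<phi> g ` orbit H \<phi> b"
  proof
    fix x assume x: "x \<in> orbit H \<phi> b"
    then have "x \<in> V" using w_V assms(2) unfolding orbit_eq by blast
    moreover have "\<phi> (inv\<^bsub>H\<^esub> g) x \<in> orbit H \<phi> b" using sub[of "inv\<^bsub>H\<^esub> g"] x assms(1) by blast
    ultimately show "x \<in> \<phi> g ` orbit H \<phi> b" using act_inv(2)[OF assms(1)] by (metis imageI)
  qed
qed

lemma orbit_simplex:
  assumes "b \<in> V" "\<And>i j. R (w b i) (w b j)"
  shows "orbit H \<phi> b \<in> X"
proof (rule systolic_clique[OF sys orbit_finite])
  show "orbit H \<phi> b \<noteq> {}" "orbit H \<phi> b \<subseteq> V"
    unfolding orbit_eq using w_V[OF assms(1)] by auto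
  show "adjacent X x y" if "x \<in> orbit H \<phi> b" "y \<in> orbit H \<phi> b" "x \<noteq> y" for x y
    using that assms(2) unfolding orbit_eq R_def by blast
qed

lemma walk_step:
  assumes b: "b \<in> V" and "R b (\<phi> u b)" "R b (\<phi> v b)"
  shows "R (w b i) (w b (i + 1))"
proof -
  have 1: "R (w b 0) (w b 1)" "R (w b (- 1)) (w b 0)"
    using assms act_w(2,3)[OF b, of 0] w_0[OF b] sym by auto
  show ?thesis
  proof (cases "even i")
    case True
    then show ?thesis using w_shift[OF b b 1(1), of i] by (simp add: add.commute)
  next
    case False
    then show ?thesis using w_shift[OF b b 1(2), of "i + 1"] by simp
  qed
qed

lemma orbit_complete:
  assumes b: "b \<in> V" and step: "\<And>i. R (w b i) (w b (i + 1))"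
    and diag: "n \<le> 2 \<or> (\<exists>i j. R (w b i) (w b j) \<and> (j - i) mod (2 * int n) \<notin> {0, 1, 2 * int n - 1})"
  shows "R (w b i) (w b j)"
  by (rule dihedral_walk_complete[of n "w b", OF n w_per step w_shift[OF b b] w_reflect[OF b b] diag])

end

section \<open>The clique joined to the orbit cycle\<close>

context dihedral_systolic begin

lemma walk_induced_cycle:
  assumes a: "a \<in> V" and step: "\<And>i. R (w a i) (w a (i + 1))"
    and inc: "\<not> R (w a i) (w a j)"
  shows "3 \<le> n \<and> induced_cycle (2 * int n) (w a)"
proof -
  have "\<not> (n \<le> 2 \<or> (\<exists>i j. R (w a i) (w a j) \<and> (j - i) mod (2 * int n) \<notin> {0, 1, 2 * int n - 1}))"
    using orbit_complete[OF a step] inc by blast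
  then have "\<not> n \<le> 2" "\<And>i j. R (w a i) (w a j) \<Longrightarrow> (j - i) mod (2 * int n) \<in> {0, 1, 2 * int n - 1}"
    by blast+
  then show ?thesis
    using step w_per unfolding induced_cycle_def by simp
qed

lemma walk_five_star:
  assumes a: "a \<in> V" and "3 \<le> n" and cyc: "induced_cycle (2 * int n) (w a)"
  shows "five_star (w a)"
proof -
  consider "n = 3" | "n = 4" | "n = 5" using assms(2) n by linarith
  then show ?thesis
  proof cases
    case 1
    note adj = induced_cycleD(2)[OF cyc] and nR = induced_cycleD(3)[OF cyc] and per = induced_cycleD(1)[OF cyc]
    have "R (w a 0) (w a 1)" "R (w a 1) (w a 2)" "R (w a 2) (w a 3)" "R (w a 3) (w a 4)" "R (w a 4) (w a 5)"
      "R (w a 5) (w a 0)"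
      using adj[of 0] adj[of 1] adj[of 2] adj[of 3] adj[of 4] adj[of 5] per[of 0] 1 by auto
    moreover have "\<not> R (w a 0) (w a 2)" "\<not> R (w a 0) (w a 3)" "\<not> R (w a 0) (w a 4)" "\<not> R (w a 1) (w a 3)"
      "\<not> R (w a 1) (w a 4)" "\<not> R (w a 1) (w a 5)" "\<not> R (w a 2) (w a 4)" "\<not> R (w a 2) (w a 5)"
      "\<not> R (w a 3) (w a 5)"
      using nR[of 0 2] nR[of 0 3] nR[of 0 4] nR[of 1 3] nR[of 1 4] nR[of 1 5] nR[of 2 4] nR[of 2 5]
        nR[of 3 5] 1 by auto
    ultimately obtain c where "R c (w a 0)" "R c (w a 1)" "R c (w a 2)" "R c (w a 3)" "R c (w a 4)"
      using hexagon[of "w a 0" "w a 1" "w a 2" "w a 3" "w a 4" "w a 5"] by blast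
    then show ?thesis
      unfolding five_star_def by (intro exI[of _ c] exI[of _ 0]) simp
  next
    case 2
    then show ?thesis using octagon cyc by simp
  next
    case 3
    show ?thesis
    proof (rule decagon)
      show "induced_cycle 10 (w a)" using cyc 3 by simp
      show "B2 (w a (i + k)) (w a (j + k))" if "even k" "B2 (w a i) (w a j)" for i j k
        using B2_act[OF _ that(2), of "\<rho> [^]\<^bsub>H\<^esub> (k div 2)"] act_w(1)[OF a] that(1) by simp
      show "B3 (w a (i + k)) (w a (j + k))" if "even k" "B3 (w a i) (w a j)" for i j k
        using B3_act[OF _ that(2), of "\<rho> [^]\<^bsub>H\<^esub> (k div 2)"] act_w(1)[OF a] that(1) by simp
    qed
  qed
qed

lemma five_star_centred:
  assumes a: "a \<in> V" and star: "five_star (w a)"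
  shows "\<exists>b\<in>V. \<forall>j\<in>{-2..2}. R b (w a j)"
proof -
  obtain y s where y: "R y (w a s)" "R y (w a (s + 1))" "R y (w a (s + 2))" "R y (w a (s + 3))" "R y (w a (s + 4))"
    using star unfolding five_star_def by blast
  have yV: "y \<in> V" using R_V(2)[OF y(1)] w_V[OF a] by blast
  have y': "R y (w a (s + j))" if "j \<in> {0..4}" for j
  proof -
    have "j = 0 \<or> j = 1 \<or> j = 2 \<or> j = 3 \<or> j = 4" using that by auto
    then show ?thesis using y by auto
  qed
  have *: "\<exists>b\<in>V. \<forall>j\<in>{-2..2}. R b (w a j)"
    if y: "y \<in> V" "\<And>j. j \<in> {0..4} \<Longrightarrow> R y (w a (s + j))" and s: "even s" for y s
  proof (intro bexI ballI)
    \<comment> \<open>This rotation shifts indices by \<open>- (s + 2)\<close> and thus centres the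
      run at 0.\<close>
    let ?g = "\<rho> [^]\<^bsub>H\<^esub> (- (s + 2) div 2)"
    show "\<phi> ?g y \<in> V" using act_closed y by simp
    fix j :: int assume "j \<in> {-2..2}"
    then have "R y (w a (s + (j + 2)))" by (intro y(2)) auto
    from R_act[OF _ this, of ?g] show "R (\<phi> ?g y) (w a j)"
      using act_w(1)[OF a] s by (simp add: algebra_simps)
  qed
  show ?thesis
  proof (cases "even s")
    case True
    then show ?thesis using *[OF yV y'] by blast
  next
    case False
    show ?thesis
    \<comment> \<open>Rotations shift by even amounts only. The reflection
      \<open>i \<mapsto> 1 - i\<close> turns the run from \<open>s\<close> to \<open>s + 4\<close>
      into one that starts at the even index \<open>- 3 - s\<close>.\<close>
    proof (rule *[of "\<phi> u y" "- 3 - s"])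
      show "\<phi> u y \<in> V" using act_closed yV by simp
      show "R (\<phi> u y) (w a (- 3 - s + j))" if "j \<in> {0..4}" for j
        using R_act[OF _ y'[of "4 - j"], of u] act_w(2)[OF a] that by (simp add: algebra_simps)
    qed (use False in simp)
  qed
qed

text \<open>If \<open>b\<close> is adjacent to \<open>w a (-2), \<dots>, w a 2\<close>, then its orbit is a clique. Neighbourhoods in this
  clique of consecutive vertices of the cycle are nested since there are no induced quadrangles, and
  they have the same size since the group acts transitively; hence all of them coincide.\<close>

lemma common_neighbour:
  assumes a: "a \<in> V" and n3: "3 \<le> n" and cyc: "induced_cycle (2 * int n) (w a)"
    and b: "b \<in> V" "\<And>j. j \<in> {-2..2} \<Longrightarrow> R b (w a j)"
  shows "R (w b i) (w b j)" "R b (w a j)"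
proof -
  note nR = induced_cycleD(3)[OF cyc]
  have n1: "\<not> R (w a (- 1)) (w a 1)" "\<not> R (w a 0) (w a 2)"
    using nR[of "-1" 1] nR[of 0 2] n3 by auto
  have u: "R (\<phi> u b) (w a j)" if "j \<in> {-1..3}" for j
    using R_act[OF _ b(2)[of "1 - j"], of u] act_w(2)[OF a] that by simp
  have v: "R (\<phi> v b) (w a j)" if "j \<in> {-3..1}" for j
    using R_act[OF _ b(2)[of "- 1 - j"], of v] act_w(3)[OF a] that by simp
  have r: "R (w b 2) (w a j)" if "j \<in> {0..4}" for j
    using R_act[OF _ b(2)[of "j - 2"], of "\<rho> [^]\<^bsub>H\<^esub> (1::int)"] act_w(1)[OF a, of 1 "j - 2"]
      act_w(1)[OF b(1), of 1 0] w_0[OF b(1)] that by simp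
  have "R b (\<phi> u b)"
    using quad[of "w a (- 1)" b "w a 1" "\<phi> u b"] b(2)[of "-1"] b(2)[of 1] u[of "-1"] u[of 1] n1 sym by auto
  moreover have "R b (\<phi> v b)"
    using quad[of "w a (- 1)" b "w a 1" "\<phi> v b"] b(2)[of "-1"] b(2)[of 1] v[of "-1"] v[of 1] n1 sym by auto
  ultimately have step: "R (w b i) (w b (i + 1))" for i
    by (rule walk_step[OF b(1)])
  \<comment> \<open>This is the diagonal of the walk of \<open>b\<close> that
    \<open>orbit_complete\<close> needs.\<close>
  have "R (w b 0) (w b 2)"
    using quad[of "w a 0" b "w a 2" "w b 2"] b(2)[of 0] b(2)[of 2] r[of 0] r[of 2] n1 w_0[OF b(1)] sym by auto
  moreover have "(2 - 0) mod (2 * int n) \<notin> {0, 1, 2 * int n - 1}"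
    using n3 by auto
  ultimately have clique: "R (w b i) (w b j)" for i j
    using orbit_complete[OF b(1) step] by blast
  then show "R (w b i) (w b j)" .
  define N where "N x = {k \<in> orbit H \<phi> b. R k x}" for x
  have finN: "finite (N x)" for x
    unfolding N_def using orbit_finite by simp
  have N_act: "N (\<phi> g x) = \<phi> g ` N x" if g: "g \<in> carrier H" and x: "x \<in> V" for g x
  proof
    show "\<phi> g ` N x \<subseteq> N (\<phi> g x)"
      unfolding N_def using act_orbit[OF g b(1)] R_act[OF g] by blast
    show "N (\<phi> g x) \<subseteq> \<phi> g ` N x"
    proof
      fix k assume k: "k \<in> N (\<phi> g x)"
      let ?h = "inv\<^bsub>H\<^esub> g"
      have kV: "k \<in> V" using k w_V[OF b(1)] unfolding N_def orbit_eq by blast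
      have "R (\<phi> ?h k) x"
        using R_act[of ?h k "\<phi> g x"] k g act_inv(1)[OF g x] unfolding N_def by simp
      moreover have "\<phi> ?h k \<in> orbit H \<phi> b"
        using act_orbit[of ?h b] g b(1) k unfolding N_def by blast
      ultimately show "k \<in> \<phi> g ` N x"
        using act_inv(2)[OF g kV] unfolding N_def by (metis (mono_tags, lifting) imageI mem_Collect_eq)
    qed
  qed
  have card: "card (N (w a j)) = card (N a)" for j
  proof -
    have "N (w a j) = \<phi> (el j) ` N a"
      unfolding w_def using N_act[of "el j" a] a by simp
    moreover have "N a \<subseteq> V"
      using w_V[OF b(1)] unfolding N_def orbit_eq by blast
    then have "inj_on (\<phi> (el j)) (N a)"
      by (rule inj_on_subset[OF action.inj_prop[OF el_closed]])
    ultimately show ?thesis by (simp add: card_image)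
  qed
  have nested: "N (w a j) \<subseteq> N (w a (j + 1)) \<or> N (w a (j + 1)) \<subseteq> N (w a j)" for j
  proof (rule ccontr)
    assume "\<not> ?thesis"
    then obtain p q where pq: "p \<in> N (w a j)" "p \<notin> N (w a (j + 1))" "q \<in> N (w a (j + 1))" "q \<notin> N (w a j)"
      by blast
    then have "q \<in> range (w b)" "p \<in> range (w b)" unfolding N_def orbit_eq by blast+
    then have "R q p" using clique by blast
    moreover have "R p (w a j)" "R q (w a (j + 1))" "\<not> R p (w a (j + 1))" "\<not> R q (w a j)"
      using pq unfolding N_def by blast+
    ultimately show False
      using quad[of p "w a j" "w a (j + 1)" q] induced_cycleD(2)[OF cyc, of j] sym by blast
  qed
  have eq: "N (w a (j + 1)) = N (w a j)" for j
    using nested[of j] card_subset_eq[OF finN, of "N (w a j)" "w a (j + 1)"]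
      card_subset_eq[OF finN, of "N (w a (j + 1))" "w a j"] card[of j] card[of "j + 1"] by metis
  have "N (w a j) = N (w a 0)" for j
  proof (induction j rule: int_induct[of _ 0])
    case (step2 i)
    then show ?case using eq[of "i - 1"] by simp
  qed (use eq in auto)
  moreover have "b \<in> N (w a 0)"
    using b(2)[of 0] w_0[OF b(1)] unfolding N_def orbit_eq by (auto intro: range_eqI[of _ _ 0])
  ultimately show "R b (w a j)" unfolding N_def by blast
qed

lemma walk_cycle:
  assumes a: "a \<in> V" and n3: "3 \<le> n" and cyc: "induced_cycle (2 * int n) (w a)"
  defines "c \<equiv> map (\<lambda>k. w a (int k)) [0..<2 * n]"
  shows "is_cycle X c" "length c = 2 * n" "set c = orbit H \<phi> a" "\<not> has_diagonal X c"
proof -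
  note step = induced_cycleD(2)[OF cyc] and nR = induced_cycleD(3)[OF cyc] and per = induced_cycleD(1)[OF cyc]
  show len: "length c = 2 * n" unfolding c_def by simp
  have nth: "c ! k = w a (int k)" if "k < 2 * n" for k
    using that unfolding c_def by simp
  have mod: "w a i = w a j" if "i mod (2 * int n) = j mod (2 * int n)" for i j
    using periodic_mod[of "w a", OF per that] .
  have nth_Suc: "c ! (Suc k mod (2 * n)) = w a (int k + 1)" if "k < 2 * n" for k
  proof -
    have "int (Suc k mod (2 * n)) mod (2 * int n) = (int k + 1) mod (2 * int n)"
      by (simp add: zmod_int add.commute)
    from mod[OF this] show ?thesis using nth[of "Suc k mod (2 * n)"] n3 by simp
  qed
  \<comment> \<open>If vertices at index distance 1 coincided, then \<open>w a i\<close> would also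
    be adjacent to a vertex at index distance 2, contrary to \<open>nR\<close>.\<close>
  have ne: "w a i \<noteq> w a j" if nz: "(j - i) mod (2 * int n) \<noteq> 0" for i j
  proof
    assume eq: "w a i = w a j"
    define d where "d = (j - i) mod (2 * int n)"
    have "j + 1 - i = (j - i) + 1" "j - 1 - i = (j - i) - 1" by simp_all
    then have shift: "(j + 1 - i) mod (2 * int n) = (d + 1) mod (2 * int n)"
      "(j - 1 - i) mod (2 * int n) = (d - 1) mod (2 * int n)"
      unfolding d_def by (simp_all only: mod_add_left_eq mod_diff_left_eq)
    have "R (w a i) (w a (j + 1))" "R (w a i) (w a (j - 1))"
      using step[of j] step[of "j - 1"] sym eq by auto
    then have d1: "(d + 1) mod (2 * int n) \<in> {0, 1, 2 * int n - 1}"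
      "(d - 1) mod (2 * int n) \<in> {0, 1, 2 * int n - 1}"
      using nR[of i "j + 1"] nR[of i "j - 1"] unfolding shift by blast+
    have two: "(1 + 1) mod (2 * int n) = 2" "(2 * int n - 1 - 1) mod (2 * int n) = 2 * int n - 2"
      using n3 by (simp_all only: mod_pos_pos_trivial)
    have "R (w a i) (w a j)" using eq by simp
    then consider "d = 1" | "d = 2 * int n - 1"
      using nR[of i j] nz unfolding d_def by blast
    then show False
    proof cases
      case 1
      then show False using d1(1) two n3 by simp
    next
      case 2
      then show False using d1(2) two n3 by simp
    qed
  qed
  have inj: "k = l" if "k < 2 * n" "l < 2 * n" "w a (int k) = w a (int l)" for k l
  proof (rule ccontr)
    assume "k \<noteq> l"
    have "(int l - int k) mod (2 * int n) \<noteq> 0"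
    proof
      assume "(int l - int k) mod (2 * int n) = 0"
      then have "int l mod (2 * int n) = int k mod (2 * int n)" by (simp add: mod_eq_dvd_iff dvd_eq_mod_eq_0)
      then show False using that \<open>k \<noteq> l\<close> by simp
    qed
    then show False using ne that by blast
  qed
  show "is_cycle X c"
    unfolding is_cycle_def len
  proof (intro conjI allI impI)
    show "3 \<le> 2 * n" using n3 by simp
    show "distinct c" unfolding c_def using inj by (auto simp: distinct_map inj_on_def)
    show "adjacent X (c ! k) (c ! (Suc k mod (2 * n)))" if "k < 2 * n" for k
    proof -
      have "w a (int k) \<noteq> w a (int k + 1)" using ne[of "int k + 1" "int k"] n3 by simp
      then show ?thesis using step[of "int k"] unfolding nth[OF that] nth_Suc[OF that] R_def by blast
    qed
  qed
  show "set c = orbit H \<phi> a"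
  proof
    show "set c \<subseteq> orbit H \<phi> a" unfolding c_def orbit_eq by auto
    show "orbit H \<phi> a \<subseteq> set c"
    proof
      fix x assume "x \<in> orbit H \<phi> a"
      then obtain i where x: "x = w a i" unfolding orbit_eq by blast
      let ?k = "nat (i mod (2 * int n))"
      have k: "int ?k = i mod (2 * int n)" using n3 by simp
      have "i mod (2 * int n) < 2 * int n" using n3 by simp
      then have "?k < 2 * n" using k by linarith
      moreover have "x = w a (int ?k)" unfolding x k by (rule mod) simp
      ultimately show "x \<in> set c" unfolding c_def set_map set_upt by (intro image_eqI[of _ _ ?k]) auto
    qed
  qed
  show "\<not> has_diagonal X c"
  proof
    assume "has_diagonal X c"
    then obtain k l where kl: "k < 2 * n" "l < 2 * n" "k \<noteq> l" "l \<noteq> Suc k mod (2 * n)" "k \<noteq> Suc l mod (2 * n)"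
      "adjacent X (c ! k) (c ! l)"
      unfolding has_diagonal_def len by blast
    then have "R (w a (int k)) (w a (int l))" using nth unfolding R_def by simp
    from nR[OF this] consider "(int l - int k) mod (2 * int n) = 0" | "(int l - int k) mod (2 * int n) = 1"
      | "(int l - int k) mod (2 * int n) = 2 * int n - 1" by blast
    then show False
    proof cases
      case 1
      have "w a (int l) = w a (int k + 0)" by (rule periodic_diff[of "w a", OF per 1])
      then show False using inj kl by simp
    next
      case 2
      have "w a (int l) = w a (int k + 1)" by (rule periodic_diff[of "w a", OF per 2])
      then have "c ! l = c ! (Suc k mod (2 * n))" using nth nth_Suc kl by simp
      then show False using inj[of l "Suc k mod (2 * n)"] nth kl n3 by simp
    next
      case 3
      have "(int l + 1) mod (2 * int n) = (int k + ((int l - int k) + 1)) mod (2 * int n)" by simp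
      also have "\<dots> = (int k + (2 * int n - 1 + 1)) mod (2 * int n)"
        unfolding 3[symmetric] by (metis mod_add_left_eq mod_add_right_eq)
      also have "\<dots> = int k mod (2 * int n)" by simp
      finally have "w a (int l + 1) = w a (int k)" by (rule mod)
      then have "c ! k = c ! (Suc l mod (2 * n))" using nth nth_Suc kl by simp
      then show False using inj[of k "Suc l mod (2 * n)"] nth kl n3 by simp
    qed
  qed
qed

lemma vertices_invariance:
  "x \<in> vertices (invariance_set X (\<phi> u) \<inter> invariance_set X (\<phi> v)) \<longleftrightarrow>
    x \<in> V \<and> R (\<phi> u x) x \<and> R (\<phi> v x) x"
proof
  assume "x \<in> vertices (invariance_set X (\<phi> u) \<inter> invariance_set X (\<phi> v))"
  then show "x \<in> V \<and> R (\<phi> u x) x \<and> R (\<phi> v x) x"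
    unfolding vertices_def invariance_set_def R_def by auto
next
  assume x: "x \<in> V \<and> R (\<phi> u x) x \<and> R (\<phi> v x) x"
  then obtain \<sigma> where "\<sigma> \<in> X" "x \<in> \<sigma>" unfolding vertices_def by blast
  then have "{x} \<in> X" using simplicial_complex_face[of X \<sigma> "{x}"] sys unfolding systolic_def by blast
  then have "{x} \<in> invariance_set X (\<phi> u) \<inter> invariance_set X (\<phi> v)"
    using x unfolding invariance_set_def R_def by auto
  then show "x \<in> vertices (invariance_set X (\<phi> u) \<inter> invariance_set X (\<phi> v))"
    unfolding vertices_def by blast
qed

lemma orbit_simplex_or_join:
  assumes a: "a \<in> vertices (invariance_set X (\<phi> u) \<inter> invariance_set X (\<phi> v))"
  shows "orbit H \<phi> a \<in> X \<or> 3 \<le> n \<and>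
    (\<exists>c. is_cycle X c \<and> length c = order H \<and> set c = orbit H \<phi> a \<and> \<not> has_diagonal X c \<and>
        (\<exists>b\<in>V. \<exists>S\<in>X. orbit H \<phi> b = S \<and> (\<forall>g\<in>carrier H. \<phi> g ` S = S) \<and>
           (\<forall>x\<in>set c. \<forall>y\<in>S. adjacent X x y) \<and>
           S \<subseteq> vertices (invariance_set X (\<phi> u) \<inter> invariance_set X (\<phi> v))))"
proof (cases "\<forall>i j. R (w a i) (w a j)")
  case True
  then show ?thesis using orbit_simplex[of a] a unfolding vertices_invariance by blast
next
  case False
  have aV: "a \<in> V" and "R a (\<phi> u a)" "R a (\<phi> v a)"
    using a sym unfolding vertices_invariance by blast+
  then have step: "R (w a i) (w a (i + 1))" for i by (rule walk_step)
  obtain n3: "3 \<le> n" and cyc: "induced_cycle (2 * int n) (w a)"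
    using walk_induced_cycle[OF aV step] False by blast
  obtain b where b: "b \<in> V" "\<And>j. j \<in> {-2..2} \<Longrightarrow> R b (w a j)"
    using five_star_centred[OF aV walk_five_star[OF aV n3 cyc]] by blast
  note clique = common_neighbour(1)[OF aV n3 cyc b] and join = common_neighbour(2)[OF aV n3 cyc b]
  have S: "orbit H \<phi> b \<in> X" using orbit_simplex[OF b(1) clique] .
  \<comment> \<open>\<open>b\<close> is adjacent to \<open>w a (j + 2)\<close>, but
    \<open>w a j\<close> is not.\<close>
  have ne: "b \<noteq> w a j" for j
    using join[of "j + 2"] induced_cycleD(3)[OF cyc, of j "j + 2"] n3 by auto
  \<comment> \<open>Any vertex of the clique is an image of \<open>b\<close>, and the orbit of
    \<open>a\<close> is invariant, so adjacency to the whole cycle is transported from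
    \<open>b\<close>.\<close>
  have adj: "adjacent X x y" if xy: "x \<in> orbit H \<phi> a" "y \<in> orbit H \<phi> b" for x y
  proof -
    obtain g where g: "g \<in> carrier H" "y = \<phi> g b" using xy(2) unfolding orbit_def by blast
    obtain x' where x': "x' \<in> orbit H \<phi> a" "x = \<phi> g x'"
      using xy(1) act_orbit[OF g(1) aV] by blast
    then obtain j where j: "x' = w a j" unfolding orbit_eq by blast
    have "R (\<phi> g x') (\<phi> g b)" using R_act[OF g(1)] join[of j] sym unfolding j by blast
    moreover have "\<phi> g x' \<noteq> \<phi> g b"
      using act_inv(1)[OF g(1)] w_V[OF aV] b(1) ne[of j] unfolding j by metis
    ultimately show ?thesis unfolding x' g R_def by blast
  qed
  have inv: "orbit H \<phi> b \<subseteq> vertices (invariance_set X (\<phi> u) \<inter> invariance_set X (\<phi> v))"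
  proof
    fix x assume "x \<in> orbit H \<phi> b"
    then obtain i where i: "x = w b i" unfolding orbit_eq by blast
    show "x \<in> vertices (invariance_set X (\<phi> u) \<inter> invariance_set X (\<phi> v))"
      unfolding vertices_invariance i act_w(2,3)[OF b(1)] using w_V[OF b(1)] clique by blast
  qed
  have "order H = 2 * n" using dih unfolding dihedral_generated_by_def by blast
  then show ?thesis
    using walk_cycle[OF aV n3 cyc] n3 S b(1) act_orbit[OF _ b(1)] adj inv by metis
qed

end

theorem proposition3p9:
  fixes n :: nat
    and H :: "('g, 'm) monoid_scheme" and u v :: 'g
    and X :: "'v set set" and \<phi> :: "'g \<Rightarrow> 'v \<Rightarrow> 'v" and a :: 'v
  assumes "1 \<le> n" and "n \<le> 5"
    and "dihedral_generated_by n H u v"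
    and "systolic X"
    and "simplicial_action H X \<phi>"
    and "a \<in> vertices (invariance_set X (\<phi> u) \<inter> invariance_set X (\<phi> v))"
  defines "case1 \<equiv> orbit H \<phi> a \<in> X"
    and "case2 \<equiv>
      (\<exists>c. is_cycle X c \<and> length c = order H \<and> set c = orbit H \<phi> a \<and> \<not> has_diagonal X c \<and>
        (\<exists>b\<in>vertices X. \<exists>S\<in>X. orbit H \<phi> b = S \<and> (\<forall>g\<in>carrier H. \<phi> g ` S = S) \<and>
           (\<forall>x\<in>set c. \<forall>y\<in>S. adjacent X x y) \<and>
           S \<subseteq> vertices (invariance_set X (\<phi> u) \<inter> invariance_set X (\<phi> v))))"
  shows "(case1 \<or> case2) \<and> (n \<in> {1, 2} \<longrightarrow> case1 \<and> \<not> case2)"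
proof -
  interpret dihedral_systolic n H u v X \<phi>
    using assms(1-5) by unfold_locales
  have main: "case1 \<or> 3 \<le> n \<and> case2"
    unfolding case1_def case2_def by (rule orbit_simplex_or_join[OF assms(6)])
  have "\<not> case2" if "n \<in> {1, 2}"
  proof
    assume "case2"
    then obtain c where c: "is_cycle X c" "length c = order H" "set c = orbit H \<phi> a" "\<not> has_diagonal X c"
      unfolding case2_def by blast
    have "order H = 2 * n" using assms(3) unfolding dihedral_generated_by_def by blast
    \<comment> \<open>A cycle has at least three vertices, which rules out
      \<open>n = 1\<close>.\<close>
    then have len: "length c = 4" using c(1,2) that unfolding is_cycle_def by auto
    \<comment> \<open>For \<open>n < 3\<close> the orbit spans a simplex, so opposite vertices of
      the 4-cycle are joined by a diagonal.\<close>
    have "set c \<in> X" using main that c(3) unfolding case1_def by auto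
    then have "{c ! 0, c ! 2} \<in> X"
      using len simplicial_complex_face[of X "set c" "{c ! 0, c ! 2}"] sys nth_mem[of _ c]
      unfolding systolic_def by simp
    moreover have "c ! 0 \<noteq> c ! 2"
      using c(1) len nth_eq_iff_index_eq[of c 0 2] unfolding is_cycle_def by simp
    ultimately have "(0::nat) < 4 \<and> (2::nat) < 4 \<and> (0::nat) \<noteq> 2 \<and> 2 \<noteq> Suc 0 mod 4 \<and> 0 \<noteq> Suc 2 mod 4 \<and>
        adjacent X (c ! 0) (c ! 2)"
      unfolding adjacent_def by simp
    then have "has_diagonal X c"
      unfolding has_diagonal_def len by blast
    then show False using c(4) by blast
  qed
  then show ?thesis using main by auto
qed

end
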